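(* Let $L$ be a computable language and let $\alpha\geq 2$ be a computable ordinal. Suppose $A$ and $B$ are disjoint subsets of $Mod(L)$, each axiomatized by a computable $\Pi_\alpha$ sentence (i.e. $A=Mod(\varphi)$ and $B=Mod(\psi)$ for some computable $\Pi_\alpha$ $L$-sentences $\varphi,\psi$). Then there is a separator of $A$ and $B$ (a set $S\subseteq Mod(L)$ with $A\subseteq S$ and $S\cap B=\emptyset$) that is the union of a countable family of sets each of which is axiomatized by a computable $d$-$\Sigma_{<\alpha}$ sentence.
   Context: $Mod(L)$ is the class of $L$-structures with universe $\omega$, and $Mod(\varphi)$ is the class of members of $Mod(L)$ satisfying $\varphi$. A set $K\subseteq Mod(L)$ is axiomatized by $\varphi$ if $K=Mod(\varphi)$. Computable infinitary formulas are formulas of $L_{\omega_1\omega}$ (with finitely many free variables) in which the infinite disjunctions and conjunctions are over c.e. sets. Precisely, for a computable ordinal $\alpha$ one fixes a notation for $\alpha$ in Kleene's $\mathcal{O}$, ordinals $\beta<\alpha$ being represented by the notations below it. A formula is computable $\Sigma_0$ and computable $\Pi_0$ if it is finitary quantifier-free. For $\alpha>0$, a computable $\Sigma_\alpha$ formula $\varphi(\bar x)$ is the disjunction of a c.e. set (a c.e. set of indices) of formulas $(\exists\bar u)\psi(\bar x,\bar u)$, where each $\psi$ is computable $\Pi_\beta$ for some $\beta<\alpha$; a computable $\Pi_\alpha$ formula $\varphi(\bar x)$ is the conjunction of a c.e. set of formulas $(\forall\bar u)\psi(\bar x,\bar u)$, where each $\psi$ is computable $\Sigma_\beta$ for some $\beta<\alpha$.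 Here an index of a computable $\Sigma_\alpha$ (resp. $\Pi_\alpha$) formula records $\Sigma$ (resp. $\Pi$), the notation, the tuple of free variables, and a c.e. index for the set of pairs (index of $\psi$, tuple $\bar u$). A formula is computable $d$-$\Sigma_\beta$ if it is the conjunction of a computable $\Sigma_\beta$ formula and a computable $\Pi_\beta$ formula, and computable $d$-$\Sigma_{<\alpha}$ if it is computable $d$-$\Sigma_\beta$ for some $\beta<\alpha$. *)

theory Defs
  imports Complex_Main "HOL-Library.Nat_Bijection" "HOL-Library.Countable_Set_Type"
begin

section \<open>Partial recursive functions and c.e. sets\<close>

datatype recf =
    Zero
  | Succ
  | Proj nat
  | Comp recf "recf list"
  | Prec recf recf
  | Mu recf

inductive eval :: "recf \<Rightarrow> nat list \<Rightarrow> nat \<Rightarrow> bool" where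
  eval_Zero: "eval Zero xs 0"
| eval_Succ: "eval Succ (x # xs) (Suc x)"
| eval_Proj: "i < length xs \<Longrightarrow> eval (Proj i) xs (xs ! i)"
| eval_Comp: "list_all2 (\<lambda>g y. eval g xs y) gs ys \<Longrightarrow> eval f ys z \<Longrightarrow> eval (Comp f gs) xs z"
| eval_Prec_0: "eval f xs y \<Longrightarrow> eval (Prec f g) (0 # xs) y"
| eval_Prec_Suc: "eval (Prec f g) (n # xs) y \<Longrightarrow> eval g (n # y # xs) z
    \<Longrightarrow> eval (Prec f g) (Suc n # xs) z"
| eval_Mu: "eval f (n # xs) 0 \<Longrightarrow> (\<forall>m<n. \<exists>y. eval f (m # xs) (Suc y)) \<Longrightarrow> eval (Mu f) xs n"

fun recf_code :: "recf \<Rightarrow> nat" where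
  "recf_code Zero = prod_encode (0, 0)"
| "recf_code Succ = prod_encode (1, 0)"
| "recf_code (Proj i) = prod_encode (2, i)"
| "recf_code (Comp f gs) = prod_encode (3, prod_encode (recf_code f, list_encode (map recf_code gs)))"
| "recf_code (Prec f g) = prod_encode (4, prod_encode (recf_code f, recf_code g))"
| "recf_code (Mu f) = prod_encode (5, recf_code f)"

text \<open>\<open>phi e x y\<close> says that the unary partial recursive function with index \<open>e\<close> converges on \<open>x\<close>
  with value \<open>y\<close>; a number that is not the code of a program is an index of the nowhere defined
  function.\<close>

definition phi :: "nat \<Rightarrow> nat \<Rightarrow> nat \<Rightarrow> bool" where
  "phi e x y \<longleftrightarrow> (\<exists>p. recf_code p = e \<and> eval p [x] y)"

definition W :: "nat \<Rightarrow> nat set" where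
  "W e = {x. \<exists>y. phi e x y}"

definition computable :: "(nat \<Rightarrow> nat) \<Rightarrow> bool" where
  "computable f \<longleftrightarrow> (\<exists>e. \<forall>x. phi e x (f x))"


section \<open>Kleene's system of ordinal notations\<close>

inductive kleene_O :: "nat \<Rightarrow> bool"
  and kleene_less :: "nat \<Rightarrow> nat \<Rightarrow> bool" (infix \<open><\<^sub>O\<close> 50) where
  O_zero: "kleene_O 1"
| O_suc: "kleene_O a \<Longrightarrow> kleene_O (2 ^ a)"
| O_lim: "(\<And>n. phi e n (f n)) \<Longrightarrow> (\<And>n. kleene_O (f n)) \<Longrightarrow> (\<And>n. f n <\<^sub>O f (Suc n))
    \<Longrightarrow> kleene_O (3 * 5 ^ e)"
| less_suc: "kleene_O a \<Longrightarrow> a <\<^sub>O 2 ^ a"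
| less_lim: "kleene_O (3 * 5 ^ e) \<Longrightarrow> phi e n b \<Longrightarrow> b <\<^sub>O 3 * 5 ^ e"
| less_trans: "a <\<^sub>O b \<Longrightarrow> b <\<^sub>O c \<Longrightarrow> a <\<^sub>O c"

text \<open>The ordinal denoted by the notation \<open>a\<close>, as the (reflexive) well-order on the set of
  notations below \<open>a\<close>.\<close>

definition kleene_ord :: "nat \<Rightarrow> nat rel" where
  "kleene_ord a = {(b, c). b <\<^sub>O a \<and> c <\<^sub>O a \<and> (b = c \<or> b <\<^sub>O c)}"


section \<open>Computable languages and structures with universe \<open>\<omega>\<close>\<close>

text \<open>A symbol is a natural number; each field gives the arity of the numbers that are symbols.
  Constants are function symbols of arity \<open>0\<close>.\<close>

record lang =
  rels :: "nat \<Rightarrow> nat option"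
  funs :: "nat \<Rightarrow> nat option"

text \<open>The set of symbols is computable, and so is the arity function on it.\<close>

definition computable_lang :: "lang \<Rightarrow> bool" where
  "computable_lang L \<longleftrightarrow>
     computable (\<lambda>r. case rels L r of None \<Rightarrow> 0 | Some n \<Rightarrow> Suc n) \<and>
     computable (\<lambda>f. case funs L f of None \<Rightarrow> 0 | Some n \<Rightarrow> Suc n)"

record struct =
  rel_int :: "nat \<Rightarrow> nat list \<Rightarrow> bool"
  fun_int :: "nat \<Rightarrow> nat list \<Rightarrow> nat"

text \<open>Values outside the language are fixed, so that members of \<open>Str L\<close> are equal iff they agree
  on the symbols of \<open>L\<close>.\<close>

definition Str :: "lang \<Rightarrow> struct set" where
  "Str L = {M. (\<forall>r xs. rels L r \<noteq> Some (length xs) \<longrightarrow> \<not> rel_int M r xs) \<and>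
               (\<forall>f xs. funs L f \<noteq> Some (length xs) \<longrightarrow> fun_int M f xs = 0)}"


section \<open>Formulas of \<open>L\<^sub>\<omega>\<^sub>1\<^sub>\<omega>\<close>\<close>

datatype trm = Var nat | Fn nat "trm list"

datatype qf =
    Bot
  | Eq trm trm
  | Rel nat "trm list"
  | Neg qf
  | And qf qf
  | Or qf qf

datatype fm =
    Fin qf
  | Conj "fm cset"
  | Disj "fm cset"
  | All nat fm
  | Ex nat fm

fun trm_in :: "lang \<Rightarrow> trm \<Rightarrow> bool" where
  "trm_in L (Var i) \<longleftrightarrow> True"
| "trm_in L (Fn f ts) \<longleftrightarrow> funs L f = Some (length ts) \<and> (\<forall>t\<in>set ts. trm_in L t)"

fun qf_in :: "lang \<Rightarrow> qf \<Rightarrow> bool" where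
  "qf_in L Bot \<longleftrightarrow> True"
| "qf_in L (Eq s t) \<longleftrightarrow> trm_in L s \<and> trm_in L t"
| "qf_in L (Rel r ts) \<longleftrightarrow> rels L r = Some (length ts) \<and> (\<forall>t\<in>set ts. trm_in L t)"
| "qf_in L (Neg \<theta>) \<longleftrightarrow> qf_in L \<theta>"
| "qf_in L (And \<theta> \<eta>) \<longleftrightarrow> qf_in L \<theta> \<and> qf_in L \<eta>"
| "qf_in L (Or \<theta> \<eta>) \<longleftrightarrow> qf_in L \<theta> \<and> qf_in L \<eta>"

fun trm_vars :: "trm \<Rightarrow> nat set" where
  "trm_vars (Var i) = {i}"
| "trm_vars (Fn f ts) = (\<Union>t\<in>set ts. trm_vars t)"

fun qf_vars :: "qf \<Rightarrow> nat set" where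
  "qf_vars Bot = {}"
| "qf_vars (Eq s t) = trm_vars s \<union> trm_vars t"
| "qf_vars (Rel r ts) = (\<Union>t\<in>set ts. trm_vars t)"
| "qf_vars (Neg \<theta>) = qf_vars \<theta>"
| "qf_vars (And \<theta> \<eta>) = qf_vars \<theta> \<union> qf_vars \<eta>"
| "qf_vars (Or \<theta> \<eta>) = qf_vars \<theta> \<union> qf_vars \<eta>"

fun trm_val :: "struct \<Rightarrow> (nat \<Rightarrow> nat) \<Rightarrow> trm \<Rightarrow> nat" where
  "trm_val M v (Var i) = v i"
| "trm_val M v (Fn f ts) = fun_int M f (map (trm_val M v) ts)"

fun qf_sat :: "struct \<Rightarrow> (nat \<Rightarrow> nat) \<Rightarrow> qf \<Rightarrow> bool" where
  "qf_sat M v Bot \<longleftrightarrow> False"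
| "qf_sat M v (Eq s t) \<longleftrightarrow> trm_val M v s = trm_val M v t"
| "qf_sat M v (Rel r ts) \<longleftrightarrow> rel_int M r (map (trm_val M v) ts)"
| "qf_sat M v (Neg \<theta>) \<longleftrightarrow> \<not> qf_sat M v \<theta>"
| "qf_sat M v (And \<theta> \<eta>) \<longleftrightarrow> qf_sat M v \<theta> \<and> qf_sat M v \<eta>"
| "qf_sat M v (Or \<theta> \<eta>) \<longleftrightarrow> qf_sat M v \<theta> \<or> qf_sat M v \<eta>"

text \<open>Recursion through the countable sets has to go via \<open>cimage\<close>; the lemmas below give the
  usual clauses for conjunctions and disjunctions.\<close>

primrec sat :: "struct \<Rightarrow> fm \<Rightarrow> (nat \<Rightarrow> nat) \<Rightarrow> bool" where
  "sat M (Fin \<theta>) = (\<lambda>v. qf_sat M v \<theta>)"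
| "sat M (Conj \<Phi>) = (\<lambda>v. \<forall>P\<in>rcset (cimage (sat M) \<Phi>). P v)"
| "sat M (Disj \<Phi>) = (\<lambda>v. \<exists>P\<in>rcset (cimage (sat M) \<Phi>). P v)"
| "sat M (All i \<phi>) = (\<lambda>v. \<forall>x. sat M \<phi> (v(i := x)))"
| "sat M (Ex i \<phi>) = (\<lambda>v. \<exists>x. sat M \<phi> (v(i := x)))"

lemma sat_Conj_iff: "sat M (Conj \<Phi>) v \<longleftrightarrow> (\<forall>\<phi>\<in>rcset \<Phi>. sat M \<phi> v)"
  by (simp add: cimage.rep_eq)

lemma sat_Disj_iff: "sat M (Disj \<Phi>) v \<longleftrightarrow> (\<exists>\<phi>\<in>rcset \<Phi>. sat M \<phi> v)"
  by (simp add: cimage.rep_eq)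

definition Mod :: "lang \<Rightarrow> fm \<Rightarrow> struct set" where
  "Mod L \<phi> = {M \<in> Str L. \<forall>v. sat M \<phi> v}"


section \<open>Computable infinitary formulas\<close>

fun trm_code :: "trm \<Rightarrow> nat" where
  "trm_code (Var i) = prod_encode (0, i)"
| "trm_code (Fn f ts) = prod_encode (1, prod_encode (f, list_encode (map trm_code ts)))"

fun qf_code :: "qf \<Rightarrow> nat" where
  "qf_code Bot = prod_encode (0, 0)"
| "qf_code (Eq s t) = prod_encode (1, prod_encode (trm_code s, trm_code t))"
| "qf_code (Rel r ts) = prod_encode (2, prod_encode (r, list_encode (map trm_code ts)))"
| "qf_code (Neg \<theta>) = prod_encode (3, qf_code \<theta>)"
| "qf_code (And \<theta> \<eta>) = prod_encode (4, prod_encode (qf_code \<theta>, qf_code \<eta>))"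
| "qf_code (Or \<theta> \<eta>) = prod_encode (5, prod_encode (qf_code \<theta>, qf_code \<eta>))"

datatype side = SideSigma | SidePi

fun side_code :: "side \<Rightarrow> nat" where
  "side_code SideSigma = 0"
| "side_code SidePi = 1"

definition index :: "side \<Rightarrow> nat \<Rightarrow> nat list \<Rightarrow> nat \<Rightarrow> nat" where
  "index s a xs e = prod_encode (side_code s, prod_encode (a, prod_encode (list_encode xs, e)))"

text \<open>\<open>has_index L s a xs e \<phi>\<close>: the number \<open>index s a xs e\<close> is an index, and \<open>\<phi>\<close> is the formula it
  denotes, with free variables among \<open>xs\<close>. At the notation \<open>1\<close> of the ordinal zero, \<open>e\<close> is the code
  of a quantifier-free formula; at any other notation it is a c.e. index of a set of pairs
  \<open>(j, us)\<close>, all of which have to consist of an index \<open>j\<close> of the opposite side at a notation below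
  \<open>a\<close> and a tuple \<open>us\<close> of variables. In these clauses \<open>F j\<close> is the formula with index \<open>j\<close>.\<close>

inductive has_index :: "lang \<Rightarrow> side \<Rightarrow> nat \<Rightarrow> nat list \<Rightarrow> nat \<Rightarrow> fm \<Rightarrow> bool" for L :: lang where
  index_zero: "qf_in L \<theta> \<Longrightarrow> qf_vars \<theta> \<subseteq> set xs \<Longrightarrow> has_index L s 1 xs (qf_code \<theta>) (Fin \<theta>)"
| index_Sigma: "kleene_O a \<Longrightarrow> a \<noteq> 1 \<Longrightarrow>
    (\<And>j us. prod_encode (j, list_encode us) \<in> W e \<Longrightarrow>
       \<exists>b ys d. j = index SidePi b ys d \<and> b <\<^sub>O a \<and> set ys \<subseteq> set xs \<union> set us \<and>
         has_index L SidePi b ys d (F j)) \<Longrightarrow>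
    has_index L SideSigma a xs e
      (Disj (acset {foldr Ex us (F j) | j us. prod_encode (j, list_encode us) \<in> W e}))"
| index_Pi: "kleene_O a \<Longrightarrow> a \<noteq> 1 \<Longrightarrow>
    (\<And>j us. prod_encode (j, list_encode us) \<in> W e \<Longrightarrow>
       \<exists>b ys d. j = index SideSigma b ys d \<and> b <\<^sub>O a \<and> set ys \<subseteq> set xs \<union> set us \<and>
         has_index L SideSigma b ys d (F j)) \<Longrightarrow>
    has_index L SidePi a xs e
      (Conj (acset {foldr All us (F j) | j us. prod_encode (j, list_encode us) \<in> W e}))"

text \<open>In the following definitions the level is given by a notation; a sentence is a formula with
  the empty tuple of free variables.\<close>

definition comp_Sigma :: "lang \<Rightarrow> nat \<Rightarrow> nat list \<Rightarrow> fm \<Rightarrow> bool" where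
  "comp_Sigma L a xs \<phi> \<longleftrightarrow> (\<exists>e. has_index L SideSigma a xs e \<phi>)"

definition comp_Pi :: "lang \<Rightarrow> nat \<Rightarrow> nat list \<Rightarrow> fm \<Rightarrow> bool" where
  "comp_Pi L a xs \<phi> \<longleftrightarrow> (\<exists>e. has_index L SidePi a xs e \<phi>)"

definition comp_d_Sigma :: "lang \<Rightarrow> nat \<Rightarrow> nat list \<Rightarrow> fm \<Rightarrow> bool" where
  "comp_d_Sigma L b xs \<chi> \<longleftrightarrow>
     (\<exists>\<phi> \<psi>. comp_Sigma L b xs \<phi> \<and> comp_Pi L b xs \<psi> \<and> \<chi> = Conj (acset {\<phi>, \<psi>}))"

definition comp_d_Sigma_below :: "lang \<Rightarrow> nat \<Rightarrow> nat list \<Rightarrow> fm \<Rightarrow> bool" where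
  "comp_d_Sigma_below L a xs \<chi> \<longleftrightarrow> (\<exists>b. b <\<^sub>O a \<and> comp_d_Sigma L b xs \<chi>)"

end

theory Submission
  imports Defs
begin

text \<open>Let \<open>M\<close> be a model of the \<open>\<Pi>\<^sub>\<alpha>\<close> sentence \<open>\<phi>\<close>. Consider, as forcing conditions, the computable
  \<open>\<Pi>\<^sub>b\<close> formulas \<open>P\<close> with \<open>b + 1 < \<alpha>\<close> that hold in \<open>M\<close> under some bijective assignment, ordered by
  implication in \<open>M\<close>. A generic sequence of conditions determines a structure \<open>K\<close> whose element \<open>n\<close> is
  named by the variable \<open>n\<close>; since the conjuncts of \<open>\<phi>\<close> hold in \<open>M\<close>, they cannot be forced to be false,
  so \<open>K\<close> is a model of \<open>\<phi>\<close>. If no condition excludes an instance \<open>\<psi>\<^sub>j\<close> of a conjunct of \<open>\<psi>\<close>, then \<open>K\<close> is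
  also a model of \<open>\<psi>\<close>, which is impossible. So some \<open>P\<close> excludes some \<open>\<psi>\<^sub>j\<close> in \<open>M\<close>, and then
  \<open>\<exists>x. P\<close> together with \<open>\<forall>x. P \<longrightarrow> \<not> \<psi>\<^sub>j\<close> is a d-\<open>\<Sigma>\<close> sentence of level below \<open>\<alpha>\<close> that
  holds in \<open>M\<close> and refutes \<open>\<psi>\<close>. There are only countably many such sentences, so no uniformity in \<open>M\<close> is
  needed. That the second sentence is computable rests on the recursion theorem (to dualize and rename
  indices effectively) and on a universal partial recursive function (to enumerate, below a limit level,
  the upper bounds of two levels).\<close>

section \<open>Total recursive functions\<close>

text \<open>The bound b + 1 < \<alpha> on conditions leaves a level \<beta> < \<alpha> that is above
  b and at least the level of \<psi>_j. At \<beta> both \<exists>x. P and \<exists>x. (P and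
  \<psi>_j) are \<Sigma>, and the negation of the latter is the \<Pi> half of the separating
  sentence. Since \<alpha> \<ge> 2, quantifier-free conditions are available; they settle the atomic
  diagram of K. Bijectivity of the assignments does two jobs: by injectivity distinct variables name
  distinct elements, so no quotient is taken, and by surjectivity every witness found in M is named
  by a variable. A sentence cannot express bijectivity; it only asks that the finitely many
  variables involved be distinct, and a finite injection on \<omega> extends to a bijection. The
  d-\<Sigma> sentence refutes \<psi> because in a model of \<psi> every instance of \<psi>_j holds,
  so a realization of P would realize P and \<psi>_j together. The sentences \<phi> and \<psi> have
  level \<alpha>, beyond the reach of the forcing theorem, which is therefore applied to their
  conjuncts.\<close>

definition tot :: "nat \<Rightarrow> (nat list \<Rightarrow> nat) \<Rightarrow> bool" where
  "tot n F \<longleftrightarrow> (\<exists>p. \<forall>xs. length xs = n \<longrightarrow> eval p xs (F xs))"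

lemma totI: "(\<And>xs. length xs = n \<Longrightarrow> eval p xs (F xs)) \<Longrightarrow> tot n F"
  unfolding tot_def by blast

lemma tot_cong: "tot n F \<Longrightarrow> (\<And>xs. length xs = n \<Longrightarrow> F xs = G xs) \<Longrightarrow> tot n G"
  unfolding tot_def by simp

lemma tot_zero: "tot n (\<lambda>_. 0)"
  by (rule totI[of _ Zero]) (rule eval_Zero)

lemma tot_suc: "tot 1 (\<lambda>xs. Suc (xs ! 0))"
proof (rule totI[of _ Succ])
  fix xs :: "nat list" assume "length xs = 1"
  then obtain x where "xs = [x]" by (cases xs) auto
  then show "eval Succ xs (Suc (xs ! 0))" by (simp add: eval_Succ)
qed

lemma tot_proj: "i < n \<Longrightarrow> tot n (\<lambda>xs. xs ! i)"
  by (rule totI[of _ "Proj i"]) (simp add: eval_Proj)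

lemma tot_comp1:
  assumes "tot 1 F" "tot n G" shows "tot n (\<lambda>xs. F [G xs])"
proof -
  obtain p where p: "\<And>xs. length xs = 1 \<Longrightarrow> eval p xs (F xs)" using assms(1) unfolding tot_def by blast
  obtain q where q: "\<And>xs. length xs = n \<Longrightarrow> eval q xs (G xs)" using assms(2) unfolding tot_def by blast
  show ?thesis
    by (rule totI[of _ "Comp p [q]"]) (auto intro!: eval_Comp[where ys="[G xs]" for xs] p q)
qed

lemma tot_comp2:
  assumes "tot 2 F" "tot n G" "tot n H" shows "tot n (\<lambda>xs. F [G xs, H xs])"
proof -
  obtain p where p: "\<And>xs. length xs = 2 \<Longrightarrow> eval p xs (F xs)" using assms(1) unfolding tot_def by blast
  obtain q where q: "\<And>xs. length xs = n \<Longrightarrow> eval q xs (G xs)" using assms(2) unfolding tot_def by blast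
  obtain r where r: "\<And>xs. length xs = n \<Longrightarrow> eval r xs (H xs)" using assms(3) unfolding tot_def by blast
  show ?thesis
    by (rule totI[of _ "Comp p [q, r]"]) (auto intro!: eval_Comp[where ys="[G xs, H xs]" for xs] p q r)
qed

lemma tot_rec:
  assumes "tot n F" "tot (Suc (Suc n)) G"
  shows "tot (Suc n) (\<lambda>xs. rec_nat (F (tl xs)) (\<lambda>k y. G (k # y # tl xs)) (xs ! 0))"
proof -
  obtain p where p: "\<And>xs. length xs = n \<Longrightarrow> eval p xs (F xs)" using assms(1) unfolding tot_def by blast
  obtain q where q: "\<And>xs. length xs = Suc (Suc n) \<Longrightarrow> eval q xs (G xs)" using assms(2) unfolding tot_def by blast
  have *: "eval (Prec p q) (k # xs) (rec_nat (F xs) (\<lambda>k y. G (k # y # xs)) k)"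
    if "length xs = n" for k xs
  proof (induction k)
    case 0 then show ?case by (simp add: eval_Prec_0 p that)
  next
    case (Suc k)
    then show ?case using q[of "k # _ # xs"] that by (auto intro: eval_Prec_Suc)
  qed
  show ?thesis
  proof (rule totI[of _ "Prec p q"])
    fix xs :: "nat list" assume "length xs = Suc n"
    then obtain k ys where "xs = k # ys" "length ys = n" by (cases xs) auto
    then show "eval (Prec p q) xs (rec_nat (F (tl xs)) (\<lambda>k y. G (k # y # tl xs)) (xs ! 0))"
      using * by simp
  qed
qed

lemma eval_Mu_Least:
  assumes "\<And>k. eval p (k # xs) (F k)" "F k = (0::nat)"
  shows "eval (Mu p) xs (LEAST k. F k = 0)"
proof (rule eval_Mu)
  have "F (LEAST k. F k = 0) = 0" using assms(2) by (rule LeastI)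
  then show "eval p ((LEAST k. F k = 0) # xs) 0" using assms(1) by metis
  show "\<forall>m<LEAST k. F k = 0. \<exists>y. eval p (m # xs) (Suc y)"
  proof (intro allI impI)
    fix m assume "m < (LEAST k. F k = 0)"
    then have "F m \<noteq> 0" by (rule not_less_Least)
    then show "\<exists>y. eval p (m # xs) (Suc y)" using assms(1)[of m] by (cases "F m") auto
  qed
qed

lemma tot_mu:
  assumes "tot (Suc n) F" "\<And>xs. length xs = n \<Longrightarrow> \<exists>k. F (k # xs) = 0"
  shows "tot n (\<lambda>xs. LEAST k. F (k # xs) = 0)"
proof -
  obtain p where p: "\<And>xs. length xs = Suc n \<Longrightarrow> eval p xs (F xs)" using assms(1) unfolding tot_def by blast
  show ?thesis
  proof (rule totI[of _ "Mu p"])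
    fix xs :: "nat list" assume "length xs = n"
    with assms(2) obtain k where "F (k # xs) = 0" by blast
    then show "eval (Mu p) xs (LEAST k. F (k # xs) = 0)"
      using p \<open>length xs = n\<close> by (intro eval_Mu_Least[where F="\<lambda>k. F (k # xs)"]) auto
  qed
qed

section \<open>Codes of programs, and computable functions of one and two numbers\<close>

lemma list_encode_simps [simp]:
  "list_encode xs = list_encode ys \<longleftrightarrow> xs = ys"
  "list_encode xs = 0 \<longleftrightarrow> xs = []" "0 = list_encode xs \<longleftrightarrow> xs = []" "0 < list_encode xs \<longleftrightarrow> xs \<noteq> []"
  by (auto simp: list_encode_eq) (cases xs; simp)+

text \<open>\<open>phi\<close> only asserts that some program with code \<open>e\<close> evaluates;
  injectivity ties an index to a single program, so that determinism passes from \<open>eval\<close>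
  to \<open>phi\<close>.\<close>

lemma recf_code_inj: "recf_code p = recf_code q \<Longrightarrow> p = q"
proof (induction p arbitrary: q)
  case Zero then show ?case by (cases q) auto
next
  case Succ then show ?case by (cases q) auto
next
  case (Proj i) then show ?case by (cases q) auto
next
  case (Comp f gs)
  then obtain f' gs' where q: "q = Comp f' gs'" by (cases q) auto
  with Comp.prems have eq: "recf_code f = recf_code f'" "map recf_code gs = map recf_code gs'" by auto
  have "gs = gs'"
    using eq(2) Comp.IH(2)
  proof (induction gs arbitrary: gs')
    case (Cons a gs)
    then obtain b gs'' where "gs' = b # gs''" "recf_code a = recf_code b" "map recf_code gs = map recf_code gs''"
      by (cases gs') auto
    then show ?case using Cons by (metis list.set_intros)
  qed auto
  then show ?case using Comp.IH(1)[OF eq(1)] q by simp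
next
  case (Prec f g) then show ?case by (cases q) auto
next
  case (Mu f) then show ?case by (cases q) auto
qed

lemma phi_code [simp]: "phi (recf_code p) x y \<longleftrightarrow> eval p [x] y"
  unfolding phi_def using recf_code_inj by blast

lemma length1D: "length xs = 1 \<Longrightarrow> xs = [xs ! 0]"
  by (cases xs) auto

lemma computable_iff_tot: "computable f \<longleftrightarrow> tot 1 (\<lambda>xs. f (xs ! 0))"
proof
  assume "computable f"
  then obtain e where e: "\<And>x. phi e x (f x)" unfolding computable_def by blast
  then obtain p where "recf_code p = e" unfolding phi_def by blast
  with e have "eval p [x] (f x)" for x by (metis phi_code)
  then show "tot 1 (\<lambda>xs. f (xs ! 0))"
    by (intro totI[of _ p]) (metis length1D)
next
  assume "tot 1 (\<lambda>xs. f (xs ! 0))"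
  then obtain p where p: "\<And>xs. length xs = 1 \<Longrightarrow> eval p xs (f (xs ! 0))" unfolding tot_def by blast
  have "phi (recf_code p) x (f x)" for x using p[of "[x]"] by auto
  then show "computable f" unfolding computable_def by blast
qed

definition computable2 :: "(nat \<Rightarrow> nat \<Rightarrow> nat) \<Rightarrow> bool" where
  "computable2 g \<longleftrightarrow> tot 2 (\<lambda>xs. g (xs ! 0) (xs ! 1))"

lemma computable_id: "computable (\<lambda>x. x)"
  using tot_proj[of 0 1] by (simp add: computable_iff_tot)

lemma tot_const: "tot n (\<lambda>_. c)"
proof (induction c)
  case 0 show ?case by (rule tot_zero)
next
  case (Suc c) then show ?case using tot_comp1[OF tot_suc] by simp
qed

lemma computable_const: "computable (\<lambda>_. c)"
  by (simp add: computable_iff_tot tot_const)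

lemma computable_comp1: "computable g \<Longrightarrow> computable f \<Longrightarrow> computable (\<lambda>x. g (f x))"
  unfolding computable_iff_tot using tot_comp1[of "\<lambda>xs. g (xs ! 0)"] by simp

lemma computable_Suc: "computable f \<Longrightarrow> computable (\<lambda>x. Suc (f x))"
  by (rule computable_comp1[of Suc]) (simp_all add: computable_iff_tot tot_suc del: One_nat_def)

lemma computable_comp2:
  "computable2 g \<Longrightarrow> computable f \<Longrightarrow> computable h \<Longrightarrow> computable (\<lambda>x. g (f x) (h x))"
  unfolding computable_iff_tot computable2_def using tot_comp2[of "\<lambda>xs. g (xs ! 0) (xs ! 1)"] by simp

lemma computable2_comp1: "computable g \<Longrightarrow> computable2 f \<Longrightarrow> computable2 (\<lambda>x y. g (f x y))"
  unfolding computable_iff_tot computable2_def using tot_comp1[of "\<lambda>xs. g (xs ! 0)"] by simp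

lemma computable2_comp2:
  "computable2 g \<Longrightarrow> computable2 f \<Longrightarrow> computable2 h \<Longrightarrow> computable2 (\<lambda>x y. g (f x y) (h x y))"
  unfolding computable2_def using tot_comp2[of "\<lambda>xs. g (xs ! 0) (xs ! 1)"] by simp

lemma computable2_fst: "computable2 (\<lambda>x y. x)" and computable2_snd: "computable2 (\<lambda>x y. y)"
  unfolding computable2_def using tot_proj[of 0 2] tot_proj[of 1 2] by simp_all

lemma computable_diag: "computable2 g \<Longrightarrow> computable (\<lambda>x. g x x)"
  using computable_comp2[OF _ computable_id computable_id] .

lemma computable2_swap: "computable2 g \<Longrightarrow> computable2 (\<lambda>x y. g y x)"
  by (rule computable2_comp2) (rule computable2_fst computable2_snd | assumption)+

lemma computable2_rec:
  assumes "computable f" "tot 3 (\<lambda>xs. g (xs ! 0) (xs ! 1) (xs ! 2))"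
  shows "computable2 (\<lambda>k x. rec_nat (f x) (\<lambda>i y. g i y x) k)"
proof -
  have "tot (Suc 1) (\<lambda>xs. rec_nat (f (tl xs ! 0)) (\<lambda>k y. g ((k # y # tl xs) ! 0) ((k # y # tl xs) ! 1) ((k # y # tl xs) ! 2)) (xs ! 0))"
    by (rule tot_rec) (use assms in \<open>simp_all add: computable_iff_tot numeral_3_eq_3\<close>)
  then show ?thesis unfolding computable2_def numeral_2_eq_2
    by (rule tot_cong[OF back_subst[where P="\<lambda>n. tot n _"]]) (auto simp: nth_tl numeral_2_eq_2)
qed

lemma computable2_plus: "computable2 (+)"
proof -
  have "computable2 (\<lambda>k x. rec_nat x (\<lambda>i y. Suc y) k)"
    by (rule computable2_rec[OF computable_id])
       (use tot_comp1[OF tot_suc tot_proj[of 1 3]] in simp)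
  moreover have "rec_nat x (\<lambda>i y. Suc y) k = k + x" for k x by (induction k) auto
  ultimately show ?thesis by (simp add: fun_eq_iff)
qed

lemma computable_pred: "computable (\<lambda>x. x - 1)"
proof -
  have "computable2 (\<lambda>k x. rec_nat (0::nat) (\<lambda>i y. i) k)"
    by (rule computable2_rec[OF computable_const]) (rule tot_proj, simp)
  moreover have "rec_nat (0::nat) (\<lambda>i y. i) k = k - 1" for k by (cases k) auto
  ultimately have "computable2 (\<lambda>k x. k - 1)" by simp
  then show ?thesis by (rule computable_diag)
qed

lemma computable2_minus: "computable2 (-)"
proof -
  have "computable2 (\<lambda>k x. rec_nat x (\<lambda>i y. y - 1) k)"
    by (rule computable2_rec[OF computable_id])
       (use tot_comp1[OF computable_pred[unfolded computable_iff_tot] tot_proj[of 1 3]] in simp)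
  moreover have "rec_nat x (\<lambda>i y. y - 1) k = x - k" for k x by (induction k) auto
  ultimately show ?thesis using computable2_swap by fastforce
qed

lemma computable_triangle: "computable triangle"
proof -
  have *: "tot 3 (\<lambda>xs. Suc (xs ! 0 + xs ! 1))"
    using tot_comp1[OF tot_suc tot_comp2[OF computable2_plus[unfolded computable2_def] tot_proj[of 0 3] tot_proj[of 1 3]]]
    by simp
  have "computable2 (\<lambda>k x. rec_nat (0::nat) (\<lambda>i y. Suc (i + y)) k)"
    by (rule computable2_rec[OF computable_const]) (rule *)
  moreover have "rec_nat 0 (\<lambda>i y. Suc (i + y)) k = triangle k" for k by (induction k) auto
  ultimately have "computable2 (\<lambda>k x. triangle k)" by simp
  then show ?thesis by (rule computable_diag)
qed

lemma computable2_prod_encode: "computable2 (\<lambda>x y. prod_encode (x, y))"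
  unfolding prod_encode_def
  by (simp, intro computable2_comp2[OF computable2_plus] computable2_comp1[OF computable_triangle]
      computable2_fst computable2_snd)

definition p1 :: "nat \<Rightarrow> nat" where "p1 z = fst (prod_decode z)"
definition p2 :: "nat \<Rightarrow> nat" where "p2 z = snd (prod_decode z)"

lemma p1_encode [simp]: "p1 (prod_encode (x, y)) = x" and p2_encode [simp]: "p2 (prod_encode (x, y)) = y"
  by (simp_all add: p1_def p2_def)

lemma p_encode [simp]: "prod_encode (p1 z, p2 z) = z"
  by (simp add: p1_def p2_def)

text \<open>Since \<open>prod_encode (x, y) = triangle (x + y) + x\<close>, the sum x + y is the
  least \<open>k\<close> such that the code is below \<open>triangle (Suc k)\<close>. This search
  always succeeds, and subtraction recovers both components from the sum.\<close>

lemma computable_p1_p2: "computable p1" "computable p2"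
proof -
  let ?s = "\<lambda>z. LEAST k. Suc z - triangle (Suc k) = 0"
  have tri: "k \<le> triangle k" for k by (induction k) auto
  have mono: "a \<le> b \<Longrightarrow> triangle a \<le> triangle b" for a b by (induction b) (auto simp: le_Suc_eq)
  have s: "?s (prod_encode (x, y)) = x + y" for x y
  proof (rule Least_equality)
    show "Suc (prod_encode (x, y)) - triangle (Suc (x + y)) = 0"
      by (simp add: prod_encode_def)
    fix k assume "Suc (prod_encode (x, y)) - triangle (Suc k) = 0"
    then have "triangle (x + y) < triangle (Suc k)" by (simp add: prod_encode_def)
    then show "x + y \<le> k" using mono[of "Suc k" "x + y"] by (meson not_less not_less_eq_eq leD)
  qed
  have "computable2 (\<lambda>k z. Suc z - triangle (Suc k))"
  proof -
    have S: "computable Suc" using computable_Suc[OF computable_id] .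
    show ?thesis
      by (intro computable2_comp2[OF computable2_minus] computable2_comp1[OF S]
          computable2_comp1[OF computable_triangle] computable2_fst computable2_snd)
  qed
  then have "tot (Suc 1) (\<lambda>xs. Suc (xs ! 1) - triangle (Suc (xs ! 0)))"
    by (simp add: computable2_def numeral_2_eq_2)
  then have "tot 1 (\<lambda>xs. LEAST k. Suc ((k # xs) ! 1) - triangle (Suc ((k # xs) ! 0)) = 0)"
  proof (rule tot_mu)
    fix xs :: "nat list"
    show "\<exists>k. Suc ((k # xs) ! 1) - triangle (Suc ((k # xs) ! 0)) = 0"
      using tri[of "Suc (xs ! 0)"] by (intro exI[of _ "xs ! 0"]) simp
  qed
  then have s': "computable ?s" by (simp add: computable_iff_tot)
  have sz: "?s z = p1 z + p2 z" for z using s[of "p1 z" "p2 z"] by (simp only: p_encode)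
  have z: "z = triangle (p1 z + p2 z) + p1 z" for z
    using p_encode[of z] unfolding prod_encode_def by simp
  have "p1 z = z - triangle (?s z)" for z unfolding sz using z[of z] by linarith
  moreover have "p2 z = ?s z - p1 z" for z unfolding sz by simp
  moreover have 1: "computable (\<lambda>z. z - triangle (?s z))"
    by (intro computable_comp2[OF computable2_minus] computable_id computable_comp1[OF computable_triangle] s')
  ultimately have "p1 = (\<lambda>z. z - triangle (?s z))" "p2 = (\<lambda>z. ?s z - (z - triangle (?s z)))"
    by (auto simp: fun_eq_iff)
  with 1 computable_comp2[OF computable2_minus s' 1] show "computable p1" "computable p2" by simp_all
qed

named_theorems comp_intros

declare computable_const [comp_intros] computable_id [comp_intros] computable_Suc [comp_intros]

lemma computable_pair [comp_intros]:
  "computable f \<Longrightarrow> computable g \<Longrightarrow> computable (\<lambda>x. prod_encode (f x, g x))"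
  by (rule computable_comp2[OF computable2_prod_encode])

lemma computable_p [comp_intros]:
  "computable f \<Longrightarrow> computable (\<lambda>x. p1 (f x))" "computable f \<Longrightarrow> computable (\<lambda>x. p2 (f x))"
  using computable_comp1 computable_p1_p2 by blast+

lemma computable_arith [comp_intros]:
  "computable f \<Longrightarrow> computable g \<Longrightarrow> computable (\<lambda>x. f x + g x)"
  "computable f \<Longrightarrow> computable g \<Longrightarrow> computable (\<lambda>x. f x - g x)"
  using computable_comp2 computable2_plus computable2_minus by blast+

text \<open>The step may depend on the parameter \<open>x\<close>, so its three arguments are packed
  into one number; in this form \<open>intro comp_intros\<close> treats recursion like any other
  function application.\<close>

lemma computable_rec_nat [comp_intros]:
  assumes "computable f" "computable (\<lambda>z. g (p1 z) (p1 (p2 z)) (p2 (p2 z)))" "computable n"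
  shows "computable (\<lambda>x. rec_nat (f x) (\<lambda>k y. g x k y) (n x))"
proof -
  have pr: "tot m (\<lambda>xs. prod_encode (F xs, G xs))" if "tot m F" "tot m G" for m F G
    using tot_comp2[OF computable2_prod_encode[unfolded computable2_def] that] by simp
  have "tot 3 (\<lambda>xs. prod_encode (xs ! 2, prod_encode (xs ! 0, xs ! 1)))"
    by (intro pr tot_proj) simp_all
  from tot_comp1[OF assms(2)[unfolded computable_iff_tot] this]
  have "tot 3 (\<lambda>xs. g (xs ! 2) (xs ! 0) (xs ! 1))" by simp
  from computable2_rec[OF assms(1) this]
  have "computable2 (\<lambda>k x. rec_nat (f x) (\<lambda>i y. g x i y) k)" .
  from computable_comp2[OF this assms(3) computable_id] show ?thesis .
qed

section \<open>The class of c.e. relations\<close>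

text \<open>\<open>list_encode\<close> sends a cons to the successor of a pair, so
  \<open>p2 (y - 1)\<close> removes the head. Truncated subtraction makes 0, the code of the empty
  list, a fixed point; hence \<open>dropc z i \<noteq> 0\<close> says that \<open>i\<close> is below
  the length, and \<open>nthc\<close> is 0 past the end.\<close>

definition dropc :: "nat \<Rightarrow> nat \<Rightarrow> nat" where "dropc z i = rec_nat z (\<lambda>_ y. p2 (y - 1)) i"
definition nthc :: "nat \<Rightarrow> nat \<Rightarrow> nat" where "nthc z i = p1 (dropc z i - 1)"

lemma computable_nthc [comp_intros]:
  "computable f \<Longrightarrow> computable g \<Longrightarrow> computable (\<lambda>x. dropc (f x) (g x))"
  "computable f \<Longrightarrow> computable g \<Longrightarrow> computable (\<lambda>x. nthc (f x) (g x))"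
  unfolding nthc_def dropc_def by (intro comp_intros; assumption)+

lemma dropc_list_encode [simp]: "dropc (list_encode xs) i = list_encode (drop i xs)"
proof (induction i)
  case 0 show ?case by (simp add: dropc_def)
next
  case (Suc i)
  then have "dropc (list_encode xs) (Suc i) = p2 (list_encode (drop i xs) - 1)" by (simp add: dropc_def)
  also have "\<dots> = list_encode (tl (drop i xs))"
    using p2_encode[of 0 0, unfolded prod_encode_def] by (cases "drop i xs") simp_all
  also have "tl (drop i xs) = drop (Suc i) xs" by (simp add: drop_Suc tl_drop)
  finally show ?case .
qed

lemma nthc_list_encode [simp]: "i < length xs \<Longrightarrow> nthc (list_encode xs) i = xs ! i"
  by (simp add: nthc_def Cons_nth_drop_Suc[symmetric])

text \<open>A normal form of c.e. predicates whose zero test can be searched directly by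
  \<open>Mu\<close>. The closure rules follow the syntax of a predicate; bound variables are passed
  through \<open>p1\<close> and \<open>p2\<close>.\<close>

definition sigma1 :: "(nat \<Rightarrow> bool) \<Rightarrow> bool" where
  "sigma1 P \<longleftrightarrow> (\<exists>f. computable f \<and> (\<forall>x. P x \<longleftrightarrow> (\<exists>y. f (prod_encode (x, y)) = 0)))"

lemma sigma1I:
  assumes "computable f" "\<And>x. P x \<longleftrightarrow> (\<exists>y. f (prod_encode (x, y)) = 0)" shows "sigma1 P"
  using assms unfolding sigma1_def by blast

named_theorems sigma1_intros

lemma sigma1_zero: assumes "computable f" shows "sigma1 (\<lambda>x. f x = 0)"
  by (rule sigma1I[of "\<lambda>z. f (p1 z)"]) (auto intro!: computable_comp1[OF assms] comp_intros)

lemma sigma1_eq [sigma1_intros]: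
  assumes "computable f" "computable g" shows "sigma1 (\<lambda>x. f x = g x)"
proof -
  have "sigma1 (\<lambda>x. (f x - g x) + (g x - f x) = 0)"
    by (intro sigma1_zero comp_intros assms)
  then show ?thesis by (rule back_subst[where P=sigma1]) (auto simp: fun_eq_iff)
qed

lemma sigma1_less [sigma1_intros]:
  assumes "computable f" "computable g" shows "sigma1 (\<lambda>x. f x < g x)"
proof -
  have "sigma1 (\<lambda>x. Suc (f x) - g x = 0)" by (intro sigma1_zero comp_intros assms)
  then show ?thesis by (rule back_subst[where P=sigma1]) (auto simp: fun_eq_iff)
qed

lemma sigma1_conj [sigma1_intros]:
  assumes "sigma1 P" "sigma1 Q" shows "sigma1 (\<lambda>x. P x \<and> Q x)"
proof -
  obtain f where f: "computable f" "\<And>x. P x \<longleftrightarrow> (\<exists>y. f (prod_encode (x, y)) = 0)" using assms(1) unfolding sigma1_def by blast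
  obtain g where g: "computable g" "\<And>x. Q x \<longleftrightarrow> (\<exists>y. g (prod_encode (x, y)) = 0)" using assms(2) unfolding sigma1_def by blast
  show ?thesis
  proof (rule sigma1I[of "\<lambda>z. f (prod_encode (p1 z, p1 (p2 z))) + g (prod_encode (p1 z, p2 (p2 z)))"])
    show "computable (\<lambda>z. f (prod_encode (p1 z, p1 (p2 z))) + g (prod_encode (p1 z, p2 (p2 z))))"
      by (intro comp_intros computable_comp1[OF f(1)] computable_comp1[OF g(1)])
    show "P x \<and> Q x \<longleftrightarrow> (\<exists>y. f (prod_encode (p1 (prod_encode (x, y)), p1 (p2 (prod_encode (x, y))))) +
      g (prod_encode (p1 (prod_encode (x, y)), p2 (p2 (prod_encode (x, y))))) = 0)" for x
      unfolding f(2) g(2) by simp (metis p1_encode p2_encode)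
  qed
qed

lemma sigma1_ex [sigma1_intros]:
  assumes "sigma1 (\<lambda>z. P (p1 z) (p2 z))" shows "sigma1 (\<lambda>x. \<exists>y. P x y)"
proof -
  obtain f where f: "computable f" "\<And>x. P (p1 x) (p2 x) \<longleftrightarrow> (\<exists>y. f (prod_encode (x, y)) = 0)" using assms unfolding sigma1_def by blast
  have "P x y \<longleftrightarrow> (\<exists>u. f (prod_encode (prod_encode (x, y), u)) = 0)" for x y
    using f(2)[of "prod_encode (x, y)"] by simp
  then show ?thesis
    by (intro sigma1I[of "\<lambda>z. f (prod_encode (prod_encode (p1 z, p1 (p2 z)), p2 (p2 z)))"])
      (simp_all, intro comp_intros computable_comp1[OF f(1)], metis p1_encode p2_encode)
qed

lemma sigma1_disj [sigma1_intros]: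
  assumes "sigma1 P" "sigma1 Q" shows "sigma1 (\<lambda>x. P x \<or> Q x)"
proof -
  obtain f where f: "computable f" "\<And>x. P x \<longleftrightarrow> (\<exists>y. f (prod_encode (x, y)) = 0)" using assms(1) unfolding sigma1_def by blast
  obtain g where g: "computable g" "\<And>x. Q x \<longleftrightarrow> (\<exists>y. g (prod_encode (x, y)) = 0)" using assms(2) unfolding sigma1_def by blast
  \<comment> \<open>Recursion as a case distinction: the value is 0 if \<open>f z = 0\<close> and
    \<open>g z\<close> otherwise, so the zero set is the union of the two.\<close>
  let ?h = "\<lambda>z. rec_nat (0::nat) (\<lambda>_ _. g z) (f z)"
  have h: "?h z = 0 \<longleftrightarrow> f z = 0 \<or> g z = 0" for z by (cases "f z") auto
  have "computable ?h" by (intro comp_intros computable_comp1[OF f(1)] computable_comp1[OF g(1)])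
  then show ?thesis by (rule sigma1I) (auto simp: h f(2) g(2))
qed

lemma sigma1_comp:
  assumes "sigma1 P" "computable g" shows "sigma1 (\<lambda>x. P (g x))"
proof -
  obtain f where f: "computable f" "\<And>x. P x \<longleftrightarrow> (\<exists>y. f (prod_encode (x, y)) = 0)" using assms(1) unfolding sigma1_def by blast
  show ?thesis
    by (rule sigma1I[of "\<lambda>z. f (prod_encode (g (p1 z), p2 z))"])
      (auto simp: f(2) intro!: computable_comp1[OF f(1)] comp_intros computable_comp1[OF assms(2)])
qed

lemma sigma1_ball [sigma1_intros]:
  assumes "sigma1 (\<lambda>z. P (p1 z) (p2 z))" "computable b" shows "sigma1 (\<lambda>x. \<forall>i<b x. P x i)"
proof -
  obtain f where f: "computable f" "\<And>x. P (p1 x) (p2 x) \<longleftrightarrow> (\<exists>y. f (prod_encode (x, y)) = 0)" using assms(1) unfolding sigma1_def by blast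
  have P: "P x y \<longleftrightarrow> (\<exists>u. f (prod_encode (prod_encode (x, y), u)) = 0)" for x y
    using f(2)[of "prod_encode (x, y)"] by simp
  \<comment> \<open>The witnesses for all \<open>i\<close> below the bound are collected in one
    coded list \<open>s\<close>; the sum of the tests vanishes exactly when each of them
    does.\<close>
  let ?h = "\<lambda>x s. rec_nat (0::nat) (\<lambda>i y. y + f (prod_encode (prod_encode (x, i), nthc s i)))"
  have h: "?h x s n = 0 \<longleftrightarrow> (\<forall>i<n. f (prod_encode (prod_encode (x, i), nthc s i)) = 0)" for x s n
    by (induction n) (auto simp: less_Suc_eq)
  have "(\<forall>i<n. P x i) \<longleftrightarrow> (\<exists>s. ?h x s n = 0)" for x n
  proof
    assume "\<forall>i<n. P x i"
    then obtain u where u: "\<And>i. i < n \<Longrightarrow> f (prod_encode (prod_encode (x, i), u i)) = 0" unfolding P by metis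
    then have "?h x (list_encode (map u [0..<n])) n = 0" unfolding h by simp
    then show "\<exists>s. ?h x s n = 0" ..
  qed (auto simp: h P)
  then show ?thesis
    by (intro sigma1I[of "\<lambda>z. ?h (p1 z) (p2 z) (b (p1 z))"])
      (simp_all, intro comp_intros computable_comp1[OF f(1)] computable_comp1[OF assms(2)])
qed

lemma sigma1_neq [sigma1_intros]:
  assumes "computable f" "computable g" shows "sigma1 (\<lambda>x. f x \<noteq> g x)"
  unfolding nat_neq_iff by (intro sigma1_intros assms)

section \<open>Indices and the recursion theorem\<close>

inductive_cases eval_elims:
  "eval Zero xs z" "eval Succ xs z" "eval (Proj i) xs z" "eval (Comp f gs) xs z"
  "eval (Prec f g) (0 # xs) z" "eval (Prec f g) (Suc n # xs) z" "eval (Mu f) xs z"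

lemma eval_det: "eval p xs y \<Longrightarrow> eval p xs z \<Longrightarrow> y = z"
proof (induction arbitrary: z rule: eval.induct)
  case (eval_Zero xs) then show ?case by (auto elim!: eval_elims)
next
  case (eval_Succ x xs) then show ?case by (auto elim!: eval_elims)
next
  case (eval_Proj i xs) then show ?case by (auto elim!: eval_elims)
next
  case (eval_Comp xs gs ys f w)
  from eval_Comp.prems obtain ys' where ys': "list_all2 (\<lambda>g y. eval g xs y) gs ys'" "eval f ys' z"
    by (auto elim!: eval_elims)
  have "ys = ys'"
    using eval_Comp.IH(1)[THEN list_all2_lengthD] ys'(1)[THEN list_all2_lengthD]
      list_all2_nthD[OF eval_Comp.IH(1)] list_all2_nthD[OF ys'(1)]
    by (intro nth_equalityI) auto
  with ys' eval_Comp.IH show ?case by simp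
next
  case (eval_Prec_0 f xs y g)
  from eval_Prec_0.prems have "eval f xs z" by (auto elim!: eval_elims)
  then show ?case by (rule eval_Prec_0.IH)
next
  case (eval_Prec_Suc f g n xs y w)
  from eval_Prec_Suc.prems obtain y' where "eval (Prec f g) (n # xs) y'" "eval g (n # y' # xs) z"
    by (auto elim!: eval_elims)
  with eval_Prec_Suc.IH show ?case by blast
next
  case (eval_Mu f n xs)
  from eval_Mu.prems have z: "eval f (z # xs) 0" "\<forall>m<z. \<exists>y. eval f (m # xs) (Suc y)"
    by (auto elim!: eval_elims)
  show ?case
  proof (rule linorder_cases[of n z])
    assume "n < z"
    with z(2) eval_Mu.IH(1) show ?thesis by blast
  next
    assume "z < n"
    with z(1) eval_Mu.IH(2) show ?thesis by blast
  qed
qed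

lemma phi_det: "phi e x y \<Longrightarrow> phi e x z \<Longrightarrow> y = z"
  unfolding phi_def using eval_det recf_code_inj by blast

lemma W_code: "W (recf_code p) = {x. \<exists>y. eval p [x] y}"
  by (simp add: W_def)

lemma computableE:
  assumes "computable f" obtains p where "\<And>x. eval p [x] (f x)"
  using assms unfolding computable_def by (metis phi_def recf_code_inj)

section \<open>Parametrization and self-reference of indices\<close>

definition pair_prog :: recf where
  "pair_prog = (SOME p. \<forall>x y. eval p [x, y] (prod_encode (x, y)))"

lemma eval_pair_prog: "eval pair_prog [x, y] (prod_encode (x, y))"
proof -
  obtain p where "\<And>xs. length xs = 2 \<Longrightarrow> eval p xs (prod_encode (xs ! 0, xs ! 1))"
    using computable2_prod_encode unfolding computable2_def tot_def by blast
  from this[of "[_, _]"] have "\<forall>x y. eval p [x, y] (prod_encode (x, y))" by simp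
  then show ?thesis unfolding pair_prog_def by (rule someI2) blast
qed

lemma eval_Proj_simps: "eval (Proj 0) (x # xs) x" "eval (Proj 1) (y # x # xs) x"
  using eval_Proj[of 0 "x # xs"] eval_Proj[of 1 "y # x # xs"] by simp_all

lemma eval_Comp1I: "eval g xs y \<Longrightarrow> eval f [y] z \<Longrightarrow> eval (Comp f [g]) xs z"
  by (rule eval_Comp[of _ _ "[y]"]) simp_all

lemma eval_Comp2I: "eval g xs y \<Longrightarrow> eval h xs u \<Longrightarrow> eval f [y, u] z \<Longrightarrow> eval (Comp f [g, h]) xs z"
  by (rule eval_Comp[of _ _ "[y, u]"]) simp_all

lemma sigma1_W: assumes "sigma1 P" shows "\<exists>e. W e = {x. P x}"
proof -
  obtain f where f: "computable f" "\<And>x. P x \<longleftrightarrow> (\<exists>y. f (prod_encode (x, y)) = 0)" using assms unfolding sigma1_def by blast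
  obtain p where p: "\<And>x. eval p [x] (f x)" using computableE[OF f(1)] by blast
  define q where "q = Comp p [Comp pair_prog [Proj 1, Proj 0]]"
  have q: "eval q [y, x] (f (prod_encode (x, y)))" for x y
    unfolding q_def
    by (rule eval_Comp1I[OF eval_Comp2I[OF eval_Proj_simps(2) eval_Proj_simps(1) eval_pair_prog] p])
  have "(\<exists>y. eval (Mu q) [x] y) \<longleftrightarrow> P x" for x
  proof
    assume "\<exists>y. eval (Mu q) [x] y"
    then obtain y where "eval q [y, x] 0" by (auto elim!: eval_elims)
    with q have "f (prod_encode (x, y)) = 0" using eval_det by blast
    then show "P x" using f(2) by blast
  next
    assume "P x"
    then obtain y where "f (prod_encode (x, y)) = 0" using f(2) by blast
    then show "\<exists>y. eval (Mu q) [x] y"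
      using eval_Mu_Least[where F="\<lambda>y. f (prod_encode (x, y))", OF q] by blast
  qed
  then have "W (recf_code (Mu q)) = {x. P x}" by (simp only: W_code)
  then show ?thesis ..
qed

fun cst :: "nat \<Rightarrow> recf" where
  "cst 0 = Zero"
| "cst (Suc n) = Comp Succ [cst n]"

lemma eval_cst: "eval (cst n) xs n"
  by (induction n) (auto intro: eval_Zero eval_Comp1I eval_Succ)

text \<open>Written on codes, so that it makes sense for every \<open>e\<close>. If \<open>e\<close>
  codes \<open>p\<close>, the value codes \<open>p\<close> applied to the pair of the constant
  \<open>n\<close> and the input.\<close>

definition smn :: "nat \<Rightarrow> nat \<Rightarrow> nat" where
  "smn e n = prod_encode (3, prod_encode (e, list_encode [recf_code (Comp pair_prog [cst n, Proj 0])]))"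

lemma W_smn: "W (smn e n) = {x. prod_encode (n, x) \<in> W e}"
proof (cases "\<exists>p. recf_code p = e")
  case True
  then obtain p where e: "e = recf_code p" by blast
  let ?q = "Comp pair_prog [cst n, Proj 0]"
  have q: "eval ?q [x] (prod_encode (n, x))" for x
    by (rule eval_Comp2I[OF eval_cst eval_Proj_simps(1) eval_pair_prog])
  have "smn e n = recf_code (Comp p [?q])" by (simp add: smn_def e)
  moreover have "eval (Comp p [?q]) [x] y \<longleftrightarrow> eval p [prod_encode (n, x)] y" for x y
  proof
    assume "eval (Comp p [?q]) [x] y"
    then obtain u where "eval ?q [x] u" "eval p [u] y"
      by (rule eval_elims(4)) (auto simp: list_all2_Cons1)
    with q[of x] show "eval p [prod_encode (n, x)] y" using eval_det by blast
  qed (rule eval_Comp1I[OF q])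
  ultimately show ?thesis by (simp only: W_code e mem_Collect_eq)
next
  case False
  \<comment> \<open>The code of a composition contains the code of its outer program, so if
    \<open>e\<close> codes no program, neither does \<open>smn e n\<close>; then both sides are
    empty.\<close>
  have "\<nexists>q. recf_code q = smn e n"
  proof
    assume "\<exists>q. recf_code q = smn e n"
    then obtain q where "recf_code q = smn e n" ..
    with False show False by (cases q) (auto simp: smn_def)
  qed
  with False show ?thesis by (auto simp: W_def phi_def)
qed

lemma computable_smn [comp_intros]:
  assumes "computable f" "computable g" shows "computable (\<lambda>x. smn (f x) (g x))"
proof -
  have cst: "recf_code (cst n) =
    rec_nat (prod_encode (0, 0)) (\<lambda>_ y. prod_encode (3, prod_encode (prod_encode (1, 0), Suc (prod_encode (y, 0))))) n" for n
    by (induction n) auto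
  show ?thesis
    unfolding smn_def recf_code.simps list.map list_encode.simps cst
    by (intro comp_intros assms)
qed

text \<open>Kleene's second recursion theorem with a parameter: \<open>Q\<close> may use its own indices
  \<open>self c n\<close>.\<close>

definition self :: "nat \<Rightarrow> nat \<Rightarrow> nat" where "self c n = smn c (prod_encode (c, n))"

lemma computable_self [comp_intros]:
  "computable f \<Longrightarrow> computable g \<Longrightarrow> computable (\<lambda>x. self (f x) (g x))"
  unfolding self_def by (intro comp_intros)

lemma recursion_theorem:
  assumes "sigma1 (\<lambda>z. Q (p1 (p1 z)) (p2 (p1 z)) (p2 z))"
  shows "\<exists>c. \<forall>n. W (self c n) = {x. Q c n x}"
proof -
  \<comment> \<open>\<open>Q\<close> takes an index as an argument, and \<open>self c n\<close>
    feeds \<open>c\<close> its own number; this is the diagonal step.\<close>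
  obtain c where "W c = {z. Q (p1 (p1 z)) (p2 (p1 z)) (p2 z)}" using sigma1_W[OF assms] by blast
  then have "\<forall>n. W (self c n) = {x. Q c n x}" by (simp add: self_def W_smn)
  then show ?thesis ..
qed

lemma uniform_index:
  assumes "sigma1 (\<lambda>z. Q (p1 z) (p2 z))"
  shows "\<exists>u. computable u \<and> (\<forall>n. W (u n) = {x. Q n x})"
proof -
  obtain c where c: "W c = {z. Q (p1 z) (p2 z)}" using sigma1_W[OF assms] by blast
  show ?thesis by (rule exI[of _ "smn c"]) (simp add: W_smn c comp_intros)
qed

section \<open>Inductively defined c.e. sets and universality\<close>

text \<open>The equivalence packs monotonicity and dependence on a finite part of the set into one
  condition. It is what gives every element of a least fixed point a finite derivation.\<close>

definition finitary :: "('a set \<Rightarrow> bool) \<Rightarrow> bool" where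
  "finitary \<Psi> \<longleftrightarrow> (\<forall>S. \<Psi> S \<longleftrightarrow> (\<exists>T. finite T \<and> T \<subseteq> S \<and> \<Psi> T))"

lemma finitary_mono: "finitary \<Psi> \<Longrightarrow> S \<subseteq> S' \<Longrightarrow> \<Psi> S \<Longrightarrow> \<Psi> S'"
  unfolding finitary_def by (meson subset_trans)

lemma finitaryI:
  assumes "\<And>S S'. S \<subseteq> S' \<Longrightarrow> \<Psi> S \<Longrightarrow> \<Psi> S'" "\<And>S. \<Psi> S \<Longrightarrow> \<exists>T. finite T \<and> T \<subseteq> S \<and> \<Psi> T"
  shows "finitary \<Psi>"
  using assms unfolding finitary_def by meson

lemma finitaryD: "finitary \<Psi> \<Longrightarrow> \<Psi> S \<Longrightarrow> \<exists>T. finite T \<and> T \<subseteq> S \<and> \<Psi> T"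
  unfolding finitary_def by meson

named_theorems finitary_intros

lemma finitary_const [finitary_intros]: "finitary (\<lambda>_. b)"
  unfolding finitary_def by auto

lemma finitary_mem [finitary_intros]: "finitary (\<lambda>S. x \<in> S)"
  by (rule finitaryI) (auto intro: exI[of _ "{x}"])

text \<open>Finitely many finite supports have a finite union. This admits the premise of
  minimization, which speaks of all \<open>m < n\<close>.\<close>

lemma finitary_ball [finitary_intros]:
  assumes "\<And>i. finitary (\<lambda>S. P S i)" shows "finitary (\<lambda>S. \<forall>i<(n::nat). P S i)"
proof (rule finitaryI)
  show "\<forall>i<n. P S' i" if "S \<subseteq> S'" "\<forall>i<n. P S i" for S S'
    using that finitary_mono[OF assms, of S S'] by simp
  fix S assume "\<forall>i<n. P S i"
  then have "\<exists>T. finite T \<and> T \<subseteq> S \<and> P T i" if "i < n" for i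
    using finitaryD[OF assms, of S i] that by simp
  then obtain T where T: "\<And>i. i < n \<Longrightarrow> finite (T i) \<and> T i \<subseteq> S \<and> P (T i) i" by metis
  have "P (\<Union>i<n. T i) i" if "i < n" for i
    by (rule finitary_mono[OF assms, of "T i"]) (use T that in auto)
  with T show "\<exists>T. finite T \<and> T \<subseteq> S \<and> (\<forall>i<n. P T i)"
    by (intro exI[of _ "\<Union>i<n. T i"]) auto
qed

lemma finitary_conj [finitary_intros]:
  assumes "finitary P" "finitary Q" shows "finitary (\<lambda>S. P S \<and> Q S)"
proof (rule finitaryI)
  show "P S' \<and> Q S'" if "S \<subseteq> S'" "P S \<and> Q S" for S S'
    using that finitary_mono[OF assms(1), of S S'] finitary_mono[OF assms(2), of S S'] by simp
  fix S assume S: "P S \<and> Q S"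
  obtain T where T: "finite T" "T \<subseteq> S" "P T" using S finitaryD[OF assms(1), of S] by auto
  obtain T' where T': "finite T'" "T' \<subseteq> S" "Q T'" using S finitaryD[OF assms(2), of S] by auto
  have "P (T \<union> T')" "Q (T \<union> T')"
    using T T' finitary_mono[OF assms(1), of T "T \<union> T'"] finitary_mono[OF assms(2), of T' "T \<union> T'"] by auto
  with T T' show "\<exists>T. finite T \<and> T \<subseteq> S \<and> P T \<and> Q T" by (intro exI[of _ "T \<union> T'"]) auto
qed

lemma finitary_ex [finitary_intros]:
  assumes "\<And>y. finitary (\<lambda>S. P S y)" shows "finitary (\<lambda>S. \<exists>y. P S y)"
  using assms unfolding finitary_def by (metis (no_types, lifting))

lemma finitary_disj [finitary_intros]:
  assumes "finitary P" "finitary Q" shows "finitary (\<lambda>S. P S \<or> Q S)"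
  using assms unfolding finitary_def by metis

definition seqset :: "nat \<Rightarrow> nat \<Rightarrow> nat set" where
  "seqset n s = {y. \<exists>i<n. nthc s i = y}"

lemma sigma1_seqset [sigma1_intros]:
  assumes "computable f" "computable g" "computable h" shows "sigma1 (\<lambda>x. f x \<in> seqset (g x) (h x))"
  unfolding seqset_def mem_Collect_eq
  by (intro sigma1_intros comp_intros assms[THEN computable_comp1])

text \<open>Membership in a least fixed point is witnessed by a finite derivation.\<close>

lemma sigma1_lfp:
  assumes fin: "\<And>x. finitary (\<lambda>S. \<Phi> S x)"
    and sig: "sigma1 (\<lambda>z. \<Phi> (seqset (p1 (p2 z)) (p2 (p2 z))) (p1 z))"
  shows "sigma1 (\<lambda>x. x \<in> lfp (\<lambda>S. {x. \<Phi> S x}))"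
proof -
  let ?L = "lfp (\<lambda>S. {x. \<Phi> S x})"
  have mono: "mono (\<lambda>S. {x. \<Phi> S x})" by (intro monoI subsetI) (auto intro: finitary_mono[OF fin])
  have unfold: "x \<in> ?L \<longleftrightarrow> \<Phi> ?L x" for x using lfp_unfold[OF mono] by blast
  \<comment> \<open>A derivation: each entry is justified by the entries before it. Monotonicity
    makes derivations closed under concatenation.\<close>
  define der where "der l \<longleftrightarrow> (\<forall>i<length l. \<Phi> (set (take i l)) (l ! i))" for l
  have der_append: "der (l @ l')" if "der l" "der l'" for l l'
    unfolding der_def
  proof (intro allI impI)
    fix i assume "i < length (l @ l')"
    then consider "i < length l" | j where "i = length l + j" "j < length l'"
      by (metis add_diff_inverse_nat length_append nat_add_left_cancel_less)
    then show "\<Phi> (set (take i (l @ l'))) ((l @ l') ! i)"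
    proof cases
      case 1 with that(1) show ?thesis by (simp add: der_def nth_append)
    next
      case 2
      with that(2) show ?thesis
        by (auto simp: der_def intro: finitary_mono[OF fin, of "set (take j l')"])
    qed
  qed
  have derI: "\<exists>l. der l \<and> x \<in> set l" if "x \<in> ?L" for x
    using that
  proof (rule lfp_induct_set[OF _ mono])
    fix x assume "x \<in> {x. \<Phi> (?L \<inter> {x. \<exists>l. der l \<and> x \<in> set l}) x}"
    \<comment> \<open>Only finitely many premises are used, so their derivations can be concatenated
      and \<open>x\<close> appended.\<close>
    then obtain T where T: "finite T" "T \<subseteq> {x. \<exists>l. der l \<and> x \<in> set l}" "\<Phi> T x"
      using finitaryD[OF fin, of "?L \<inter> {x. \<exists>l. der l \<and> x \<in> set l}" x] by auto
    from T(1,2) have "\<exists>l. der l \<and> T \<subseteq> set l"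
    proof (induction T)
      case empty show ?case by (intro exI[of _ "[]"]) (simp add: der_def)
    next
      case (insert y T)
      then obtain l l' where "der l" "T \<subseteq> set l" "der l'" "y \<in> set l'" by auto
      then show ?case by (intro exI[of _ "l @ l'"]) (auto intro: der_append)
    qed
    then obtain l where l: "der l" "T \<subseteq> set l" by blast
    then have "\<Phi> (set l) x" using T(3) by (auto intro: finitary_mono[OF fin, of T])
    with l(1) have "der (l @ [x])" by (auto simp: der_def nth_append less_Suc_eq)
    then show "\<exists>l. der l \<and> x \<in> set l" by (intro exI[of _ "l @ [x]"]) auto
  qed
  \<comment> \<open>Derivations become numbers: \<open>n\<close> is the position of the conclusion
    in the sequence coded by \<open>s\<close>, and later entries are ignored.\<close>
  have "x \<in> ?L \<longleftrightarrow> (\<exists>s n. nthc s n = x \<and> (\<forall>i<Suc n. \<Phi> (seqset i s) (nthc s i)))" for x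
  proof
    assume "x \<in> ?L"
    then obtain l n where l: "der l" "n < length l" "x = l ! n" using derI by (metis in_set_conv_nth)
    have "seqset i (list_encode l) = set (take i l)" if "i < Suc n" for i
      using that l(2) unfolding seqset_def set_conv_nth by force
    then have "\<forall>i<Suc n. \<Phi> (seqset i (list_encode l)) (nthc (list_encode l) i)"
      using l by (auto simp: der_def less_Suc_eq)
    then show "\<exists>s n. nthc s n = x \<and> (\<forall>i<Suc n. \<Phi> (seqset i s) (nthc s i))"
      using l by (intro exI[of _ "list_encode l"] exI[of _ n]) auto
  next
    assume "\<exists>s n. nthc s n = x \<and> (\<forall>i<Suc n. \<Phi> (seqset i s) (nthc s i))"
    then obtain s n where x: "nthc s n = x" and s: "\<And>i. i < Suc n \<Longrightarrow> \<Phi> (seqset i s) (nthc s i)" by blast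
    have "i < Suc n \<Longrightarrow> nthc s i \<in> ?L" for i
    proof (induction i rule: less_induct)
      case (less i)
      then have "seqset i s \<subseteq> ?L" by (auto simp: seqset_def)
      then show ?case using s[OF less.prems] unfolding unfold[of "nthc s i"]
        by (rule finitary_mono[OF fin])
    qed
    with x show "x \<in> ?L" by blast
  qed
  moreover have "sigma1 (\<lambda>x. \<exists>s n. nthc s n = x \<and> (\<forall>i<Suc n. \<Phi> (seqset i s) (nthc s i)))"
  proof -
    have *: "sigma1 (\<lambda>x. \<Phi> (seqset (f x) (g x)) (h x))" if "computable f" "computable g" "computable h" for f g h
      using sigma1_comp[OF sig, of "\<lambda>x. prod_encode (h x, prod_encode (f x, g x))"] that
      by (simp add: comp_intros)
    show ?thesis by (intro sigma1_intros comp_intros *)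
  qed
  ultimately show ?thesis by simp
qed

section \<open>A universal partial recursive function\<close>

abbreviation consc :: "nat \<Rightarrow> nat \<Rightarrow> nat" where "consc x t \<equiv> Suc (prod_encode (x, t))"

text \<open>Judgements of the evaluation relation on codes: evaluation of a program, evaluation of a list
  of programs, being the code of a program, being the code of a list of programs.\<close>

abbreviation jev :: "nat \<Rightarrow> nat \<Rightarrow> nat \<Rightarrow> nat" where
  "jev e a y \<equiv> prod_encode (0, prod_encode (e, prod_encode (a, y)))"
abbreviation jevs :: "nat \<Rightarrow> nat \<Rightarrow> nat \<Rightarrow> nat" where
  "jevs e a y \<equiv> prod_encode (1, prod_encode (e, prod_encode (a, y)))"
abbreviation jcode :: "nat \<Rightarrow> nat" where "jcode e \<equiv> prod_encode (2, e)"
abbreviation jcodes :: "nat \<Rightarrow> nat" where "jcodes e \<equiv> prod_encode (3, e)"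

text \<open>The evaluation clauses mirror the rules of \<open>eval\<close>. The code judgements
  matter where a subprogram occurs without being evaluated, as \<open>g\<close> does in primitive
  recursion at 0; without them, numbers that code no program would acquire values.\<close>

definition eval_step :: "nat set \<Rightarrow> nat \<Rightarrow> bool" where
  "eval_step S z \<longleftrightarrow>
    (\<exists>a. z = jev (prod_encode (0, 0)) a 0) \<or>
    (\<exists>x t. z = jev (prod_encode (1, 0)) (consc x t) (Suc x)) \<or>
    (\<exists>i a. dropc a i \<noteq> 0 \<and> z = jev (prod_encode (2, i)) a (nthc a i)) \<or>
    (\<exists>f gs a ys y. z = jev (prod_encode (3, prod_encode (f, gs))) a y \<and> jevs gs a ys \<in> S \<and> jev f ys y \<in> S) \<or>
    (\<exists>f g t y. z = jev (prod_encode (4, prod_encode (f, g))) (consc 0 t) y \<and> jcode g \<in> S \<and> jev f t y \<in> S) \<or>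
    (\<exists>f g n t y u. z = jev (prod_encode (4, prod_encode (f, g))) (consc (Suc n) t) y \<and>
       jev (prod_encode (4, prod_encode (f, g))) (consc n t) u \<in> S \<and> jev g (consc n (consc u t)) y \<in> S) \<or>
    (\<exists>f a n. z = jev (prod_encode (5, f)) a n \<and> jev f (consc n a) 0 \<in> S \<and>
       (\<forall>m<n. \<exists>y. jev f (consc m a) (Suc y) \<in> S)) \<or>
    (\<exists>a. z = jevs 0 a 0) \<or>
    (\<exists>g gs a y ys. z = jevs (consc g gs) a (consc y ys) \<and> jev g a y \<in> S \<and> jevs gs a ys \<in> S) \<or>
    z = jcode (prod_encode (0, 0)) \<or>
    z = jcode (prod_encode (1, 0)) \<or>
    (\<exists>i. z = jcode (prod_encode (2, i))) \<or>
    (\<exists>f gs. z = jcode (prod_encode (3, prod_encode (f, gs))) \<and> jcode f \<in> S \<and> jcodes gs \<in> S) \<or>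
    (\<exists>f g. z = jcode (prod_encode (4, prod_encode (f, g))) \<and> jcode f \<in> S \<and> jcode g \<in> S) \<or>
    (\<exists>f. z = jcode (prod_encode (5, f)) \<and> jcode f \<in> S) \<or>
    z = jcodes 0 \<or>
    (\<exists>g gs. z = jcodes (consc g gs) \<and> jcode g \<in> S \<and> jcodes gs \<in> S)"

definition evals :: "nat set" where "evals = lfp (\<lambda>S. {z. eval_step S z})"

lemma finitary_eval_step: "finitary (\<lambda>S. eval_step S z)"
  unfolding eval_step_def by (intro finitary_intros)

lemma sigma1_evals: "computable f \<Longrightarrow> sigma1 (\<lambda>x. f x \<in> evals)"
proof -
  have "sigma1 (\<lambda>z. eval_step (seqset (p1 (p2 z)) (p2 (p2 z))) (p1 z))"
    unfolding eval_step_def by (intro sigma1_intros comp_intros)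
  from sigma1_lfp[OF finitary_eval_step this] show "computable f \<Longrightarrow> sigma1 (\<lambda>x. f x \<in> evals)"
    unfolding evals_def by (rule sigma1_comp)
qed

lemma evals_iff: "z \<in> evals \<longleftrightarrow> eval_step evals z"
proof -
  have "mono (\<lambda>S. {z. eval_step S z})"
    by (intro monoI subsetI) (auto intro: finitary_mono[OF finitary_eval_step])
  from lfp_unfold[OF this] show ?thesis unfolding evals_def by blast
qed

lemma jcode_evals: "jcode (recf_code p) \<in> evals"
proof (induction p)
  case (Comp f gs)
  have "jcodes (list_encode (map recf_code gs)) \<in> evals"
    using Comp.IH(2)
  proof (induction gs)
    case Nil show ?case by (subst evals_iff) (simp add: eval_step_def)
  next
    case (Cons g gs) then show ?case by (subst evals_iff) (simp add: eval_step_def)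
  qed
  with Comp.IH(1) show ?case by (subst evals_iff) (simp add: eval_step_def)
qed (subst evals_iff, simp add: eval_step_def)+

lemma eval_imp_evals: "eval p xs y \<Longrightarrow> jev (recf_code p) (list_encode xs) y \<in> evals"
proof (induction rule: eval.induct)
  case (eval_Zero xs) show ?case by (subst evals_iff) (simp add: eval_step_def)
next
  case (eval_Succ x xs) show ?case by (subst evals_iff) (simp add: eval_step_def)
next
  case (eval_Proj i xs) then show ?case
    by (subst evals_iff) (auto simp: eval_step_def intro!: disjI2 exI[of _ "list_encode xs"] dest!: sym[of "xs ! i"])
next
  case (eval_Comp xs gs ys f z)
  have "jevs (list_encode (map recf_code gs)) (list_encode xs) (list_encode ys) \<in> evals"
    using eval_Comp.IH(1)
  proof (induction gs ys rule: list_all2_induct)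
    case Nil show ?case by (subst evals_iff) (simp add: eval_step_def)
  next
    case (Cons g gs y ys) then show ?case by (subst evals_iff) (simp add: eval_step_def)
  qed
  with eval_Comp.IH(2) show ?case by (subst evals_iff) (auto simp: eval_step_def)
next
  case (eval_Prec_0 f xs y g)
  then show ?case using jcode_evals[of g] by (subst evals_iff) (simp add: eval_step_def)
next
  case (eval_Prec_Suc f g n xs y z)
  then show ?case by (subst evals_iff) (auto simp: eval_step_def)
next
  case (eval_Mu f n xs)
  then show ?case by (subst evals_iff) (auto simp: eval_step_def)
qed

definition good_judgement :: "nat \<Rightarrow> bool" where
  "good_judgement z \<longleftrightarrow>
    (\<forall>e a y. z = jev e a y \<longrightarrow> (\<exists>p xs. e = recf_code p \<and> a = list_encode xs \<and> eval p xs y)) \<and>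
    (\<forall>e a y. z = jevs e a y \<longrightarrow> (\<exists>ps xs ys. e = list_encode (map recf_code ps) \<and> a = list_encode xs \<and>
       y = list_encode ys \<and> list_all2 (\<lambda>p y. eval p xs y) ps ys)) \<and>
    (\<forall>e. z = jcode e \<longrightarrow> (\<exists>p. e = recf_code p)) \<and>
    (\<forall>e. z = jcodes e \<longrightarrow> (\<exists>ps. e = list_encode (map recf_code ps)))"

lemma recf_code_eq [simp]: "recf_code p = recf_code q \<longleftrightarrow> p = q"
  using recf_code_inj by blast

lemma list_encode_ex: "\<exists>xs. a = list_encode xs"
  by (metis list_decode_inverse)

lemma consc_list_encode: "consc x (list_encode xs) = list_encode (x # xs)"
  by simp

lemma evals_good: assumes "z \<in> evals" shows "good_judgement z"
proof (rule lfp_induct_set[OF assms[unfolded evals_def]])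
  show "mono (\<lambda>S. {z. eval_step S z})"
    by (intro monoI subsetI) (auto intro: finitary_mono[OF finitary_eval_step])
next
  fix z assume z: "z \<in> {z. eval_step (lfp (\<lambda>S. {z. eval_step S z}) \<inter> {x. good_judgement x}) z}"
  define S where "S = lfp (\<lambda>S. {z. eval_step S z}) \<inter> {x. good_judgement x}"
  have ev: "\<exists>p xs. e = recf_code p \<and> a = list_encode xs \<and> eval p xs y" if "jev e a y \<in> S" for e a y
    using that unfolding S_def good_judgement_def by blast
  have evs: "\<exists>ps xs ys. e = list_encode (map recf_code ps) \<and> a = list_encode xs \<and>
       y = list_encode ys \<and> list_all2 (\<lambda>p y. eval p xs y) ps ys" if "jevs e a y \<in> S" for e a y
    using that unfolding S_def good_judgement_def by blast
  have code: "\<exists>p. e = recf_code p" if "jcode e \<in> S" for e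
    using that unfolding S_def good_judgement_def by blast
  have codes: "\<exists>ps. e = list_encode (map recf_code ps)" if "jcodes e \<in> S" for e
    using that unfolding S_def good_judgement_def by blast
  from z have "eval_step S z" by (simp add: S_def)
  then show "good_judgement z"
    unfolding eval_step_def
  proof (elim disjE exE conjE, goal_cases)
    case (1 a)
    obtain xs where "a = list_encode xs" using list_encode_ex by blast
    with 1 show ?case using eval_Zero[of xs] recf_code.simps(1) unfolding good_judgement_def
      by (auto simp del: recf_code.simps list_encode.simps) metis
  next
    case (2 x t)
    obtain xs where "t = list_encode xs" using list_encode_ex by blast
    then have "consc x t = list_encode (x # xs)" by simp
    with 2 show ?case using eval_Succ[of x xs] recf_code.simps(2) unfolding good_judgement_def
      by (auto simp del: recf_code.simps list_encode.simps) metis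
  next
    case (3 i a)
    obtain xs where xs: "a = list_encode xs" using list_encode_ex by blast
    with 3 have "i < length xs" by simp
    with 3 xs show ?case using eval_Proj[of i xs] recf_code.simps(3)[of i] unfolding good_judgement_def
      by (auto simp del: recf_code.simps list_encode.simps) metis
  next
    case (4 f gs a ys y)
    from ev[OF 4(3)] evs[OF 4(2)] obtain p ps xs us where
      *: "f = recf_code p" "gs = list_encode (map recf_code ps)" "a = list_encode xs" "ys = list_encode us"
      "list_all2 (\<lambda>p y. eval p xs y) ps us" "eval p us y" by auto
    have "eval (Comp p ps) xs y" using * eval_Comp by blast
    with 4(1) * show ?case using recf_code.simps(4)[of p ps] unfolding good_judgement_def
      by (auto simp del: recf_code.simps list_encode.simps) metis
  next
    case (5 f g t y)
    from ev[OF 5(3)] code[OF 5(2)] obtain p q xs where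
      *: "f = recf_code p" "g = recf_code q" "t = list_encode xs" "eval p xs y" by auto
    have "eval (Prec p q) (0 # xs) y" using * eval_Prec_0 by blast
    with 5(1) * show ?case using recf_code.simps(5)[of p q] unfolding good_judgement_def
      by (auto simp del: recf_code.simps list_encode.simps simp: consc_list_encode) metis
  next
    case (6 f g n t y u)
    \<comment> \<open>The premise concerns the same code at \<open>n\<close>. The program that the
      induction hypothesis gives for it must be a primitive recursion, and it supplies the programs
      behind \<open>f\<close> and \<open>g\<close>.\<close>
    from ev[OF 6(2)] obtain r ns where r: "prod_encode (4, prod_encode (f, g)) = recf_code r"
      "consc n t = list_encode ns" "eval r ns u" by blast
    from r(1) obtain p q where pq: "r = Prec p q" "f = recf_code p" "g = recf_code q" by (cases r) auto
    obtain xs where xs: "t = list_encode xs" using list_encode_ex by blast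
    with r(2) have ns: "ns = n # xs" by (simp add: consc_list_encode del: list_encode.simps)
    from ev[OF 6(3)] pq xs have "eval q (n # u # xs) y"
      by (auto simp add: consc_list_encode simp del: list_encode.simps)
    then have "eval (Prec p q) (Suc n # xs) y" using r(3) ns pq eval_Prec_Suc by blast
    with 6(1) pq xs show ?case using recf_code.simps(5)[of p q] unfolding good_judgement_def
      by (auto simp del: recf_code.simps list_encode.simps simp: consc_list_encode) metis
  next
    case (7 f a n)
    obtain xs where xs: "a = list_encode xs" using list_encode_ex by blast
    from ev[OF 7(2)] xs obtain p where p: "f = recf_code p" "eval p (n # xs) 0"
      by (auto simp add: consc_list_encode simp del: list_encode.simps)
    have "\<exists>y. eval p (m # xs) (Suc y)" if "m < n" for m
    proof -
      from 7(3) that obtain y where "jev f (consc m a) (Suc y) \<in> S" by blast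
      from ev[OF this] p xs show ?thesis by (auto simp add: consc_list_encode simp del: list_encode.simps)
    qed
    with p have "eval (Mu p) xs n" by (intro eval_Mu) auto
    with 7(1) p xs show ?case using recf_code.simps(6)[of p] unfolding good_judgement_def
      by (auto simp del: recf_code.simps list_encode.simps) metis
  next
    case (8 a)
    obtain xs where "a = list_encode xs" using list_encode_ex by blast
    with 8 show ?case unfolding good_judgement_def by auto
  next
    case (9 g gs a y ys)
    from ev[OF 9(2)] evs[OF 9(3)] obtain p ps xs us where
      *: "g = recf_code p" "gs = list_encode (map recf_code ps)" "a = list_encode xs" "ys = list_encode us"
      "list_all2 (\<lambda>p y. eval p xs y) ps us" "eval p xs y" by auto
    have "consc g gs = list_encode (map recf_code (p # ps))" "consc y ys = list_encode (y # us)"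
      "list_all2 (\<lambda>p y. eval p xs y) (p # ps) (y # us)" using * by simp_all
    with 9(1) *(3) show ?case unfolding good_judgement_def
      by (auto simp del: recf_code.simps list_encode.simps list.map list_all2_Cons list.rel_inject)
  next
    case 10 then show ?case unfolding good_judgement_def by (auto intro: exI[of _ Zero])
  next
    case 11 then show ?case unfolding good_judgement_def by (auto intro: exI[of _ Succ])
  next
    case (12 i) then show ?case unfolding good_judgement_def by (auto intro: exI[of _ "Proj i"])
  next
    case (13 f gs)
    from code[OF 13(2)] codes[OF 13(3)] obtain p ps where "f = recf_code p" "gs = list_encode (map recf_code ps)" by blast
    with 13(1) show ?case unfolding good_judgement_def by (auto intro: exI[of _ "Comp p ps"])
  next
    case (14 f g)
    from code[OF 14(2)] code[OF 14(3)] obtain p q where "f = recf_code p" "g = recf_code q" by blast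
    with 14(1) show ?case unfolding good_judgement_def by (auto intro: exI[of _ "Prec p q"])
  next
    case (15 f)
    from code[OF 15(2)] obtain p where "f = recf_code p" by blast
    with 15(1) show ?case unfolding good_judgement_def by (auto intro: exI[of _ "Mu p"])
  next
    case 16 then show ?case unfolding good_judgement_def by auto
  next
    case (17 g gs)
    from code[OF 17(2)] codes[OF 17(3)] obtain p ps where "g = recf_code p" "gs = list_encode (map recf_code ps)" by blast
    then have "consc g gs = list_encode (map recf_code (p # ps))" by simp
    with 17(1) show ?case unfolding good_judgement_def
      by (auto simp del: recf_code.simps list_encode.simps list.map)
  qed
qed

lemma phi_iff_evals: "phi e x y \<longleftrightarrow> jev e (consc x 0) y \<in> evals"
proof
  assume "phi e x y"
  then obtain p where "e = recf_code p" "eval p [x] y" unfolding phi_def by blast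
  then show "jev e (consc x 0) y \<in> evals" using eval_imp_evals[of p "[x]" y] by simp
next
  assume "jev e (consc x 0) y \<in> evals"
  from evals_good[OF this] obtain p xs where "e = recf_code p" "consc x 0 = list_encode xs" "eval p xs y"
    unfolding good_judgement_def by blast
  moreover have "consc x 0 = list_encode [x]" by simp
  ultimately have "e = recf_code p" "eval p [x] y" by (simp_all del: list_encode.simps)
  then show "phi e x y" by simp
qed

text \<open>The enumeration theorem: the index is itself an argument. It permits c.e. definitions to
  mention membership in \<open>W e\<close> for a computed \<open>e\<close>, as any manipulation of
  nested indices must.\<close>

lemma sigma1_phi [sigma1_intros]:
  assumes "computable e" "computable f" "computable g" shows "sigma1 (\<lambda>x. phi (e x) (f x) (g x))"
  unfolding phi_iff_evals by (intro sigma1_evals comp_intros assms)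

lemma sigma1_mem_W [sigma1_intros]:
  assumes "computable e" "computable f" shows "sigma1 (\<lambda>x. f x \<in> W (e x))"
  unfolding W_def mem_Collect_eq
  by (intro sigma1_intros comp_intros assms[THEN computable_comp1])

section \<open>Notations below a given one\<close>

text \<open>One step up to a successor or from a term of a fundamental sequence to its limit. No
  reference is made to \<open>kleene_O\<close>, so the relation is c.e.; below an actual notation
  its transitive closure is \<open><\<^sub>O\<close>. The condition \<open>b \<noteq> 0\<close>
  keeps \<open>2 ^ 0 = 1\<close> from having a predecessor.\<close>

definition nstep :: "nat \<Rightarrow> nat \<Rightarrow> bool" where
  "nstep b c \<longleftrightarrow> (b \<noteq> 0 \<and> c = 2 ^ b) \<or> (\<exists>e n. c = 3 * 5 ^ e \<and> phi e n b)"

definition leO :: "nat \<Rightarrow> nat \<Rightarrow> bool" where "leO b c \<longleftrightarrow> nstep\<^sup>*\<^sup>* b c"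

lemma computable_times_power [comp_intros]:
  assumes "computable f"
  shows "computable (\<lambda>x. 2 ^ f x)" "computable (\<lambda>x. 3 * 5 ^ f x)"
proof -
  have "rec_nat 1 (\<lambda>_ y. y + y) n = (2::nat) ^ n" for n :: nat by (induction n) auto
  moreover have "computable (\<lambda>x. rec_nat 1 (\<lambda>_ y. y + y) (f x))" by (intro comp_intros assms)
  ultimately show "computable (\<lambda>x. 2 ^ f x)" by simp
  have "rec_nat 3 (\<lambda>_ y. y + (y + (y + (y + y)))) n = (3::nat) * 5 ^ n" for n :: nat by (induction n) auto
  moreover have "computable (\<lambda>x. rec_nat 3 (\<lambda>_ y. y + (y + (y + (y + y)))) (f x))" by (intro comp_intros assms)
  ultimately show "computable (\<lambda>x. 3 * 5 ^ f x)" by simp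
qed

lemma sigma1_nstep [sigma1_intros]:
  assumes "computable f" "computable g" shows "sigma1 (\<lambda>x. nstep (f x) (g x))"
  unfolding nstep_def by (intro sigma1_intros comp_intros assms assms[THEN computable_comp1])

lemma sigma1_leO [sigma1_intros]:
  assumes "computable f" "computable g" shows "sigma1 (\<lambda>x. leO (f x) (g x))"
proof -
  have "leO b c \<longleftrightarrow> (\<exists>s n. nthc s 0 = b \<and> nthc s n = c \<and> (\<forall>i<n. nstep (nthc s i) (nthc s (Suc i))))" for b c
  proof
    assume "leO b c"
    then obtain n h where h: "h 0 = b" "h n = c" "\<And>i. i < n \<Longrightarrow> nstep (h i) (h (Suc i))"
      unfolding leO_def rtranclp_power relpowp_fun_conv by blast
    have "nthc (list_encode (map h [0..<Suc n])) i = h i" if "i \<le> n" for i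
      using that by (subst nthc_list_encode) (auto simp del: upt_Suc)
    with h show "\<exists>s n. nthc s 0 = b \<and> nthc s n = c \<and> (\<forall>i<n. nstep (nthc s i) (nthc s (Suc i)))"
      by (intro exI[of _ "list_encode (map h [0..<Suc n])"] exI[of _ n]) (auto simp del: list_encode.simps upt_Suc)
  next
    assume "\<exists>s n. nthc s 0 = b \<and> nthc s n = c \<and> (\<forall>i<n. nstep (nthc s i) (nthc s (Suc i)))"
    then show "leO b c" unfolding leO_def rtranclp_power relpowp_fun_conv by blast
  qed
  then show ?thesis by (simp, intro sigma1_intros comp_intros assms[THEN computable_comp1])
qed

lemma odd_lim: "odd (3 * 5 ^ e :: nat)" and lim_neq_1: "3 * 5 ^ e \<noteq> (1::nat)"
  by simp_all

lemma suc_neq_lim: "b \<noteq> 0 \<Longrightarrow> 2 ^ b \<noteq> (3 * 5 ^ e :: nat)"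
  using odd_lim by (metis even_power even_numeral neq0_conv)

lemma kleene_O_pos: "kleene_O b \<Longrightarrow> b \<noteq> 0"
  by (induction rule: kleene_O_kleene_less.inducts(1)[where ?P2.0="\<lambda>_ _. True"]) auto

lemma kleene_O_sucD: "kleene_O (2 ^ b) \<Longrightarrow> b \<noteq> 0 \<Longrightarrow> kleene_O b"
  using suc_neq_lim by (auto elim: kleene_O.cases)

lemma kleene_O_limD:
  assumes "kleene_O (3 * 5 ^ e)"
  obtains f where "\<And>n. phi e n (f n)" "\<And>n. kleene_O (f n)" "\<And>n. f n <\<^sub>O f (Suc n)"
  using assms
proof (cases rule: kleene_O.cases)
  case O_zero then show ?thesis using lim_neq_1 by metis
next
  case (O_suc a) then show ?thesis using suc_neq_lim kleene_O_pos by metis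
next
  case (O_lim e' f)
  then have "e' = e" by simp
  then show ?thesis by (intro that[of f]) (use O_lim in simp_all)
qed

lemma nstepD: assumes "nstep b c" "kleene_O c" shows "kleene_O b \<and> b <\<^sub>O c"
  using assms(1) unfolding nstep_def
proof (elim disjE exE conjE)
  assume "b \<noteq> 0" "c = 2 ^ b"
  then show ?thesis using kleene_O_sucD assms(2) less_suc by blast
next
  fix e n assume e: "c = 3 * 5 ^ e" "phi e n b"
  with assms(2) obtain f where "\<And>n. phi e n (f n)" "\<And>n. kleene_O (f n)" using kleene_O_limD by metis
  with e(2) have "kleene_O b" using phi_det by metis
  with e assms(2) show ?thesis using less_lim by blast
qed

lemma less_imp_nsteps: "b <\<^sub>O c \<Longrightarrow> nstep\<^sup>+\<^sup>+ b c"
proof (induction rule: kleene_O_kleene_less.inducts(2)[where ?P1.0="\<lambda>_. True"])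
  case (less_suc a)
  then show ?case using kleene_O_pos by (auto simp: nstep_def)
next
  case (less_lim e n b)
  then show ?case by (auto simp: nstep_def)
qed auto

lemma nstepsD: assumes "nstep\<^sup>+\<^sup>+ b c" "kleene_O c" shows "kleene_O b \<and> b <\<^sub>O c"
  using assms(1)
proof (induction rule: converse_tranclp_induct)
  case (base y) then show ?case using nstepD assms(2) by blast
next
  case (step y z) then show ?case using nstepD less_trans by blast
qed

lemma less_O: "b <\<^sub>O c \<Longrightarrow> kleene_O b \<and> kleene_O c"
proof (induction rule: kleene_O_kleene_less.inducts(2)[where ?P1.0="\<lambda>_. True"])
  case (less_suc a) then show ?case by (auto intro: O_suc)
next
  case (less_lim e n b)
  then have "nstep b (3 * 5 ^ e)" by (auto simp: nstep_def)
  with less_lim show ?case using nstepD by blast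
qed auto

lemma leO_iff: assumes "kleene_O c" shows "leO b c \<longleftrightarrow> b = c \<or> b <\<^sub>O c"
  unfolding leO_def
proof
  assume "nstep\<^sup>*\<^sup>* b c"
  then show "b = c \<or> b <\<^sub>O c" using nstepsD[OF _ assms] by (auto dest: rtranclpD)
next
  assume "b = c \<or> b <\<^sub>O c"
  then show "nstep\<^sup>*\<^sup>* b c" using less_imp_nsteps by (auto intro: tranclp_into_rtranclp)
qed

lemma leO_refl: "leO b b" by (simp add: leO_def)

lemma leO_trans: "leO b c \<Longrightarrow> leO c d \<Longrightarrow> leO b d"
  unfolding leO_def by (rule rtranclp_trans)

lemma less_leO: "b <\<^sub>O c \<Longrightarrow> leO b c"
  unfolding leO_def by (rule tranclp_into_rtranclp) (rule less_imp_nsteps)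

lemma le_less_O: assumes "leO b c" "c <\<^sub>O d" shows "b <\<^sub>O d"
proof -
  have "b = c \<or> b <\<^sub>O c" using assms leO_iff less_O by simp
  then show ?thesis using assms(2) less_trans[of b c d] by auto
qed

lemma less_le_O: assumes "b <\<^sub>O c" "leO c d" "kleene_O d" shows "b <\<^sub>O d"
proof -
  have "c = d \<or> c <\<^sub>O d" using assms leO_iff by simp
  then show ?thesis using assms(1) less_trans[of b c d] by auto
qed

lemma not_less_one: "\<not> b <\<^sub>O 1"
proof
  assume "b <\<^sub>O 1"
  then obtain d where "nstep d 1" using less_imp_nsteps by (metis tranclp.cases)
  then have "d \<noteq> 0" "2 ^ d = (1::nat)" using lim_neq_1 unfolding nstep_def by metis+
  with less_exp[of d] show False by linarith
qed

lemma one_less: "kleene_O b \<Longrightarrow> b \<noteq> 1 \<Longrightarrow> 1 <\<^sub>O b"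
proof -
  have "kleene_O b \<Longrightarrow> b = 1 \<or> 1 <\<^sub>O b"
  proof (induction rule: kleene_O_kleene_less.inducts(1)[where ?P2.0="\<lambda>_ _. True"])
    case (O_suc a)
    then show ?case using less_suc[of a] less_trans by blast
  next
    case (O_lim e f)
    then have "f 0 <\<^sub>O 3 * 5 ^ e" using less_lim[OF kleene_O_kleene_less.O_lim[of e f]] by blast
    with O_lim show ?case using less_trans by metis
  qed auto
  then show "kleene_O b \<Longrightarrow> b \<noteq> 1 \<Longrightarrow> 1 <\<^sub>O b" by blast
qed

lemma less_lastE:
  assumes "b <\<^sub>O c" obtains d where "leO b d" "nstep d c"
  using less_imp_nsteps[OF assms] unfolding leO_def by (metis tranclp.cases tranclp_into_rtranclp rtranclp.rtrancl_refl)

lemma less_sucD: assumes "b <\<^sub>O 2 ^ a" shows "leO b a"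
proof -
  obtain d where d: "leO b d" "nstep d (2 ^ a)" using assms by (rule less_lastE)
  have "a \<noteq> 0" using assms not_less_one[of b] by (cases a) auto
  with d show ?thesis using suc_neq_lim by (auto simp: nstep_def)
qed

text \<open>Below a successor, the predecessor bounds everything. Below a limit, each element lies
  under some term of the fundamental sequence, and the terms increase, so a late enough term bounds
  both.\<close>

lemma directed_below:
  assumes "b <\<^sub>O c" "b' <\<^sub>O c" shows "\<exists>d. d <\<^sub>O c \<and> leO b d \<and> leO b' d"
proof -
  have "kleene_O c" using assms less_O by blast
  then show ?thesis
  proof (cases rule: kleene_O.cases)
    case O_zero then show ?thesis using assms not_less_one by blast
  next
    case (O_suc a) then show ?thesis using assms less_sucD[of b a] less_sucD[of b' a] less_suc by auto
  next
    case (O_lim e f)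
    have f: "\<exists>n. leO x (f n)" if "x <\<^sub>O c" for x
    proof -
      from that obtain d where "leO x d" "nstep d c" by (rule less_lastE)
      then show ?thesis using O_lim suc_neq_lim phi_det by (auto simp: nstep_def) (metis)+
    qed
    have mono: "leO (f m) (f (m + k))" for m k
      by (induction k) (auto intro: leO_refl leO_trans[OF _ less_leO[OF O_lim(4)]])
    obtain m n where "leO b (f m)" "leO b' (f n)" using f assms by blast
    then have "leO b (f (m + n))" "leO b' (f (m + n))"
      using mono[of m n] mono[of n m] leO_trans by (auto simp: add.commute)
    moreover have "f (m + n) <\<^sub>O c" using O_lim \<open>kleene_O c\<close> less_lim by blast
    ultimately show ?thesis by blast
  qed
qed

text \<open>Turns \<alpha> \<ge> 2 into a concrete notation: if \<open>1\<close> were the only one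
  below \<open>a\<close>, a two-element order would embed into a field with at most one
  point.\<close>

lemma exists_nonzero_below:
  assumes "(natLeq_on 2, kleene_ord a) \<in> ordLeq" shows "\<exists>b. b <\<^sub>O a \<and> b \<noteq> 1"
proof (rule ccontr)
  assume *: "\<not> ?thesis"
  obtain f where f: "embed (natLeq_on 2) (kleene_ord a) f" using assms unfolding ordLeq_def by blast
  have "inj_on f (Field (natLeq_on 2))" by (rule embed_inj_on[OF natLeq_on_Well_order f])
  moreover have "f ` Field (natLeq_on 2) \<subseteq> Field (kleene_ord a)" by (rule embed_Field[OF f])
  moreover have "Field (kleene_ord a) \<subseteq> {1}" using * by (auto simp: kleene_ord_def Field_def)
  ultimately have "card (Field (natLeq_on 2)) \<le> card {1::nat}"
    by (meson card_inj_on_le finite.emptyI finite.insertI subset_trans)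
  then show False by (simp add: Field_natLeq_on)
qed

section \<open>Indices of formulas\<close>

lemma trm_code_inj: "trm_code s = trm_code t \<Longrightarrow> s = t"
proof (induction s arbitrary: t)
  case (Var i) then show ?case by (cases t) auto
next
  case (Fn f ss)
  then obtain ts where t: "t = Fn f ts" "map trm_code ss = map trm_code ts" by (cases t) auto
  have "ss = ts" using t(2) Fn.IH
  proof (induction ss arbitrary: ts)
    case (Cons s ss) then show ?case by (cases ts) auto
  qed auto
  with t show ?case by simp
qed

lemma map_trm_code_eq: "map trm_code ss = map trm_code ts \<longleftrightarrow> ss = ts"
  by (rule inj_map_eq_map) (auto simp: inj_def trm_code_inj)

lemma qf_code_inj: "qf_code \<theta> = qf_code \<eta> \<Longrightarrow> \<theta> = \<eta>"
proof (induction \<theta> arbitrary: \<eta>)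
  case Bot then show ?case by (cases \<eta>) auto
next
  case (Eq s t) then show ?case by (cases \<eta>) (auto dest: trm_code_inj)
next
  case (Rel r ts) then show ?case by (cases \<eta>) (auto simp: map_trm_code_eq)
next
  case (Neg \<theta>) then show ?case by (cases \<eta>) auto
next
  case (And \<theta>1 \<theta>2) then show ?case by (cases \<eta>) auto
next
  case (Or \<theta>1 \<theta>2) then show ?case by (cases \<eta>) auto
qed

fun opp :: "side \<Rightarrow> side" where "opp SideSigma = SidePi" | "opp SidePi = SideSigma"

lemma opp_opp [simp]: "opp (opp s) = s" by (cases s) auto

lemma side_code_eq [simp]: "side_code s = side_code t \<longleftrightarrow> s = t"
  by (cases s; cases t) auto

lemma side_code_opp: "side_code (opp s) = 1 - side_code s"
  by (cases s) auto

lemma index_eq [simp]: "index s a xs e = index s' a' xs' e' \<longleftrightarrow> s = s' \<and> a = a' \<and> xs = xs' \<and> e = e'"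
  by (simp add: index_def)

lemma has_index_unique: "has_index L s a xs e \<phi> \<Longrightarrow> has_index L s a xs e \<psi> \<Longrightarrow> \<phi> = \<psi>"
proof (induction arbitrary: \<psi> rule: has_index.induct)
  case (index_zero \<theta> xs s)
  from index_zero.prems show ?case by (cases rule: has_index.cases) (auto dest: qf_code_inj)
next
  case (index_Sigma a e xs F)
  from index_Sigma.prems show ?case
  proof (cases rule: has_index.cases)
    case (index_Sigma F')
    have "F j = F' j" if "prod_encode (j, list_encode us) \<in> W e" for j us
      using index_Sigma.IH[OF that] index_Sigma(4)[OF that] by auto
    then have "{foldr Ex us (F j) |j us. prod_encode (j, list_encode us) \<in> W e} =
        {foldr Ex us (F' j) |j us. prod_encode (j, list_encode us) \<in> W e}"
      by (intro Collect_cong ex_cong1) auto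
    with index_Sigma show ?thesis by simp
  qed (use index_Sigma in auto)
next
  case (index_Pi a e xs F)
  from index_Pi.prems show ?case
  proof (cases rule: has_index.cases)
    case (index_Pi F')
    have "F j = F' j" if "prod_encode (j, list_encode us) \<in> W e" for j us
      using index_Pi.IH[OF that] index_Pi(4)[OF that] by auto
    then have "{foldr All us (F j) |j us. prod_encode (j, list_encode us) \<in> W e} =
        {foldr All us (F' j) |j us. prod_encode (j, list_encode us) \<in> W e}"
      by (intro Collect_cong ex_cong1) auto
    with index_Pi show ?thesis by simp
  qed (use index_Pi in auto)
qed

text \<open>An index denotes at most one formula, so the arbitrary \<open>F\<close> in each rule of
  \<open>has_index\<close> can be replaced by this one function, common to all formulas.\<close>

definition fm_of :: "lang \<Rightarrow> nat \<Rightarrow> fm" where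
  "fm_of L j = (THE \<phi>. \<exists>s a xs e. j = index s a xs e \<and> has_index L s a xs e \<phi>)"

lemma fm_of_index: "has_index L s a xs e \<phi> \<Longrightarrow> fm_of L (index s a xs e) = \<phi>"
  unfolding fm_of_def by (rule the_equality) (auto dest: has_index_unique)

section \<open>Truth of indexed formulas, for both sides at once\<close>

lemma sat_foldr_Ex:
  "sat M (foldr Ex us \<phi>) v \<longleftrightarrow> (\<exists>u. (\<forall>x. x \<notin> set us \<longrightarrow> u x = v x) \<and> sat M \<phi> u)"
proof (induction us arbitrary: v)
  case Nil
  have "(\<forall>x. u x = v x) \<longleftrightarrow> u = v" for u by auto
  then show ?case by auto
next
  case (Cons y us)
  show ?case
  proof
    assume "sat M (foldr Ex (y # us) \<phi>) v"
    then obtain a u where "\<forall>x. x \<notin> set us \<longrightarrow> u x = (v(y := a)) x" "sat M \<phi> u" using Cons by auto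
    then show "\<exists>u. (\<forall>x. x \<notin> set (y # us) \<longrightarrow> u x = v x) \<and> sat M \<phi> u" by (intro exI[of _ u]) auto
  next
    assume "\<exists>u. (\<forall>x. x \<notin> set (y # us) \<longrightarrow> u x = v x) \<and> sat M \<phi> u"
    then obtain u where "\<forall>x. x \<notin> set (y # us) \<longrightarrow> u x = v x" "sat M \<phi> u" by blast
    then show "sat M (foldr Ex (y # us) \<phi>) v" using Cons by (auto intro!: exI[of _ "u y"] exI[of _ u])
  qed
qed

lemma sat_foldr_All:
  "sat M (foldr All us \<phi>) v \<longleftrightarrow> (\<forall>u. (\<forall>x. x \<notin> set us \<longrightarrow> u x = v x) \<longrightarrow> sat M \<phi> u)"
proof (induction us arbitrary: v)
  case Nil
  have "(\<forall>x. u x = v x) \<longleftrightarrow> u = v" for u by auto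
  then show ?case by auto
next
  case (Cons y us)
  show ?case
  proof
    assume *: "sat M (foldr All (y # us) \<phi>) v"
    show "\<forall>u. (\<forall>x. x \<notin> set (y # us) \<longrightarrow> u x = v x) \<longrightarrow> sat M \<phi> u"
    proof (intro allI impI)
      fix u assume u: "\<forall>x. x \<notin> set (y # us) \<longrightarrow> u x = v x"
      from * have "sat M (foldr All us \<phi>) (v(y := u y))" by simp
      with u show "sat M \<phi> u" unfolding Cons by auto
    qed
  next
    assume "\<forall>u. (\<forall>x. x \<notin> set (y # us) \<longrightarrow> u x = v x) \<longrightarrow> sat M \<phi> u"
    then show "sat M (foldr All (y # us) \<phi>) v" using Cons by auto
  qed
qed

lemma countable_members: "countable {g us (F j) | (j :: nat) (us :: nat list). P j us}"
proof -
  have "{g us (F j) | j us. P j us} \<subseteq> (\<lambda>(j, us). g us (F j)) ` UNIV" by auto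
  then show ?thesis by (rule countable_subset) simp
qed

lemma sat_Disj_members:
  "sat M (Disj (acset {foldr Ex us (F j) | (j :: nat) us. P j us})) v \<longleftrightarrow>
   (\<exists>j us u. P j us \<and> (\<forall>x. x \<notin> set us \<longrightarrow> u x = v x) \<and> sat M (F j) u)"
proof -
  have "rcset (acset {foldr Ex us (F j) | j us. P j us}) = {foldr Ex us (F j) | j us. P j us}"
    using countable_members by (intro acset_inverse) simp
  moreover have "(\<exists>\<phi>\<in>{foldr Ex us (F j) | j us. P j us}. sat M \<phi> v) \<longleftrightarrow> (\<exists>j us. P j us \<and> sat M (foldr Ex us (F j)) v)" by blast
  ultimately show ?thesis unfolding sat_Disj_iff sat_foldr_Ex by auto
qed

lemma sat_Conj_members:
  "sat M (Conj (acset {foldr All us (F j) | (j :: nat) us. P j us})) v \<longleftrightarrow>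
   (\<forall>j us u. P j us \<longrightarrow> (\<forall>x. x \<notin> set us \<longrightarrow> u x = v x) \<longrightarrow> sat M (F j) u)"
proof -
  have "rcset (acset {foldr All us (F j) | j us. P j us}) = {foldr All us (F j) | j us. P j us}"
    using countable_members by (intro acset_inverse) simp
  moreover have "(\<forall>\<phi>\<in>{foldr All us (F j) | j us. P j us}. sat M \<phi> v) \<longleftrightarrow> (\<forall>j us. P j us \<longrightarrow> sat M (foldr All us (F j)) v)" by blast
  ultimately show ?thesis unfolding sat_Conj_iff sat_foldr_All by auto
qed

text \<open>\<open>sat_side\<close> is truth for \<open>\<Sigma>\<close> and falsity for \<open>\<Pi>\<close>; with it, one existential
  clause describes both kinds of formulas.\<close>

definition sat_side :: "side \<Rightarrow> struct \<Rightarrow> fm \<Rightarrow> (nat \<Rightarrow> nat) \<Rightarrow> bool" where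
  "sat_side s M \<phi> v \<longleftrightarrow> (sat M \<phi> v \<longleftrightarrow> s = SideSigma)"

lemma sat_side_simps: "sat_side SideSigma M \<phi> v \<longleftrightarrow> sat M \<phi> v" "sat_side SidePi M \<phi> v \<longleftrightarrow> \<not> sat M \<phi> v"
  by (auto simp: sat_side_def)

lemma sat_side_opp: "sat_side (opp s) M \<phi> v \<longleftrightarrow> \<not> sat_side s M \<phi> v"
  by (cases s) (auto simp: sat_side_simps)

text \<open>With \<open>opp\<close> and \<open>sat_side\<close> a single step case covers \<Sigma>
  and \<Pi>: both are described by the existence of a member together with values for its quantified
  variables.\<close>

lemma has_index_induct [consumes 1, case_names zero step]:
  assumes "has_index L s a xs e \<phi>"
    and zero: "\<And>\<theta> xs s. qf_in L \<theta> \<Longrightarrow> qf_vars \<theta> \<subseteq> set xs \<Longrightarrow> P s 1 xs (qf_code \<theta>) (Fin \<theta>)"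
    and step: "\<And>s a xs e \<phi>. has_index L s a xs e \<phi> \<Longrightarrow> kleene_O a \<Longrightarrow> a \<noteq> 1 \<Longrightarrow>
      (\<And>j us. prod_encode (j, list_encode us) \<in> W e \<Longrightarrow>
        \<exists>b ys d. j = index (opp s) b ys d \<and> b <\<^sub>O a \<and> set ys \<subseteq> set xs \<union> set us \<and>
          has_index L (opp s) b ys d (fm_of L j) \<and> P (opp s) b ys d (fm_of L j)) \<Longrightarrow>
      (\<And>M v. sat_side s M \<phi> v \<longleftrightarrow> (\<exists>j us u. prod_encode (j, list_encode us) \<in> W e \<and>
        (\<forall>x. x \<notin> set us \<longrightarrow> u x = v x) \<and> sat_side s M (fm_of L j) u)) \<Longrightarrow>
      P s a xs e \<phi>"
  shows "P s a xs e \<phi>"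
  using assms(1)
proof (induction rule: has_index.induct)
  case (index_zero \<theta> xs s) then show ?case by (rule zero)
next
  case (index_Sigma a e xs F)
  have F: "F j = fm_of L j" if "prod_encode (j, list_encode us) \<in> W e" for j us
    using index_Sigma.IH[OF that] fm_of_index by metis
  show ?case
  proof (rule step)
    show "has_index L SideSigma a xs e (Disj (acset {foldr Ex us (F j) |j us. prod_encode (j, list_encode us) \<in> W e}))"
      using index_Sigma.IH by (intro has_index.index_Sigma index_Sigma.hyps) metis
    show "\<exists>b ys d. j = index (opp SideSigma) b ys d \<and> b <\<^sub>O a \<and> set ys \<subseteq> set xs \<union> set us \<and>
        has_index L (opp SideSigma) b ys d (fm_of L j) \<and> P (opp SideSigma) b ys d (fm_of L j)"
      if "prod_encode (j, list_encode us) \<in> W e" for j us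
      using index_Sigma.IH[OF that] F[OF that] by auto
    show "sat_side SideSigma M (Disj (acset {foldr Ex us (F j) |j us. prod_encode (j, list_encode us) \<in> W e})) v \<longleftrightarrow>
       (\<exists>j us u. prod_encode (j, list_encode us) \<in> W e \<and>
        (\<forall>x. x \<notin> set us \<longrightarrow> u x = v x) \<and> sat_side SideSigma M (fm_of L j) u)" for M v
      unfolding sat_side_simps sat_Disj_members by (intro ex_cong1) (auto simp: F)
  qed (use index_Sigma.hyps in auto)
next
  case (index_Pi a e xs F)
  have F: "F j = fm_of L j" if "prod_encode (j, list_encode us) \<in> W e" for j us
    using index_Pi.IH[OF that] fm_of_index by metis
  show ?case
  proof (rule step)
    show "has_index L SidePi a xs e (Conj (acset {foldr All us (F j) |j us. prod_encode (j, list_encode us) \<in> W e}))"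
      using index_Pi.IH by (intro has_index.index_Pi index_Pi.hyps) metis
    show "\<exists>b ys d. j = index (opp SidePi) b ys d \<and> b <\<^sub>O a \<and> set ys \<subseteq> set xs \<union> set us \<and>
        has_index L (opp SidePi) b ys d (fm_of L j) \<and> P (opp SidePi) b ys d (fm_of L j)"
      if "prod_encode (j, list_encode us) \<in> W e" for j us
      using index_Pi.IH[OF that] F[OF that] by auto
    show "sat_side SidePi M (Conj (acset {foldr All us (F j) |j us. prod_encode (j, list_encode us) \<in> W e})) v \<longleftrightarrow>
       (\<exists>j us u. prod_encode (j, list_encode us) \<in> W e \<and>
        (\<forall>x. x \<notin> set us \<longrightarrow> u x = v x) \<and> sat_side SidePi M (fm_of L j) u)" for M v
      unfolding sat_side_simps sat_Conj_members by (auto simp: F)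
  qed (use index_Pi.hyps in auto)
qed

lemma has_index_memberD:
  assumes "has_index L s a xs e \<phi>" "a \<noteq> 1" "prod_encode (j, list_encode us) \<in> W e"
  shows "\<exists>b ys d. j = index (opp s) b ys d \<and> b <\<^sub>O a \<and> set ys \<subseteq> set xs \<union> set us \<and>
    has_index L (opp s) b ys d (fm_of L j)"
  using assms by (induction rule: has_index_induct) blast+

lemma sat_side_iff:
  assumes "has_index L s a xs e \<phi>" "a \<noteq> 1"
  shows "sat_side s M \<phi> v \<longleftrightarrow> (\<exists>j us u. prod_encode (j, list_encode us) \<in> W e \<and>
    (\<forall>x. x \<notin> set us \<longrightarrow> u x = v x) \<and> sat_side s M (fm_of L j) u)"
  using assms by (induction rule: has_index_induct) simp_all

text \<open>Constructing a formula thus reduces to giving a c.e. set all of whose elements are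
  admissible; the formula itself is assembled with \<open>fm_of\<close>.\<close>

lemma has_index_ex:
  assumes "kleene_O a" "a \<noteq> 1"
    and "\<And>j us. prod_encode (j, list_encode us) \<in> W e \<Longrightarrow>
      \<exists>b ys d \<chi>. j = index (opp s) b ys d \<and> b <\<^sub>O a \<and> set ys \<subseteq> set xs \<union> set us \<and> has_index L (opp s) b ys d \<chi>"
  shows "\<exists>\<phi>. has_index L s a xs e \<phi>"
proof -
  have *: "\<exists>b ys d. j = index (opp s) b ys d \<and> b <\<^sub>O a \<and> set ys \<subseteq> set xs \<union> set us \<and> has_index L (opp s) b ys d (fm_of L j)"
    if "prod_encode (j, list_encode us) \<in> W e" for j us
    using assms(3)[OF that] fm_of_index by blast
  show ?thesis
  proof (cases s)
    case SideSigma
    then show ?thesis using * index_Sigma[OF assms(1,2), of e xs L "fm_of L"] by auto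
  next
    case SidePi
    then show ?thesis using * index_Pi[OF assms(1,2), of e xs L "fm_of L"] by auto
  qed
qed

text \<open>The right-hand side does not mention \<open>s\<close>: at the notation of zero the two
  sides coincide, so a quantifier-free formula can serve as a member on either side.\<close>

lemma has_index_one: "has_index L s 1 xs e \<phi> \<longleftrightarrow> (\<exists>\<theta>. qf_in L \<theta> \<and> qf_vars \<theta> \<subseteq> set xs \<and> e = qf_code \<theta> \<and> \<phi> = Fin \<theta>)"
  by (auto elim: has_index.cases intro: index_zero[simplified])

lemma trm_val_cong: "(\<And>x. x \<in> trm_vars t \<Longrightarrow> v x = w x) \<Longrightarrow> trm_val M v t = trm_val M w t"
proof (induction t)
  case (Fn f ts)
  then have "map (trm_val M v) ts = map (trm_val M w) ts" by (auto intro!: map_cong)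
  then show ?case by (simp only: trm_val.simps)
qed simp

lemma qf_sat_cong: "(\<And>x. x \<in> qf_vars \<theta> \<Longrightarrow> v x = w x) \<Longrightarrow> qf_sat M v \<theta> \<longleftrightarrow> qf_sat M w \<theta>"
proof (induction \<theta>)
  case (Eq s t) then show ?case using trm_val_cong[of s v w M] trm_val_cong[of t v w M] by auto
next
  case (Rel r ts)
  then have "map (trm_val M v) ts = map (trm_val M w) ts" by (auto intro!: map_cong trm_val_cong)
  then show ?case by (simp only: qf_sat.simps)
qed auto

lemma sat_cong:
  "has_index L s a xs e \<phi> \<Longrightarrow> (\<And>x. x \<in> set xs \<Longrightarrow> v x = w x) \<Longrightarrow> sat M \<phi> v \<longleftrightarrow> sat M \<phi> w"
proof (induction arbitrary: v w rule: has_index_induct)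
  case (zero \<theta> xs s)
  then show ?case using qf_sat_cong[of \<theta> v w M] by auto
next
  case (step s a xs e \<phi>)
  have *: "sat_side s M \<phi> v \<Longrightarrow> sat_side s M \<phi> w" if vw: "\<And>x. x \<in> set xs \<Longrightarrow> v x = w x" for v w
  proof -
    assume "sat_side s M \<phi> v"
    then obtain j us u where j: "prod_encode (j, list_encode us) \<in> W e"
      and u: "\<forall>x. x \<notin> set us \<longrightarrow> u x = v x" "sat_side s M (fm_of L j) u"
      unfolding step.hyps by blast
    define u' where "u' x = (if x \<in> set us then u x else w x)" for x
    from step.IH[OF j] obtain b ys d where ys: "set ys \<subseteq> set xs \<union> set us"
      and IH: "\<And>v w. (\<And>x. x \<in> set ys \<Longrightarrow> v x = w x) \<Longrightarrow> sat M (fm_of L j) v \<longleftrightarrow> sat M (fm_of L j) w" by blast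
    have "sat M (fm_of L j) u \<longleftrightarrow> sat M (fm_of L j) u'"
      using ys u(1) vw by (intro IH) (auto simp: u'_def)
    with u(2) have "sat_side s M (fm_of L j) u'" by (simp add: sat_side_def)
    moreover have "\<forall>x. x \<notin> set us \<longrightarrow> u' x = w x" by (simp add: u'_def)
    ultimately show "sat_side s M \<phi> w" unfolding step.hyps using j by blast
  qed
  have "sat_side s M \<phi> v \<longleftrightarrow> sat_side s M \<phi> w" using *[of v w] *[of w v] step.prems by auto
  then show ?case by (auto simp: sat_side_def)
qed

section \<open>Substitution and dualization of indices\<close>

fun trm_sub :: "(nat \<Rightarrow> nat) \<Rightarrow> trm \<Rightarrow> trm" where
  "trm_sub \<sigma> (Var i) = Var (\<sigma> i)"
| "trm_sub \<sigma> (Fn f ts) = Fn f (map (trm_sub \<sigma>) ts)"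

fun qf_sub :: "(nat \<Rightarrow> nat) \<Rightarrow> qf \<Rightarrow> qf" where
  "qf_sub \<sigma> Bot = Bot"
| "qf_sub \<sigma> (Eq s t) = Eq (trm_sub \<sigma> s) (trm_sub \<sigma> t)"
| "qf_sub \<sigma> (Rel r ts) = Rel r (map (trm_sub \<sigma>) ts)"
| "qf_sub \<sigma> (Neg \<theta>) = Neg (qf_sub \<sigma> \<theta>)"
| "qf_sub \<sigma> (And \<theta> \<eta>) = And (qf_sub \<sigma> \<theta>) (qf_sub \<sigma> \<eta>)"
| "qf_sub \<sigma> (Or \<theta> \<eta>) = Or (qf_sub \<sigma> \<theta>) (qf_sub \<sigma> \<eta>)"

lemma trm_val_sub: "trm_val M v (trm_sub \<sigma> t) = trm_val M (v \<circ> \<sigma>) t"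
proof (induction t)
  case (Fn f ts)
  have "map (trm_val M v \<circ> trm_sub \<sigma>) ts = map (trm_val M (v \<circ> \<sigma>)) ts"
    unfolding map_eq_conv comp_apply[of "trm_val M v"] using Fn.IH by blast
  then show ?case by (simp only: trm_val.simps trm_sub.simps map_map)
qed simp

lemma qf_sat_sub: "qf_sat M v (qf_sub \<sigma> \<theta>) \<longleftrightarrow> qf_sat M (v \<circ> \<sigma>) \<theta>"
  by (induction \<theta>) (simp_all add: trm_val_sub comp_def)

lemma trm_vars_sub: "trm_vars (trm_sub \<sigma> t) = \<sigma> ` trm_vars t"
  by (induction t) auto

lemma qf_vars_sub: "qf_vars (qf_sub \<sigma> \<theta>) = \<sigma> ` qf_vars \<theta>"
  by (induction \<theta>) (auto simp: trm_vars_sub)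

lemma trm_in_sub: "trm_in L (trm_sub \<sigma> t) \<longleftrightarrow> trm_in L t"
  by (induction t) auto

lemma qf_in_sub: "qf_in L (qf_sub \<sigma> \<theta>) \<longleftrightarrow> qf_in L \<theta>"
  by (induction \<theta>) (auto simp: trm_in_sub)

abbreviation jt :: "nat \<Rightarrow> nat \<Rightarrow> nat \<Rightarrow> nat" where
  "jt s c d \<equiv> prod_encode (0, prod_encode (s, prod_encode (c, d)))"
abbreviation jts :: "nat \<Rightarrow> nat \<Rightarrow> nat \<Rightarrow> nat" where
  "jts s c d \<equiv> prod_encode (1, prod_encode (s, prod_encode (c, d)))"
abbreviation jq :: "nat \<Rightarrow> nat \<Rightarrow> nat \<Rightarrow> nat" where
  "jq s c d \<equiv> prod_encode (2, prod_encode (s, prod_encode (c, d)))"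

text \<open>Substitution on codes, where \<open>s\<close> codes the map \<open>nthc s\<close> on
  variables. The graph is generated inductively, so it is c.e. by the fixed point lemma; on codes of
  terms and formulas the clauses leave exactly one result.\<close>

definition sub_step :: "nat set \<Rightarrow> nat \<Rightarrow> bool" where
  "sub_step S z \<longleftrightarrow>
    (\<exists>s i. z = jt s (prod_encode (0, i)) (prod_encode (0, nthc s i))) \<or>
    (\<exists>s f ts us. z = jt s (prod_encode (1, prod_encode (f, ts))) (prod_encode (1, prod_encode (f, us))) \<and>
       jts s ts us \<in> S) \<or>
    (\<exists>s. z = jts s 0 0) \<or>
    (\<exists>s t ts u us. z = jts s (consc t ts) (consc u us) \<and> jt s t u \<in> S \<and> jts s ts us \<in> S) \<or>
    (\<exists>s. z = jq s (prod_encode (0, 0)) (prod_encode (0, 0))) \<or>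
    (\<exists>s a b c d. z = jq s (prod_encode (1, prod_encode (a, b))) (prod_encode (1, prod_encode (c, d))) \<and>
       jt s a c \<in> S \<and> jt s b d \<in> S) \<or>
    (\<exists>s r ts us. z = jq s (prod_encode (2, prod_encode (r, ts))) (prod_encode (2, prod_encode (r, us))) \<and>
       jts s ts us \<in> S) \<or>
    (\<exists>s a c. z = jq s (prod_encode (3, a)) (prod_encode (3, c)) \<and> jq s a c \<in> S) \<or>
    (\<exists>s a b c d. z = jq s (prod_encode (4, prod_encode (a, b))) (prod_encode (4, prod_encode (c, d))) \<and>
       jq s a c \<in> S \<and> jq s b d \<in> S) \<or>
    (\<exists>s a b c d. z = jq s (prod_encode (5, prod_encode (a, b))) (prod_encode (5, prod_encode (c, d))) \<and>
       jq s a c \<in> S \<and> jq s b d \<in> S)"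

definition subs :: "nat set" where "subs = lfp (\<lambda>S. {z. sub_step S z})"

lemma finitary_sub_step: "finitary (\<lambda>S. sub_step S z)"
  unfolding sub_step_def by (intro finitary_intros)

lemma sigma1_subs [sigma1_intros]:
  assumes "computable f" shows "sigma1 (\<lambda>x. f x \<in> subs)"
proof -
  have "sigma1 (\<lambda>z. sub_step (seqset (p1 (p2 z)) (p2 (p2 z))) (p1 z))"
    unfolding sub_step_def by (intro sigma1_intros comp_intros)
  from sigma1_lfp[OF finitary_sub_step this] show ?thesis
    unfolding subs_def by (rule sigma1_comp[OF _ assms])
qed

lemma subs_iff: "z \<in> subs \<longleftrightarrow> sub_step subs z"
proof -
  have "mono (\<lambda>S. {z. sub_step S z})"
    by (intro monoI subsetI) (auto intro: finitary_mono[OF finitary_sub_step])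
  from lfp_unfold[OF this] show ?thesis unfolding subs_def by blast
qed

lemma jt_subs: "jt s (trm_code t) d \<in> subs \<longleftrightarrow> d = trm_code (trm_sub (nthc s) t)"
proof (induction t arbitrary: d)
  case (Var i) show ?case by (subst subs_iff) (simp add: sub_step_def)
next
  case (Fn f ts)
  have "jts s (list_encode (map trm_code ts)) d \<in> subs \<longleftrightarrow>
      d = list_encode (map trm_code (map (trm_sub (nthc s)) ts))" for d
    using Fn
  proof (induction ts arbitrary: d)
    case Nil show ?case by (subst subs_iff) (simp add: sub_step_def)
  next
    case (Cons t ts)
    then show ?case by (subst subs_iff) (simp add: sub_step_def)
  qed
  then show ?case by (subst subs_iff) (simp add: sub_step_def)
qed

lemma jts_subs: "jts s (list_encode (map trm_code ts)) d \<in> subs \<longleftrightarrow>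
    d = list_encode (map trm_code (map (trm_sub (nthc s)) ts))"
proof (induction ts arbitrary: d)
  case Nil show ?case by (subst subs_iff) (simp add: sub_step_def)
next
  case (Cons t ts)
  then show ?case by (subst subs_iff) (simp add: sub_step_def jt_subs)
qed

lemma jq_subs: "jq s (qf_code \<theta>) d \<in> subs \<longleftrightarrow> d = qf_code (qf_sub (nthc s) \<theta>)"
  by (induction \<theta> arbitrary: d; subst subs_iff) (simp_all add: sub_step_def jt_subs jts_subs[unfolded One_nat_def])

section \<open>Tuples of variables as coded lists\<close>

definition app_seg :: "nat \<Rightarrow> nat \<Rightarrow> nat \<Rightarrow> nat" where
  "app_seg b N k = rec_nat b (\<lambda>i y. consc (N + i) y) k"

text \<open>The reversal reflects that \<open>app_seg\<close> puts each later variable in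
  front.\<close>

definition segl :: "nat \<Rightarrow> nat \<Rightarrow> nat list" where "segl N k = rev [N..<N + k]"

lemma app_seg_list_encode: "app_seg (list_encode us) N k = list_encode (segl N k @ us)"
  by (induction k) (simp_all add: app_seg_def segl_def)

lemma app_seg_zero: "app_seg 0 N k = list_encode (segl N k)"
  using app_seg_list_encode[of "[]"] by simp

lemma set_segl [simp]: "set (segl N k) = {N..<N + k}"
  by (simp add: segl_def)

lemma computable_app_seg [comp_intros]:
  assumes "computable f" "computable g" "computable h" shows "computable (\<lambda>x. app_seg (f x) (g x) (h x))"
  unfolding app_seg_def by (intro comp_intros assms assms[THEN computable_comp1])

definition lset :: "nat \<Rightarrow> nat set" where "lset u = set (list_decode u)"

lemma lset_list_encode [simp]: "lset (list_encode us) = set us"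
  by (simp add: lset_def)

text \<open>Codes thereby serve as computable bounds: an index bounds the free variables recorded in
  it, and the code of a tuple bounds how many fresh variables its renaming takes.\<close>

lemma mem_less_list_encode: "x \<in> set us \<Longrightarrow> x < list_encode us"
proof (induction us)
  case (Cons y us)
  then show ?case using le_prod_encode_1[of y "list_encode us"] le_prod_encode_2[of "list_encode us" y] by auto
qed simp

lemma length_le_list_encode: "length us \<le> list_encode us"
proof (induction us)
  case (Cons y us)
  then show ?case using le_prod_encode_2[of "list_encode us" y] by simp
qed simp

lemma mem_lset_iff: "x \<in> lset u \<longleftrightarrow> (\<exists>i. dropc u i \<noteq> 0 \<and> nthc u i = x)"
proof -
  obtain us where "u = list_encode us" using list_encode_ex by blast
  then show ?thesis by (auto simp: in_set_conv_nth not_le)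
qed

text \<open>The length of a list is at most its code, so \<open>u\<close> bounds all positions. The
  quantifier being bounded, non-membership is c.e. as well.\<close>

lemma not_mem_lset_iff: "x \<notin> lset u \<longleftrightarrow> (\<forall>i<u. dropc u i = 0 \<or> nthc u i \<noteq> x)"
proof -
  obtain us where us: "u = list_encode us" using list_encode_ex by blast
  show ?thesis
  proof
    assume "\<forall>i<u. dropc u i = 0 \<or> nthc u i \<noteq> x"
    moreover have "i < u \<and> dropc u i \<noteq> 0 \<and> nthc u i = us ! i" if "i < length us" for i
      using that length_le_list_encode[of us] us by simp
    ultimately have "us ! i \<noteq> x" if "i < length us" for i using that by blast
    then show "x \<notin> lset u" using us by (auto simp: in_set_conv_nth)
  qed (auto simp: mem_lset_iff)
qed

lemma sigma1_lset [sigma1_intros]: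
  assumes "computable f" "computable g"
  shows "sigma1 (\<lambda>x. f x \<in> lset (g x))" "sigma1 (\<lambda>x. f x \<notin> lset (g x))"
  unfolding not_mem_lset_iff unfolding mem_lset_iff
  by (intro sigma1_intros comp_intros assms assms[THEN computable_comp1])+

text \<open>The substitution \<open>nthc s'\<close> renames the quantified variables \<open>x \<in> lset u\<close> to the fresh ones \<open>N + x\<close>
  and is \<open>nthc s\<close> elsewhere; only the arguments below \<open>k\<close> matter.\<close>

definition sub_upd :: "nat \<Rightarrow> nat \<Rightarrow> nat \<Rightarrow> nat \<Rightarrow> nat \<Rightarrow> bool" where
  "sub_upd k s u N s' \<longleftrightarrow> (\<forall>x<k. (x \<in> lset u \<and> nthc s' x = N + x) \<or> (x \<notin> lset u \<and> nthc s' x = nthc s x))"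

lemma sub_upd_ex: "\<exists>s'. sub_upd k s u N s'"
  by (rule exI[of _ "list_encode (map (\<lambda>x. if x \<in> lset u then N + x else nthc s x) [0..<k])"])
    (auto simp: sub_upd_def)

text \<open>The third component of an index of the dual, under the substitution \<open>nthc s\<close> into variables below
  \<open>N\<close>, of the formula with index component \<open>e\<close> at level \<open>b\<close>; \<open>c\<close> is the fixed point to be
  supplied by the recursion theorem.\<close>

definition dual_code :: "nat \<Rightarrow> nat \<Rightarrow> nat \<Rightarrow> nat \<Rightarrow> nat \<Rightarrow> nat \<Rightarrow> bool" where
  "dual_code c b e N s e' \<longleftrightarrow>
    (b = 1 \<and> (\<exists>g. jq s e g \<in> subs \<and> e' = prod_encode (3, g))) \<or>
    (b \<noteq> 1 \<and> e' = self c (prod_encode (e, prod_encode (N, s))))"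

text \<open>A member \<open>k\<close> with tuple \<open>u\<close> becomes one of the other side,
  hence \<open>1 - i\<close>, at the same notation. Its prefix is the whole block from
  \<open>N\<close> to \<open>N + u\<close>, which contains the copy \<open>N + x\<close> of every
  \<open>x\<close> in the tuple; the remaining quantifiers are vacuous.\<close>

definition dual_member :: "nat \<Rightarrow> nat \<Rightarrow> nat \<Rightarrow> nat \<Rightarrow> nat \<Rightarrow> bool" where
  "dual_member c e N s x \<longleftrightarrow> (\<exists>k u i b y d s' e'. prod_encode (k, u) \<in> W e \<and>
    k = prod_encode (i, prod_encode (b, prod_encode (y, d))) \<and> sub_upd k s u N s' \<and>
    dual_code c b d (N + Suc u) s' e' \<and>
    x = prod_encode (prod_encode (1 - i, prod_encode (b, prod_encode (app_seg 0 0 (N + Suc u), e'))), app_seg 0 N (Suc u)))"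

lemma sigma1_dual_member:
  "sigma1 (\<lambda>z. dual_member (p1 (p1 z)) (p1 (p2 (p1 z))) (p1 (p2 (p2 (p1 z)))) (p2 (p2 (p2 (p1 z)))) (p2 z))"
  unfolding dual_member_def dual_code_def sub_upd_def by (intro sigma1_intros comp_intros)

lemma dual_fixpoint:
  obtains c where "\<And>e N s. W (self c (prod_encode (e, prod_encode (N, s)))) = {x. dual_member c e N s x}"
proof -
  obtain c where "\<forall>n. W (self c n) = {x. dual_member c (p1 n) (p1 (p2 n)) (p2 (p2 n)) x}"
    using recursion_theorem[OF sigma1_dual_member] by blast
  then show thesis by (intro that[of c]) simp
qed

lemma list_encode_le_index: "list_encode ys \<le> index s b ys d"
  unfolding index_def
  using le_prod_encode_1[of "list_encode ys" d] le_prod_encode_2[of "prod_encode (list_encode ys, d)" b]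
    le_prod_encode_2[of "prod_encode (b, prod_encode (list_encode ys, d))" "side_code s"] by linarith

text \<open>Existence and correctness are separate claims because the c.e. set collects every
  \<open>e'\<close> related to a member: each must be a valid index, and every member must have one.
  \<open>N\<close> and \<open>t\<close> vary in the induction, since a quantifier block raises the
  bound and updates the substitution.\<close>

lemma dualize_aux:
  assumes c: "\<And>e N s. W (self c (prod_encode (e, prod_encode (N, s)))) = {x. dual_member c e N s x}"
    and "has_index L s a xs e \<phi>"
  shows "(\<exists>e'. dual_code c a e N t e') \<and>
    (\<forall>e'. dual_code c a e N t e' \<longrightarrow> (\<forall>x\<in>set xs. nthc t x < N) \<longrightarrow>
      (\<exists>\<phi>'. has_index L (opp s) a (segl 0 N) e' \<phi>' \<and> (\<forall>M v. sat M \<phi>' v \<longleftrightarrow> \<not> sat M \<phi> (v \<circ> nthc t))))"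
  using assms(2)
proof (induction arbitrary: N t rule: has_index_induct)
  case (zero \<theta> xs s)
  show ?case
  proof (intro conjI allI impI)
    show "\<exists>e'. dual_code c 1 (qf_code \<theta>) N t e'" by (simp add: dual_code_def jq_subs)
    fix e' assume "dual_code c 1 (qf_code \<theta>) N t e'" and t: "\<forall>x\<in>set xs. nthc t x < N"
    then have "e' = qf_code (Neg (qf_sub (nthc t) \<theta>))" by (simp add: dual_code_def jq_subs)
    moreover have "has_index L (opp s) 1 (segl 0 N) (qf_code (Neg (qf_sub (nthc t) \<theta>))) (Fin (Neg (qf_sub (nthc t) \<theta>)))"
      using zero t by (intro has_index.index_zero) (auto simp: qf_in_sub qf_vars_sub)
    ultimately show "\<exists>\<phi>'. has_index L (opp s) 1 (segl 0 N) e' \<phi>' \<and>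
        (\<forall>M v. sat M \<phi>' v \<longleftrightarrow> \<not> sat M (Fin \<theta>) (v \<circ> nthc t))"
      by (intro exI[of _ "Fin (Neg (qf_sub (nthc t) \<theta>))"]) (simp add: qf_sat_sub)
  qed
next
  case (step s a xs e \<phi>)
  show ?case
  proof (intro conjI allI impI)
    show "\<exists>e'. dual_code c a e N t e'" using step.hyps by (simp add: dual_code_def)
    fix e' assume "dual_code c a e N t e'" and t: "\<forall>x\<in>set xs. nthc t x < N"
    with step.hyps have W: "W e' = {x. dual_member c e N t x}" by (simp add: dual_code_def c)
    have child: "\<exists>\<chi>. has_index L s b (segl 0 (N + Suc (list_encode us))) e'' \<chi> \<and>
        (\<forall>M v. sat M \<chi> v \<longleftrightarrow> \<not> sat M (fm_of L k) (v \<circ> nthc t')) \<and>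
        set ys \<subseteq> set xs \<union> set us \<and>
        (\<forall>x\<in>set ys. nthc t' x = (if x \<in> set us then N + x else nthc t x)) \<and>
        has_index L (opp s) b ys d (fm_of L k)"
      if k: "prod_encode (k, list_encode us) \<in> W e" "k = index (opp s) b ys d"
        and t': "sub_upd k t (list_encode us) N t'" "dual_code c b d (N + Suc (list_encode us)) t' e''"
      for k us b ys d t' e''
    proof -
      from step.IH[OF k(1)] obtain b' ys' d' where *: "k = index (opp s) b' ys' d'" "b' <\<^sub>O a"
        "set ys' \<subseteq> set xs \<union> set us" "has_index L (opp s) b' ys' d' (fm_of L k)"
        "\<And>N t. \<forall>e'. dual_code c b' d' N t e' \<longrightarrow> (\<forall>x\<in>set ys'. nthc t x < N) \<longrightarrow>
          (\<exists>\<phi>'. has_index L (opp (opp s)) b' (segl 0 N) e' \<phi>' \<and>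
            (\<forall>M v. sat M \<phi>' v \<longleftrightarrow> \<not> sat M (fm_of L k) (v \<circ> nthc t)))" by blast
      moreover have "b' = b" "ys' = ys" "d' = d" using *(1) k(2) by simp_all
      ultimately have IH: "b <\<^sub>O a" "set ys \<subseteq> set xs \<union> set us" "has_index L (opp s) b ys d (fm_of L k)"
        "(\<forall>e'. dual_code c b d N t e' \<longrightarrow> (\<forall>x\<in>set ys. nthc t x < N) \<longrightarrow>
          (\<exists>\<phi>'. has_index L (opp (opp s)) b (segl 0 N) e' \<phi>' \<and>
            (\<forall>M v. sat M \<phi>' v \<longleftrightarrow> \<not> sat M (fm_of L k) (v \<circ> nthc t))))" for N t
        by simp_all
      have upd: "nthc t' x = (if x \<in> set us then N + x else nthc t x)" if "x \<in> set ys" for x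
      proof -
        have "x < k" using mem_less_list_encode[OF that] list_encode_le_index[of ys "opp s" b d] k(2) by linarith
        with t'(1) show ?thesis by (auto simp: sub_upd_def)
      qed
      have "nthc t' x < N + Suc (list_encode us)" if "x \<in> set ys" for x
      proof (cases "x \<in> set us")
        case True then show ?thesis using upd[OF that] mem_less_list_encode[OF True] by simp
      next
        case False
        with that IH(2) t have "nthc t x < N" by auto
        then show ?thesis using upd[OF that] False by simp
      qed
      with IH(4)[rule_format, OF t'(2)] IH(2,3) upd show ?thesis by auto
    qed
    have mem: "\<exists>k us b ys d t' e''. prod_encode (k, list_encode us) \<in> W e \<and> k = index (opp s) b ys d \<and> b <\<^sub>O a \<and>
        sub_upd k t (list_encode us) N t' \<and> dual_code c b d (N + Suc (list_encode us)) t' e'' \<and>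
        j = index s b (segl 0 (N + Suc (list_encode us))) e'' \<and> ws = segl N (Suc (list_encode us))"
      if "prod_encode (j, list_encode ws) \<in> W e'" for j ws
    proof -
      from that[unfolded W] obtain k u i b y d s' e'' where
        *: "prod_encode (k, u) \<in> W e" "k = prod_encode (i, prod_encode (b, prod_encode (y, d)))"
        "sub_upd k t u N s'" "dual_code c b d (N + Suc u) s' e''"
        "j = prod_encode (1 - i, prod_encode (b, prod_encode (app_seg 0 0 (N + Suc u), e'')))"
        "list_encode ws = app_seg 0 N (Suc u)"
        unfolding dual_member_def by (simp del: One_nat_def) blast
      obtain us where us: "u = list_encode us" using list_encode_ex by blast
      from step.IH[OF *(1)[unfolded us]] obtain b' ys d' where k: "k = index (opp s) b' ys d'" "b' <\<^sub>O a" by blast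
      with *(2) have "i = side_code (opp s)" "b = b'" "y = list_encode ys" "d = d'" by (auto simp: index_def)
      moreover have "1 - side_code (opp s) = side_code s" using side_code_opp[of "opp s"] by simp
      ultimately show ?thesis using * us k
        by (intro exI[of _ k] exI[of _ us] exI[of _ b] exI[of _ ys] exI[of _ d] exI[of _ s'] exI[of _ e''])
          (simp add: app_seg_zero index_def)
    qed
    have "\<exists>\<phi>'. has_index L (opp s) a (segl 0 N) e' \<phi>'"
    proof (rule has_index_ex[OF step.hyps(2,3)])
      fix j ws assume "prod_encode (j, list_encode ws) \<in> W e'"
      from mem[OF this] obtain k us b ys d t' e'' where
        *: "prod_encode (k, list_encode us) \<in> W e" "k = index (opp s) b ys d" "b <\<^sub>O a"
        "sub_upd k t (list_encode us) N t'" "dual_code c b d (N + Suc (list_encode us)) t' e''"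
        "j = index s b (segl 0 (N + Suc (list_encode us))) e''" "ws = segl N (Suc (list_encode us))" by blast
      from child[OF *(1,2,4,5)] obtain \<chi> where "has_index L s b (segl 0 (N + Suc (list_encode us))) e'' \<chi>" by blast
      with * show "\<exists>b ys d \<chi>. j = index (opp (opp s)) b ys d \<and> b <\<^sub>O a \<and>
          set ys \<subseteq> set (segl 0 N) \<union> set ws \<and> has_index L (opp (opp s)) b ys d \<chi>"
        by fastforce
    qed
    then obtain \<phi>' where \<phi>': "has_index L (opp s) a (segl 0 N) e' \<phi>'" ..
    have "sat_side (opp s) M \<phi>' v \<longleftrightarrow> sat_side s M \<phi> (v \<circ> nthc t)" for M v
    proof
      assume "sat_side (opp s) M \<phi>' v"
      then obtain j ws u' where j: "prod_encode (j, list_encode ws) \<in> W e'"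
        and u': "\<forall>x. x \<notin> set ws \<longrightarrow> u' x = v x" "sat_side (opp s) M (fm_of L j) u'"
        unfolding sat_side_iff[OF \<phi>' step.hyps(3)] by blast
      from mem[OF j] obtain k us b ys d t' e'' where
        *: "prod_encode (k, list_encode us) \<in> W e" "k = index (opp s) b ys d" "b <\<^sub>O a"
        "sub_upd k t (list_encode us) N t'" "dual_code c b d (N + Suc (list_encode us)) t' e''"
        "j = index s b (segl 0 (N + Suc (list_encode us))) e''" "ws = segl N (Suc (list_encode us))" by blast
      from child[OF *(1,2,4,5)] obtain \<chi> where \<chi>: "has_index L s b (segl 0 (N + Suc (list_encode us))) e'' \<chi>"
        "\<And>M v. sat M \<chi> v \<longleftrightarrow> \<not> sat M (fm_of L k) (v \<circ> nthc t')" "set ys \<subseteq> set xs \<union> set us"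
        "\<And>x. x \<in> set ys \<Longrightarrow> nthc t' x = (if x \<in> set us then N + x else nthc t x)"
        "has_index L (opp s) b ys d (fm_of L k)" by blast
      have "fm_of L j = \<chi>" using fm_of_index[OF \<chi>(1)] *(6) by simp
      with u'(2) \<chi>(2) have "sat_side s M (fm_of L k) (u' \<circ> nthc t')" by (cases s) (auto simp: sat_side_simps)
      \<comment> \<open>A variable in \<open>us\<close> takes the value of its fresh copy. Elsewhere
        \<open>nthc t x < N\<close> lies outside the quantified block, so the value is the old
        one.\<close>
      moreover define u where "u x = (if x \<in> set us then u' (N + x) else (v \<circ> nthc t) x)" for x
      have "sat M (fm_of L k) (u' \<circ> nthc t') \<longleftrightarrow> sat M (fm_of L k) u"
      proof (rule sat_cong[OF \<chi>(5)])
        fix x assume x: "x \<in> set ys"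
        show "(u' \<circ> nthc t') x = u x"
        proof (cases "x \<in> set us")
          case True then show ?thesis using \<chi>(4)[OF x] by (simp add: u_def)
        next
          case False
          then have "nthc t x < N" using x \<chi>(3) t by auto
          then have "u' (nthc t x) = v (nthc t x)" using u'(1) *(7) by simp
          then show ?thesis using \<chi>(4)[OF x] False by (simp add: u_def)
        qed
      qed
      ultimately have "sat_side s M (fm_of L k) u" by (simp add: sat_side_def)
      then show "sat_side s M \<phi> (v \<circ> nthc t)"
        unfolding step.hyps(4) using *(1) by (intro exI[of _ k] exI[of _ us] exI[of _ u]) (auto simp: u_def)
    next
      assume "sat_side s M \<phi> (v \<circ> nthc t)"
      then obtain k us u where k: "prod_encode (k, list_encode us) \<in> W e"
        and u: "\<forall>x. x \<notin> set us \<longrightarrow> u x = (v \<circ> nthc t) x" "sat_side s M (fm_of L k) u"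
        unfolding step.hyps(4) by blast
      obtain b ys d where k': "k = index (opp s) b ys d" "\<And>N t. \<exists>e'. dual_code c b d N t e'"
        using step.IH[OF k] by blast
      obtain t' where t': "sub_upd k t (list_encode us) N t'" using sub_upd_ex by blast
      obtain e'' where e'': "dual_code c b d (N + Suc (list_encode us)) t' e''" using k'(2) by blast
      from child[OF k k'(1) t' e''] obtain \<chi> where \<chi>: "has_index L s b (segl 0 (N + Suc (list_encode us))) e'' \<chi>"
        "\<And>M v. sat M \<chi> v \<longleftrightarrow> \<not> sat M (fm_of L k) (v \<circ> nthc t')" "set ys \<subseteq> set xs \<union> set us"
        "\<And>x. x \<in> set ys \<Longrightarrow> nthc t' x = (if x \<in> set us then N + x else nthc t x)"
        "has_index L (opp s) b ys d (fm_of L k)" by blast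
      define j where "j = index s b (segl 0 (N + Suc (list_encode us))) e''"
      have "1 - side_code (opp s) = side_code s" using side_code_opp[of "opp s"] by simp
      then have "dual_member c e N t (prod_encode (j, list_encode (segl N (Suc (list_encode us)))))"
        unfolding dual_member_def j_def index_def app_seg_zero[symmetric]
        using k t' e'' k'(1) unfolding index_def by (metis (no_types))
      then have j: "prod_encode (j, list_encode (segl N (Suc (list_encode us)))) \<in> W e'" by (simp add: W)
      \<comment> \<open>The converse transfer: the block variable \<open>N + x\<close> receives the
        value of \<open>x\<close>.\<close>
      define u' where "u' y = (if y \<in> set (segl N (Suc (list_encode us))) then u (y - N) else v y)" for y
      have "sat M (fm_of L k) (u' \<circ> nthc t') \<longleftrightarrow> sat M (fm_of L k) u"
      proof (rule sat_cong[OF \<chi>(5)])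
        fix x assume x: "x \<in> set ys"
        show "(u' \<circ> nthc t') x = u x"
        proof (cases "x \<in> set us")
          case True then show ?thesis using \<chi>(4)[OF x] mem_less_list_encode[OF True] by (simp add: u'_def)
        next
          case False
          then have "nthc t x < N" using x \<chi>(3) t by auto
          then show ?thesis using \<chi>(4)[OF x] False u(1) by (simp add: u'_def)
        qed
      qed
      with u(2) \<chi>(2) have "sat_side (opp s) M \<chi> u'" by (cases s) (auto simp: sat_side_simps)
      moreover have "fm_of L j = \<chi>" using fm_of_index[OF \<chi>(1)] by (simp add: j_def)
      ultimately show "sat_side (opp s) M \<phi>' v"
        unfolding sat_side_iff[OF \<phi>' step.hyps(3)] using j
        by (intro exI[of _ j] exI[of _ "segl N (Suc (list_encode us))"] exI[of _ u']) (auto simp: u'_def)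
    qed
    then have "\<forall>M v. sat M \<phi>' v \<longleftrightarrow> \<not> sat M \<phi> (v \<circ> nthc t)"
      by (cases s) (auto simp: sat_side_simps)
    with \<phi>' show "\<exists>\<phi>'. has_index L (opp s) a (segl 0 N) e' \<phi>' \<and> (\<forall>M v. sat M \<phi>' v \<longleftrightarrow> \<not> sat M \<phi> (v \<circ> nthc t))"
      by blast
  qed
qed

text \<open>Freshness allows a formula in the variables below \<open>N\<close> to be moved under the quantifiers of the
  members of \<open>W e\<close>.\<close>

definition fresh_members :: "nat \<Rightarrow> nat \<Rightarrow> bool" where
  "fresh_members N e \<longleftrightarrow> (\<forall>j us. prod_encode (j, list_encode us) \<in> W e \<longrightarrow> set us \<inter> {..<N} = {})"

lemma dual_index:
  assumes "has_index L s a xs e \<phi>" "\<And>x. x \<in> set xs \<Longrightarrow> \<sigma> x < N"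
  shows "\<exists>e' \<phi>'. has_index L (opp s) a (segl 0 N) e' \<phi>' \<and> (\<forall>M v. sat M \<phi>' v \<longleftrightarrow> \<not> sat M \<phi> (v \<circ> \<sigma>)) \<and>
    (a \<noteq> 1 \<longrightarrow> fresh_members N e')"
proof -
  obtain c where c: "\<And>e N s. W (self c (prod_encode (e, prod_encode (N, s)))) = {x. dual_member c e N s x}"
    by (rule dual_fixpoint) blast
  \<comment> \<open>Only finitely many values of \<sigma> matter, so a list codes them; its length
    \<open>list_encode xs\<close> exceeds every variable in \<open>xs\<close>.\<close>
  define t where "t = list_encode (map \<sigma> [0..<list_encode xs])"
  have t: "nthc t x = \<sigma> x" if "x \<in> set xs" for x
    using mem_less_list_encode[OF that] by (simp add: t_def)
  from dualize_aux[OF c assms(1), of N t] obtain e' \<phi>' where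
    *: "dual_code c a e N t e'" "has_index L (opp s) a (segl 0 N) e' \<phi>'"
    "\<And>M v. sat M \<phi>' v \<longleftrightarrow> \<not> sat M \<phi> (v \<circ> nthc t)" using t assms(2) by auto
  have "sat M \<phi> (v \<circ> nthc t) \<longleftrightarrow> sat M \<phi> (v \<circ> \<sigma>)" for M v
    using t by (intro sat_cong[OF assms(1)]) simp
  moreover have "fresh_members N e'" if "a \<noteq> 1"
    unfolding fresh_members_def
  proof (intro allI impI)
    fix j us assume "prod_encode (j, list_encode us) \<in> W e'"
    then have "dual_member c e N t (prod_encode (j, list_encode us))"
      using *(1) that by (simp add: dual_code_def c)
    then obtain u where "list_encode us = app_seg 0 N (Suc u)" unfolding dual_member_def by auto
    then have "us = segl N (Suc u)" by (simp only: app_seg_zero list_encode_simps)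
    then show "set us \<inter> {..<N} = {}" by auto
  qed
  ultimately show ?thesis using * by auto
qed

text \<open>Renaming is obtained by dualizing twice, once along \<sigma> and once along the
  identity; freshness comes from the second pass.\<close>

lemma subst_index:
  assumes "has_index L s a xs e \<phi>" "\<And>x. x \<in> set xs \<Longrightarrow> \<sigma> x < N"
  shows "\<exists>e' \<phi>'. has_index L s a (segl 0 N) e' \<phi>' \<and> (\<forall>M v. sat M \<phi>' v \<longleftrightarrow> sat M \<phi> (v \<circ> \<sigma>)) \<and>
    (a \<noteq> 1 \<longrightarrow> fresh_members N e')"
proof -
  from dual_index[where \<sigma>=\<sigma>, OF assms] obtain e1 \<phi>1 where 1: "has_index L (opp s) a (segl 0 N) e1 \<phi>1"
    "\<And>M v. sat M \<phi>1 v \<longleftrightarrow> \<not> sat M \<phi> (v \<circ> \<sigma>)" by auto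
  have "\<exists>e' \<phi>'. has_index L (opp (opp s)) a (segl 0 N) e' \<phi>' \<and> (\<forall>M v. sat M \<phi>' v \<longleftrightarrow> \<not> sat M \<phi>1 (v \<circ> (\<lambda>x. x))) \<and>
    (a \<noteq> 1 \<longrightarrow> fresh_members N e')"
    by (rule dual_index[OF 1(1)]) simp
  with 1(2) show ?thesis by (simp add: comp_def)
qed

section \<open>Conjunctions and existential closures of indices\<close>

lemma leO_one: "leO b 1 \<Longrightarrow> b = 1"
  using leO_iff[OF O_zero] not_less_one by blast

lemma one_leO: "kleene_O b \<Longrightarrow> leO 1 b"
  using leO_iff one_less by blast

text \<open>The members, seen from a level above \<open>b\<close> and on the side with code \<open>i\<close>, of a formula of level \<open>b\<close>:
  a formula of level \<open>1\<close> becomes its own only member.\<close>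

definition lifted_member :: "nat \<Rightarrow> nat \<Rightarrow> nat \<Rightarrow> nat \<Rightarrow> nat \<Rightarrow> bool" where
  "lifted_member i b y e x \<longleftrightarrow>
    (b = 1 \<and> x = prod_encode (prod_encode (1 - i, prod_encode (1, prod_encode (y, e))), 0)) \<or> (b \<noteq> 1 \<and> x \<in> W e)"

lemma lifted_member_valid:
  assumes "has_index L s b xs e \<phi>" "lifted_member (side_code s) b (list_encode xs) e (prod_encode (j, list_encode us))"
    "leO b c" "kleene_O c" "c \<noteq> 1"
  shows "\<exists>b ys d \<chi>. j = index (opp s) b ys d \<and> b <\<^sub>O c \<and> set ys \<subseteq> set xs \<union> set us \<and> has_index L (opp s) b ys d \<chi>"
proof (cases "b = 1")
  case True
  with assms(2) have "j = index (opp s) 1 xs e" "us = []"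
    by (simp_all add: lifted_member_def index_def side_code_opp)
  moreover have "has_index L (opp s) 1 xs e \<phi>" using assms(1) unfolding True has_index_one .
  ultimately show ?thesis using one_less[OF assms(4,5)] by auto
next
  case False
  with assms(2) have "prod_encode (j, list_encode us) \<in> W e" by (simp add: lifted_member_def)
  from has_index_memberD[OF assms(1) False this] show ?thesis using less_le_O[OF _ assms(3,4)] by blast
qed

lemma lifted_member_sat:
  assumes "has_index L s b xs e \<phi>"
  shows "sat_side s M \<phi> v \<longleftrightarrow>
    (\<exists>j us u. lifted_member (side_code s) b (list_encode xs) e (prod_encode (j, list_encode us)) \<and>
      (\<forall>x. x \<notin> set us \<longrightarrow> u x = v x) \<and> sat_side s M (fm_of L j) u)"
proof (cases "b = 1")
  case True
  have "lifted_member (side_code s) b (list_encode xs) e (prod_encode (j, list_encode us)) \<longleftrightarrow>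
      j = index (opp s) 1 xs e \<and> us = []" for j us
    using True by (simp add: lifted_member_def index_def side_code_opp)
  moreover have "has_index L (opp s) 1 xs e \<phi>" using assms unfolding True has_index_one .
  moreover have "(\<forall>x. u x = v x) \<longleftrightarrow> u = v" for u by auto
  ultimately show ?thesis using fm_of_index by auto
next
  case False
  then have "lifted_member (side_code s) b (list_encode xs) e x \<longleftrightarrow> x \<in> W e" for x
    by (simp add: lifted_member_def)
  then show ?thesis using sat_side_iff[OF assms False] by simp
qed

text \<open>Cumulativity of the hierarchy. Above level zero the set of members is kept; a
  quantifier-free formula becomes its own only member with an empty prefix, which is trivially
  fresh.\<close>

lemma lift_index:
  assumes "has_index L s b xs e \<phi>" "leO b c" "kleene_O c" "c \<noteq> 1" "b \<noteq> 1 \<longrightarrow> fresh_members N e"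
  shows "\<exists>e' \<phi>'. has_index L s c xs e' \<phi>' \<and> (\<forall>M v. sat M \<phi>' v \<longleftrightarrow> sat M \<phi> v) \<and> fresh_members N e'"
proof -
  have "sigma1 (lifted_member (side_code s) b (list_encode xs) e)"
    unfolding lifted_member_def by (intro sigma1_intros comp_intros)
  then obtain e' where e': "W e' = {x. lifted_member (side_code s) b (list_encode xs) e x}" using sigma1_W by blast
  obtain \<phi>' where \<phi>': "has_index L s c xs e' \<phi>'"
    using has_index_ex[OF assms(3,4), of e' s xs L] lifted_member_valid[OF assms(1) _ assms(2-4)] e' by blast
  have "sat_side s M \<phi>' v \<longleftrightarrow> sat_side s M \<phi> v" for M v
    using sat_side_iff[OF \<phi>' assms(4)] lifted_member_sat[OF assms(1)] e' by simp
  moreover have "fresh_members N e'"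
    using assms(5) unfolding fresh_members_def e' lifted_member_def by auto
  ultimately show ?thesis using \<phi>' by (auto simp: sat_side_def)
qed

text \<open>The third component of an index at level \<open>c\<close> of the conjunction of two \<open>\<Pi>\<close> formulas.\<close>

definition conj_member :: "nat \<Rightarrow> nat \<Rightarrow> bool" where
  "conj_member n x \<longleftrightarrow> lifted_member 1 (p1 (p1 n)) (p1 (p2 (p1 n))) (p2 (p2 (p1 n))) x \<or>
    lifted_member 1 (p1 (p2 n)) (p1 (p2 (p2 n))) (p2 (p2 (p2 n))) x"

text \<open>One computable choice of index for the union, fixed so that \<open>conj_code\<close> can
  occur inside another c.e. definition.\<close>

definition conj_union :: "nat \<Rightarrow> nat" where
  "conj_union = (SOME u. computable u \<and> (\<forall>n. W (u n) = {x. conj_member n x}))"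

lemma computable_conj_union: "computable conj_union" and W_conj_union: "W (conj_union n) = {x. conj_member n x}"
proof -
  have "sigma1 (\<lambda>z. conj_member (p1 z) (p2 z))"
    unfolding conj_member_def lifted_member_def by (intro sigma1_intros comp_intros)
  from someI_ex[OF uniform_index[OF this]]
  show "computable conj_union" "W (conj_union n) = {x. conj_member n x}"
    unfolding conj_union_def[symmetric] by blast+
qed

definition conj_code :: "nat \<Rightarrow> nat \<Rightarrow> nat \<Rightarrow> nat \<Rightarrow> nat \<Rightarrow> nat \<Rightarrow> nat \<Rightarrow> nat \<Rightarrow> bool" where
  "conj_code c b y e b' y' e' d \<longleftrightarrow>
    (c = 1 \<and> d = prod_encode (4, prod_encode (e, e'))) \<or>
    (c \<noteq> 1 \<and> d = conj_union (prod_encode (prod_encode (b, prod_encode (y, e)), prod_encode (b', prod_encode (y', e')))))"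

lemma conj_code_ex: "\<exists>d. conj_code c b y e b' y' e' d"
  unfolding conj_code_def by blast

lemma conj_code_index:
  assumes P: "has_index L SidePi b ys e P" "leO b c" and P': "has_index L SidePi b' ys' e' P'" "leO b' c"
    and "kleene_O c" and xs: "set ys \<subseteq> set xs" "set ys' \<subseteq> set xs"
    and d: "conj_code c b (list_encode ys) e b' (list_encode ys') e' d"
  shows "\<exists>Q. has_index L SidePi c xs d Q \<and> (\<forall>M v. sat M Q v \<longleftrightarrow> sat M P v \<and> sat M P' v)"
proof (cases "c = 1")
  case True
  then have "b = 1" "b' = 1" using assms leO_one by auto
  with P P' obtain \<theta> \<theta>' where "qf_in L \<theta>" "qf_vars \<theta> \<subseteq> set ys" "e = qf_code \<theta>" "P = Fin \<theta>"
    "qf_in L \<theta>'" "qf_vars \<theta>' \<subseteq> set ys'" "e' = qf_code \<theta>'" "P' = Fin \<theta>'"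
    by (auto simp: has_index_one simp del: One_nat_def)
  then show ?thesis using True d xs
    by (intro exI[of _ "Fin (And \<theta> \<theta>')"]) (auto simp: conj_code_def has_index_one simp del: One_nat_def intro!: exI[of _ "And \<theta> \<theta>'"])
next
  case False
  with d have W: "W d = {x. lifted_member 1 b (list_encode ys) e x \<or> lifted_member 1 b' (list_encode ys') e' x}"
    by (simp add: conj_code_def W_conj_union conj_member_def)
  have "\<exists>Q. has_index L SidePi c xs d Q"
  proof (rule has_index_ex[OF assms(5) False])
    fix j us assume "prod_encode (j, list_encode us) \<in> W d"
    then consider "lifted_member (side_code SidePi) b (list_encode ys) e (prod_encode (j, list_encode us))"
      | "lifted_member (side_code SidePi) b' (list_encode ys') e' (prod_encode (j, list_encode us))"
      unfolding W by auto
    then show "\<exists>b ys d \<chi>. j = index (opp SidePi) b ys d \<and> b <\<^sub>O c \<and> set ys \<subseteq> set xs \<union> set us \<and> has_index L (opp SidePi) b ys d \<chi>"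
    proof cases
      case 1
      from lifted_member_valid[OF P(1) this P(2) assms(5) False] show ?thesis using xs by blast
    next
      case 2
      from lifted_member_valid[OF P'(1) this P'(2) assms(5) False] show ?thesis using xs by blast
    qed
  qed
  then obtain Q where Q: "has_index L SidePi c xs d Q" ..
  have "sat_side SidePi M Q v \<longleftrightarrow> sat_side SidePi M P v \<or> sat_side SidePi M P' v" for M v
    unfolding sat_side_iff[OF Q False] lifted_member_sat[OF P(1)] lifted_member_sat[OF P'(1)] W
    by (simp add: side_code.simps) blast
  with Q show ?thesis by (auto simp: sat_side_simps)
qed

lemma conj_index:
  assumes "has_index L SidePi b ys e P" "leO b c" "has_index L SidePi b' ys' e' P'" "leO b' c" "kleene_O c"
  shows "\<exists>d Q. has_index L SidePi c (ys @ ys') d Q \<and> (\<forall>M v. sat M Q v \<longleftrightarrow> sat M P v \<and> sat M P' v)"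
proof -
  obtain d where d: "conj_code c b (list_encode ys) e b' (list_encode ys') e' d" using conj_code_ex by blast
  show ?thesis using conj_code_index[OF assms(1-5) _ _ d, of "ys @ ys'"] by auto
qed

section \<open>Existential closures as \<Sigma> sentences\<close>

lemma ex_index:
  assumes "has_index L SidePi b ys e P" "b <\<^sub>O \<beta>"
  shows "\<exists>e' \<Theta>. has_index L SideSigma \<beta> [] e' \<Theta> \<and> (\<forall>M v. sat M \<Theta> v \<longleftrightarrow> (\<exists>u. sat M P u))"
proof -
  have "sigma1 (\<lambda>x. x = prod_encode (index SidePi b ys e, list_encode ys))"
    by (intro sigma1_intros comp_intros)
  then obtain e' where e': "W e' = {x. x = prod_encode (index SidePi b ys e, list_encode ys)}" using sigma1_W by blast
  have \<beta>: "kleene_O \<beta>" "\<beta> \<noteq> 1" using assms(2) less_O not_less_one by blast+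
  have "\<exists>\<Theta>. has_index L SideSigma \<beta> [] e' \<Theta>"
    by (rule has_index_ex[OF \<beta>]) (use assms e' in auto)
  then obtain \<Theta> where \<Theta>: "has_index L SideSigma \<beta> [] e' \<Theta>" ..
  have "sat M \<Theta> v \<longleftrightarrow> (\<exists>u. sat M P u)" for M v
  proof -
    have "sat_side SideSigma M \<Theta> v \<longleftrightarrow> (\<exists>u. (\<forall>x. x \<notin> set ys \<longrightarrow> u x = v x) \<and> sat_side SideSigma M P u)"
      unfolding sat_side_iff[OF \<Theta> \<beta>(2)] e' using fm_of_index[OF assms(1)] by simp
    moreover have "\<exists>u'. (\<forall>x. x \<notin> set ys \<longrightarrow> u' x = v x) \<and> sat M P u'" if "sat M P u" for u
    proof -
      have "sat M P u \<longleftrightarrow> sat M P (\<lambda>x. if x \<in> set ys then u x else v x)"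
        by (rule sat_cong[OF assms(1)]) simp
      with that show ?thesis by (intro exI[of _ "\<lambda>x. if x \<in> set ys then u x else v x"]) simp
    qed
    ultimately show ?thesis unfolding sat_side_simps by blast
  qed
  with \<Theta> show ?thesis by blast
qed

text \<open>The prefix \<open>U\<close> binds all variables below \<open>N\<close> and those of the member \<open>k\<close> of \<open>W d\<close>. The level \<open>c\<close> ranges
  over all admissible ones because an upper bound cannot be computed when \<open>\<beta>\<close> is a limit.\<close>

definition ex_conj_member :: "nat \<Rightarrow> nat \<Rightarrow> nat \<Rightarrow> nat \<Rightarrow> nat \<Rightarrow> nat \<Rightarrow> nat \<Rightarrow> bool" where
  "ex_conj_member b y e \<beta> N d x \<longleftrightarrow> (\<exists>k u i b' y' e' c c' E. prod_encode (k, u) \<in> W d \<and>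
    k = prod_encode (i, prod_encode (b', prod_encode (y', e'))) \<and>
    leO b c \<and> leO b' c \<and> leO c c' \<and> nstep c' \<beta> \<and> conj_code c b y e b' y' e' E \<and>
    x = prod_encode (prod_encode (1, prod_encode (c, prod_encode (app_seg u 0 N, E))), app_seg u 0 N))"

text \<open>The conjunction with \<open>P\<close> is distributed over the disjunction
  \<open>\<Psi>\<close> and moved under the quantifiers of its members, where freshness prevents
  capture. Each \<open>P\<close> with a member is then \<Pi> at a common level \<open>c\<close>
  below \<beta>; different choices of \<open>c\<close> only add equivalent disjuncts.\<close>

lemma ex_conj_index:
  assumes P: "has_index L SidePi b ys e P" "set ys \<subseteq> {..<N}" "b <\<^sub>O \<beta>"
    and \<Psi>: "has_index L SideSigma \<beta> (segl 0 N) d \<Psi>" "fresh_members N d"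
  shows "\<exists>e' \<Theta>. has_index L SideSigma \<beta> [] e' \<Theta> \<and> (\<forall>M v. sat M \<Theta> v \<longleftrightarrow> (\<exists>u. sat M P u \<and> sat M \<Psi> u))"
proof -
  have "sigma1 (ex_conj_member b (list_encode ys) e \<beta> N d)"
    unfolding ex_conj_member_def conj_code_def
    by (intro sigma1_intros comp_intros computable_comp1[OF computable_conj_union])
  then obtain e' where W: "W e' = {x. ex_conj_member b (list_encode ys) e \<beta> N d x}" using sigma1_W by blast
  have \<beta>: "kleene_O \<beta>" "\<beta> \<noteq> 1" using P(3) less_O not_less_one by blast+
  let ?U = "\<lambda>us. segl 0 N @ us"
  \<comment> \<open>The c.e. form of \<open>c <\<^sub>O \<beta>\<close> used in
    \<open>ex_conj_member\<close>: climb to some \<open>c'\<close>, then make one last step to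
    \<beta>.\<close>
  have less: "(\<exists>c'. leO c c' \<and> nstep c' \<beta>) \<longleftrightarrow> c <\<^sub>O \<beta>" for c
    using nstepD[OF _ \<beta>(1)] le_less_O less_lastE by blast
  have child: "\<exists>Q. has_index L SidePi c (?U us) E Q \<and> (\<forall>M v. sat M Q v \<longleftrightarrow> sat M P v \<and> sat M (fm_of L k) v)"
    if "prod_encode (k, list_encode us) \<in> W d" "k = index SidePi b' ys' d'" "leO b c" "leO b' c" "c <\<^sub>O \<beta>"
      "conj_code c b (list_encode ys) e b' (list_encode ys') d' E" for k us b' ys' d' c E
  proof -
    from has_index_memberD[OF \<Psi>(1) \<beta>(2) that(1)] that(2)
    have "has_index L SidePi b' ys' d' (fm_of L k)" "set ys' \<subseteq> {..<N} \<union> set us" by auto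
    then show ?thesis
      using P(2) less_O[OF that(5)]
      by (intro conj_code_index[OF P(1) that(3) _ that(4) _ _ _ that(6)]) auto
  qed
  have mem: "prod_encode (j, list_encode ws) \<in> W e' \<longleftrightarrow> (\<exists>k us b' ys' d' c E. prod_encode (k, list_encode us) \<in> W d \<and>
      k = index SidePi b' ys' d' \<and> leO b c \<and> leO b' c \<and> c <\<^sub>O \<beta> \<and>
      conj_code c b (list_encode ys) e b' (list_encode ys') d' E \<and> j = index SidePi c (?U us) E \<and> ws = ?U us)" for j ws
  proof
    assume "prod_encode (j, list_encode ws) \<in> W e'"
    then obtain k u i b' y' d' c c' E where
      *: "prod_encode (k, u) \<in> W d" "k = prod_encode (i, prod_encode (b', prod_encode (y', d')))"
      "leO b c" "leO b' c" "leO c c'" "nstep c' \<beta>" "conj_code c b (list_encode ys) e b' y' d' E"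
      "j = prod_encode (1, prod_encode (c, prod_encode (app_seg u 0 N, E)))" "list_encode ws = app_seg u 0 N"
      unfolding W ex_conj_member_def by auto
    obtain us where us: "u = list_encode us" using list_encode_ex by blast
    from has_index_memberD[OF \<Psi>(1) \<beta>(2) *(1)[unfolded us]] obtain b'' ys' d'' where "k = index SidePi b'' ys' d''" by auto
    with *(2) have k: "k = index SidePi b' ys' d'" "y' = list_encode ys'" by (auto simp: index_def)
    have "c <\<^sub>O \<beta>" using less *(5,6) by blast
    moreover have "ws = ?U us" using *(9) by (simp only: us app_seg_list_encode list_encode_simps)
    moreover have "j = index SidePi c (?U us) E" using *(8) by (simp add: us app_seg_list_encode index_def)
    ultimately show "\<exists>k us b' ys' d' c E. prod_encode (k, list_encode us) \<in> W d \<and>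
      k = index SidePi b' ys' d' \<and> leO b c \<and> leO b' c \<and> c <\<^sub>O \<beta> \<and>
      conj_code c b (list_encode ys) e b' (list_encode ys') d' E \<and> j = index SidePi c (?U us) E \<and> ws = ?U us"
      using *(1,3,4,7) k unfolding us by blast
  next
    assume "\<exists>k us b' ys' d' c E. prod_encode (k, list_encode us) \<in> W d \<and>
      k = index SidePi b' ys' d' \<and> leO b c \<and> leO b' c \<and> c <\<^sub>O \<beta> \<and>
      conj_code c b (list_encode ys) e b' (list_encode ys') d' E \<and> j = index SidePi c (?U us) E \<and> ws = ?U us"
    then obtain k us b' ys' d' c E c' where
      *: "prod_encode (k, list_encode us) \<in> W d" "k = index SidePi b' ys' d'" "leO b c" "leO b' c"
      "conj_code c b (list_encode ys) e b' (list_encode ys') d' E" "j = index SidePi c (?U us) E" "ws = ?U us"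
      "leO c c'" "nstep c' \<beta>" unfolding less[symmetric] by blast
    show "prod_encode (j, list_encode ws) \<in> W e'"
      unfolding W mem_Collect_eq ex_conj_member_def
      by (rule exI[of _ k], rule exI[of _ "list_encode us"], rule exI[of _ 1], rule exI[of _ b'],
          rule exI[of _ "list_encode ys'"], rule exI[of _ d'], rule exI[of _ c], rule exI[of _ c'], rule exI[of _ E])
        (use * in \<open>simp add: app_seg_list_encode index_def\<close>)
  qed
  have "\<exists>\<Theta>. has_index L SideSigma \<beta> [] e' \<Theta>"
  proof (rule has_index_ex[OF \<beta>])
    fix j ws assume "prod_encode (j, list_encode ws) \<in> W e'"
    then show "\<exists>b ys d \<chi>. j = index (opp SideSigma) b ys d \<and> b <\<^sub>O \<beta> \<and> set ys \<subseteq> set [] \<union> set ws \<and> has_index L (opp SideSigma) b ys d \<chi>"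
      unfolding mem using child by fastforce
  qed
  then obtain \<Theta> where \<Theta>: "has_index L SideSigma \<beta> [] e' \<Theta>" ..
  have "sat M \<Theta> v \<longleftrightarrow> (\<exists>u. sat M P u \<and> sat M \<Psi> u)" for M v
  proof
    assume "sat M \<Theta> v"
    then obtain j ws u where "prod_encode (j, list_encode ws) \<in> W e'" and u: "sat M (fm_of L j) u"
      unfolding sat_side_iff[OF \<Theta> \<beta>(2), unfolded sat_side_simps] by blast
    then obtain k us b' ys' d' c E where
      *: "prod_encode (k, list_encode us) \<in> W d" "k = index SidePi b' ys' d'" "leO b c" "leO b' c" "c <\<^sub>O \<beta>"
      "conj_code c b (list_encode ys) e b' (list_encode ys') d' E" "j = index SidePi c (?U us) E" "ws = ?U us"
      unfolding mem by blast
    from child[OF *(1-6)] obtain Q where Q: "has_index L SidePi c (?U us) E Q"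
      "\<And>M v. sat M Q v \<longleftrightarrow> sat M P v \<and> sat M (fm_of L k) v" by blast
    with u *(7) have "sat M P u" "sat M (fm_of L k) u" using fm_of_index[OF Q(1)] by auto
    then have "sat M \<Psi> u"
      unfolding sat_side_iff[OF \<Psi>(1) \<beta>(2), unfolded sat_side_simps] using *(1) by blast
    then show "\<exists>u. sat M P u \<and> sat M \<Psi> u" using \<open>sat M P u\<close> by blast
  next
    assume "\<exists>u. sat M P u \<and> sat M \<Psi> u"
    then obtain w where w: "sat M P w" "sat M \<Psi> w" by blast
    then obtain k us u where k: "prod_encode (k, list_encode us) \<in> W d"
      and u: "\<forall>x. x \<notin> set us \<longrightarrow> u x = w x" "sat M (fm_of L k) u"
      unfolding sat_side_iff[OF \<Psi>(1) \<beta>(2), unfolded sat_side_simps] by blast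
    from has_index_memberD[OF \<Psi>(1) \<beta>(2) k] obtain b' ys' d' where
      k': "k = index SidePi b' ys' d'" "b' <\<^sub>O \<beta>" by auto
    obtain c where c: "c <\<^sub>O \<beta>" "leO b c" "leO b' c" using directed_below[OF P(3) k'(2)] by blast
    obtain E where E: "conj_code c b (list_encode ys) e b' (list_encode ys') d' E" using conj_code_ex by blast
    from child[OF k k'(1) c(2,3,1) E] obtain Q where Q: "has_index L SidePi c (?U us) E Q"
      "\<And>M v. sat M Q v \<longleftrightarrow> sat M P v \<and> sat M (fm_of L k) v" by blast
    \<comment> \<open>Freshness enters here: the tuple \<open>us\<close> avoids the variables of
      \<open>P\<close>, so the new witnesses leave \<open>P\<close> true.\<close>
    have "u x = w x" if "x \<in> set ys" for x
      using that u(1) P(2) \<Psi>(2) k unfolding fresh_members_def by blast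
    then have "sat M P u" using w(1) sat_cong[OF P(1)] by blast
    with u(2) Q(2) have "sat M Q u" by blast
    moreover define u' where "u' x = (if x \<in> set (?U us) then u x else v x)" for x
    ultimately have "sat M Q u'" using sat_cong[OF Q(1), of u u' M] by simp
    moreover have "prod_encode (index SidePi c (?U us) E, list_encode (?U us)) \<in> W e'"
      unfolding mem using k k'(1) c E by blast
    ultimately show "sat M \<Theta> v"
      unfolding sat_side_iff[OF \<Theta> \<beta>(2), unfolded sat_side_simps] using fm_of_index[OF Q(1)]
      by (intro exI[of _ "index SidePi c (?U us) E"] exI[of _ "?U us"] exI[of _ u']) (auto simp: u'_def)
  qed
  with \<Theta> show ?thesis by blast
qed

section \<open>Generic structures\<close>

text \<open>These assignments send variables of a formula to elements of the generic structure,
  which are variables again. Finite support keeps them countable, so a single sequence can treat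
  them all, and quantifiers change only finitely many values.\<close>

definition finsupp :: "(nat \<Rightarrow> nat) set" where "finsupp = {w. finite {x. w x \<noteq> 0}}"

lemma finsupp_cong: assumes "w \<in> finsupp" "\<And>x. x \<notin> set us \<Longrightarrow> u x = w x" shows "u \<in> finsupp"
proof -
  have "{x. u x \<noteq> 0} \<subseteq> {x. w x \<noteq> 0} \<union> set us" using assms(2) by auto
  then show ?thesis using assms(1) finite_subset unfolding finsupp_def by blast
qed

lemma countable_finsupp: "countable finsupp"
proof -
  have "finsupp \<subseteq> range (\<lambda>l x. if x < length l then l ! x else (0::nat))"
  proof
    fix w :: "nat \<Rightarrow> nat" assume "w \<in> finsupp"
    then have "finite {x. w x \<noteq> 0}" by (simp add: finsupp_def)
    then obtain m where "{x. w x \<noteq> 0} \<subseteq> {..<m}" using finite_nat_bounded by auto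
    then have "w = (\<lambda>x. if x < length (map w [0..<m]) then map w [0..<m] ! x else 0)" by (auto simp: fun_eq_iff)
    then show "w \<in> range (\<lambda>l x. if x < length l then l ! x else (0::nat))" by blast
  qed
  then show ?thesis by (rule countable_subset) simp
qed

text \<open>Forcing is plain implication in \<open>M\<close> over bijective assignments, with no
  recursion on formulas; its agreement with truth in the generic structure is the content of
  \<open>truth\<close>.\<close>

definition forces :: "struct \<Rightarrow> fm \<Rightarrow> ((nat \<Rightarrow> nat) \<Rightarrow> bool) \<Rightarrow> bool" where
  "forces M P S \<longleftrightarrow> (\<forall>v. bij v \<longrightarrow> sat M P v \<longrightarrow> S v)"

text \<open>The assumptions after \<open>p_mono\<close> are the dense sets to be met.
  \<open>p_side\<close> is a Henkin condition: either the formula is excluded on its side, or one of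
  its members is forced at named witnesses.\<close>

locale generic =
  fixes L :: lang and M :: struct and a :: nat and p :: "nat \<Rightarrow> fm"
  assumes p_sat: "\<And>n. \<exists>v. bij v \<and> sat M (p n) v"
    and p_mono: "\<And>n v. sat M (p (Suc n)) v \<Longrightarrow> sat M (p n) v"
    and p_fun: "\<And>f xs. funs L f = Some (length xs) \<Longrightarrow> \<exists>n k. forces M (p n) (\<lambda>v. fun_int M f (map v xs) = v k)"
    and p_rel: "\<And>r xs. rels L r = Some (length xs) \<Longrightarrow>
      \<exists>n. forces M (p n) (\<lambda>v. rel_int M r (map v xs)) \<or> forces M (p n) (\<lambda>v. \<not> rel_int M r (map v xs))"
    and p_side: "\<And>s b xs e \<phi> w. has_index L s b xs e \<phi> \<Longrightarrow> b \<noteq> 1 \<Longrightarrow> b <\<^sub>O a \<Longrightarrow> w \<in> finsupp \<Longrightarrow>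
      \<exists>n. forces M (p n) (\<lambda>v. \<not> sat_side s M \<phi> (v \<circ> w)) \<or>
        (\<exists>k us w'. prod_encode (k, list_encode us) \<in> W e \<and> w' \<in> finsupp \<and> (\<forall>x. x \<notin> set us \<longrightarrow> w' x = w x) \<and>
          forces M (p n) (\<lambda>v. sat_side s M (fm_of L k) (v \<circ> w')))"
begin

definition forced :: "((nat \<Rightarrow> nat) \<Rightarrow> bool) \<Rightarrow> bool" where
  "forced S \<longleftrightarrow> (\<exists>n. forces M (p n) S)"

lemma p_le: "m \<le> n \<Longrightarrow> sat M (p n) v \<Longrightarrow> sat M (p m) v"
  by (induction n rule: dec_induct) (auto dest: p_mono)

lemma forced_conj: assumes "forced S" "forced S'" shows "forced (\<lambda>v. S v \<and> S' v)"
proof -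
  obtain m n where "forces M (p m) S" "forces M (p n) S'" using assms unfolding forced_def by blast
  then have "forces M (p (max m n)) (\<lambda>v. S v \<and> S' v)"
    unfolding forces_def using p_le[of m "max m n"] p_le[of n "max m n"] by auto
  then show ?thesis unfolding forced_def by blast
qed

lemma forced_mono: "forced S \<Longrightarrow> (\<And>v. bij v \<Longrightarrow> S v \<Longrightarrow> S' v) \<Longrightarrow> forced S'"
  unfolding forced_def forces_def by blast

lemma forced_True: "(\<And>v. bij v \<Longrightarrow> S v) \<Longrightarrow> forced S"
  unfolding forced_def forces_def by blast

lemma forced_ex: "forced S \<Longrightarrow> \<exists>v. bij v \<and> S v"
  unfolding forced_def forces_def using p_sat by blast

lemma forced_consistent: "forced S \<Longrightarrow> \<not> forced (\<lambda>v. \<not> S v)"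
  using forced_ex[OF forced_conj[of S "\<lambda>v. \<not> S v"]] by blast

lemma forced_ball: "(\<And>t. t \<in> set ts \<Longrightarrow> forced (S t)) \<Longrightarrow> forced (\<lambda>v. \<forall>t\<in>set ts. S t v)"
proof (induction ts)
  case Nil show ?case by (rule forced_True) simp
next
  case (Cons t ts)
  then have "forced (\<lambda>v. S t v \<and> (\<forall>t\<in>set ts. S t v))" by (intro forced_conj) auto
  then show ?case by simp
qed

text \<open>The chosen \<open>k\<close> is unique, since two candidates would name the same value
  under a bijective assignment. So the variables themselves serve as elements.\<close>

definition K :: struct where
  "K = \<lparr>rel_int = \<lambda>r xs. rels L r = Some (length xs) \<and> forced (\<lambda>v. rel_int M r (map v xs)),
    fun_int = \<lambda>f xs. if funs L f = Some (length xs) then SOME k. forced (\<lambda>v. fun_int M f (map v xs) = v k) else 0\<rparr>"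

lemma K_Str: "K \<in> Str L"
  by (auto simp: K_def Str_def)

lemma forced_fun:
  assumes "funs L f = Some (length xs)" shows "forced (\<lambda>v. fun_int M f (map v xs) = v (fun_int K f xs))"
proof -
  have "\<exists>k. forced (\<lambda>v. fun_int M f (map v xs) = v k)" using p_fun[OF assms] unfolding forced_def by blast
  from someI_ex[OF this] show ?thesis by (simp add: K_def assms)
qed

lemma forced_trm: "trm_in L t \<Longrightarrow> forced (\<lambda>v. trm_val M (v \<circ> w) t = v (trm_val K w t))"
proof (induction t)
  case (Var i) show ?case by (rule forced_True) simp
next
  case (Fn f ts)
  have "forced (\<lambda>v. \<forall>t\<in>set ts. trm_val M (v \<circ> w) t = v (trm_val K w t))"
    using Fn by (intro forced_ball Fn.IH) auto
  moreover have "forced (\<lambda>v. fun_int M f (map v (map (trm_val K w) ts)) = v (fun_int K f (map (trm_val K w) ts)))"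
    by (rule forced_fun) (use Fn in simp)
  ultimately show ?case
  proof (rule forced_mono[OF forced_conj])
    fix v assume v: "(\<forall>t\<in>set ts. trm_val M (v \<circ> w) t = v (trm_val K w t)) \<and>
      fun_int M f (map v (map (trm_val K w) ts)) = v (fun_int K f (map (trm_val K w) ts))"
    then have "map (trm_val M (v \<circ> w)) ts = map v (map (trm_val K w) ts)"
      unfolding map_map map_eq_conv comp_apply[of v "trm_val K w"] by blast
    with v show "trm_val M (v \<circ> w) (Fn f ts) = v (trm_val K w (Fn f ts))" by (simp only: trm_val.simps)
  qed
qed

lemma forced_qf:
  "qf_in L \<theta> \<Longrightarrow> (qf_sat K w \<theta> \<longrightarrow> forced (\<lambda>v. qf_sat M (v \<circ> w) \<theta>)) \<and>
    (\<not> qf_sat K w \<theta> \<longrightarrow> forced (\<lambda>v. \<not> qf_sat M (v \<circ> w) \<theta>))"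
proof (induction \<theta>)
  case Bot then show ?case by (auto intro: forced_True)
next
  case (Eq s t)
  then have "forced (\<lambda>v. trm_val M (v \<circ> w) s = v (trm_val K w s) \<and> trm_val M (v \<circ> w) t = v (trm_val K w t))"
    by (intro forced_conj forced_trm) auto
  then have "forced (\<lambda>v. (trm_val M (v \<circ> w) s = trm_val M (v \<circ> w) t) = (trm_val K w s = trm_val K w t))"
    by (rule forced_mono) (auto dest: bij_is_inj injD)
  then show ?case by (cases "trm_val K w s = trm_val K w t") (simp_all add: comp_def)
next
  case (Rel r ts)
  have *: "forced (\<lambda>v. map (trm_val M (v \<circ> w)) ts = map v (map (trm_val K w) ts))"
  proof (rule forced_mono)
    show "forced (\<lambda>v. \<forall>t\<in>set ts. trm_val M (v \<circ> w) t = v (trm_val K w t))"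
      using Rel by (intro forced_ball forced_trm) auto
  qed (simp only: map_map map_eq_conv comp_apply)
  have len: "rels L r = Some (length (map (trm_val K w) ts))" using Rel by simp
  show ?case
  proof (cases "forced (\<lambda>v. rel_int M r (map v (map (trm_val K w) ts)))")
    case True
    then have "qf_sat K w (Rel r ts)" using len by (simp add: K_def)
    moreover have "forced (\<lambda>v. qf_sat M (v \<circ> w) (Rel r ts))"
      using forced_conj[OF True *] by (rule forced_mono) (simp only: qf_sat.simps)
    ultimately show ?thesis by blast
  next
    case False
    then have "\<not> qf_sat K w (Rel r ts)" by (simp add: K_def)
    moreover have "forced (\<lambda>v. \<not> rel_int M r (map v (map (trm_val K w) ts)))"
      using p_rel[OF len] False unfolding forced_def by blast
    from forced_conj[OF this *] have "forced (\<lambda>v. \<not> qf_sat M (v \<circ> w) (Rel r ts))"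
      by (rule forced_mono) (simp only: qf_sat.simps simp_thms)
    ultimately show ?thesis by blast
  qed
next
  case (Neg \<theta>) then show ?case by simp
next
  case (And \<theta> \<eta>)
  then show ?case
    by (cases "qf_sat K w \<theta>"; cases "qf_sat K w \<eta>") (auto intro: forced_conj elim: forced_mono)
next
  case (Or \<theta> \<eta>)
  then show ?case
    by (cases "qf_sat K w \<theta>"; cases "qf_sat K w \<eta>") (auto intro: forced_conj elim: forced_mono)
qed

text \<open>The forcing theorem. In the first case of \<open>p_side\<close>, a witness in
  \<open>K\<close> would by induction be forced, against consistency; in the second, the forced
  member is true in \<open>K\<close> by induction.\<close>

lemma truth:
  "has_index L s b xs e \<phi> \<Longrightarrow> b <\<^sub>O a \<Longrightarrow> w \<in> finsupp \<Longrightarrow>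
    (sat_side s K \<phi> w \<and> forced (\<lambda>v. sat_side s M \<phi> (v \<circ> w))) \<or>
    (\<not> sat_side s K \<phi> w \<and> forced (\<lambda>v. \<not> sat_side s M \<phi> (v \<circ> w)))"
proof (induction arbitrary: w rule: has_index_induct)
  case (zero \<theta> xs s)
  then show ?case using forced_qf[of \<theta> w]
    by (cases s; cases "qf_sat K w \<theta>") (simp_all add: sat_side_simps comp_def)
next
  case (step s b xs e \<phi>)
  have member: "(sat_side s K (fm_of L k) u \<and> forced (\<lambda>v. sat_side s M (fm_of L k) (v \<circ> u))) \<or>
      (\<not> sat_side s K (fm_of L k) u \<and> forced (\<lambda>v. \<not> sat_side s M (fm_of L k) (v \<circ> u)))"
    if "prod_encode (k, list_encode us) \<in> W e" "u \<in> finsupp" for k us u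
  proof -
    from step.IH[OF that(1)] obtain b' where "b' <\<^sub>O b" and
      IH: "\<And>w. b' <\<^sub>O a \<Longrightarrow> w \<in> finsupp \<Longrightarrow>
       (sat_side (opp s) K (fm_of L k) w \<and> forced (\<lambda>v. sat_side (opp s) M (fm_of L k) (v \<circ> w))) \<or>
       (\<not> sat_side (opp s) K (fm_of L k) w \<and> forced (\<lambda>v. \<not> sat_side (opp s) M (fm_of L k) (v \<circ> w)))" by blast
    then have "b' <\<^sub>O a" using step.prems less_trans by blast
    from IH[OF this that(2)] show ?thesis unfolding sat_side_opp by auto
  qed
  have lift: "sat_side s M \<phi> (v \<circ> w)"
    if "prod_encode (k, list_encode us) \<in> W e" "\<forall>x. x \<notin> set us \<longrightarrow> u x = w x" "sat_side s M (fm_of L k) (v \<circ> u)" for k us u v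
    unfolding step.hyps(4) using that by (intro exI[of _ k] exI[of _ us] exI[of _ "v \<circ> u"]) simp
  from p_side[OF step.hyps(1,3) step.prems] obtain n where
    "forces M (p n) (\<lambda>v. \<not> sat_side s M \<phi> (v \<circ> w)) \<or>
        (\<exists>k us w'. prod_encode (k, list_encode us) \<in> W e \<and> w' \<in> finsupp \<and> (\<forall>x. x \<notin> set us \<longrightarrow> w' x = w x) \<and>
          forces M (p n) (\<lambda>v. sat_side s M (fm_of L k) (v \<circ> w')))" by blast
  then show ?case
  proof (elim disjE exE conjE)
    assume "forces M (p n) (\<lambda>v. \<not> sat_side s M \<phi> (v \<circ> w))"
    then have neg: "forced (\<lambda>v. \<not> sat_side s M \<phi> (v \<circ> w))" unfolding forced_def by blast
    have "\<not> sat_side s K \<phi> w"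
    proof
      assume "sat_side s K \<phi> w"
      then obtain k us u where k: "prod_encode (k, list_encode us) \<in> W e" "\<forall>x. x \<notin> set us \<longrightarrow> u x = w x"
        "sat_side s K (fm_of L k) u" unfolding step.hyps(4) by blast
      have "u \<in> finsupp" by (rule finsupp_cong[OF step.prems(2)]) (use k(2) in blast)
      with member[OF k(1)] k(3) have "forced (\<lambda>v. sat_side s M (fm_of L k) (v \<circ> u))" by blast
      then have "forced (\<lambda>v. sat_side s M \<phi> (v \<circ> w))"
        by (rule forced_mono) (rule lift[OF k(1,2)])
      with neg forced_consistent show False by blast
    qed
    with neg show ?thesis by blast
  next
    fix k us w'
    assume k: "prod_encode (k, list_encode us) \<in> W e" "w' \<in> finsupp" "\<forall>x. x \<notin> set us \<longrightarrow> w' x = w x"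
      "forces M (p n) (\<lambda>v. sat_side s M (fm_of L k) (v \<circ> w'))"
    then have "forced (\<lambda>v. sat_side s M (fm_of L k) (v \<circ> w'))" unfolding forced_def by blast
    moreover from this have "sat_side s K (fm_of L k) w'" using member[OF k(1,2)] forced_consistent by blast
    then have "sat_side s K \<phi> w" unfolding step.hyps(4) using k by blast
    moreover have "forced (\<lambda>v. sat_side s M \<phi> (v \<circ> w))"
      using calculation(1) by (rule forced_mono) (rule lift[OF k(1,3)])
    ultimately show ?thesis by blast
  qed
qed

text \<open>\<open>truth\<close> does not reach level \<open>a\<close>. But a failure of the
  sentence in \<open>K\<close> is a failure of an instance of some conjunct, whose level is below
  \<open>a\<close>, and that failure would be forced.\<close>

lemma K_sentence:
  assumes "has_index L SidePi a [] e \<phi>" "a \<noteq> 1"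
    and "\<And>k us w. prod_encode (k, list_encode us) \<in> W e \<Longrightarrow> w \<in> finsupp \<Longrightarrow> \<not> forced (\<lambda>v. \<not> sat M (fm_of L k) (v \<circ> w))"
  shows "K \<in> Mod L \<phi>"
proof -
  have "sat K \<phi> (\<lambda>_. 0)"
  proof (rule ccontr)
    assume "\<not> sat K \<phi> (\<lambda>_. 0)"
    then obtain k us u where k: "prod_encode (k, list_encode us) \<in> W e" "\<forall>x. x \<notin> set us \<longrightarrow> u x = 0"
      "\<not> sat K (fm_of L k) u" using sat_side_iff[OF assms(1,2), of K "\<lambda>_. 0", unfolded sat_side_simps] by blast
    have u: "u \<in> finsupp"
      by (rule finsupp_cong[of "\<lambda>_. 0"]) (use k(2) in \<open>auto simp: finsupp_def\<close>)
    from has_index_memberD[OF assms(1,2) k(1)] obtain b ys d where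
      "b <\<^sub>O a" "has_index L SideSigma b ys d (fm_of L k)" by auto
    from truth[OF this(2,1) u] k(3) have "forced (\<lambda>v. \<not> sat M (fm_of L k) (v \<circ> u))" by (simp add: sat_side_simps)
    with assms(3)[OF k(1) u] show False by blast
  qed
  then have "sat K \<phi> v" for v using sat_cong[OF assms(1), of v "\<lambda>_. 0" K] by simp
  with K_Str show ?thesis unfolding Mod_def by blast
qed

end

section \<open>Construction of generic sequences\<close>

text \<open>The intermediate \<beta> is the level at which the existential closure of a condition is
  \<Sigma> while still below \<alpha>.\<close>

definition low :: "nat \<Rightarrow> nat \<Rightarrow> bool" where "low a b \<longleftrightarrow> (\<exists>\<beta>. b <\<^sub>O \<beta> \<and> \<beta> <\<^sub>O a)"

lemma low_directed:
  assumes "low a b" "low a b'" shows "\<exists>c. low a c \<and> kleene_O c \<and> leO b c \<and> leO b' c"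
proof -
  obtain \<beta> \<beta>' where \<beta>: "b <\<^sub>O \<beta>" "\<beta> <\<^sub>O a" "b' <\<^sub>O \<beta>'" "\<beta>' <\<^sub>O a" using assms unfolding low_def by blast
  obtain \<gamma> where \<gamma>: "\<gamma> <\<^sub>O a" "leO \<beta> \<gamma>" "leO \<beta>' \<gamma>" using directed_below \<beta> by blast
  then have "b <\<^sub>O \<gamma>" "b' <\<^sub>O \<gamma>" using \<beta> less_le_O less_O by blast+
  then obtain c where "c <\<^sub>O \<gamma>" "leO b c" "leO b' c" using directed_below by blast
  then show ?thesis using \<gamma>(1) less_O unfolding low_def by blast
qed

definition cond :: "lang \<Rightarrow> struct \<Rightarrow> nat \<Rightarrow> fm set" where
  "cond L M a = {P. (\<exists>b ys e. low a b \<and> has_index L SidePi b ys e P) \<and> (\<exists>v. bij v \<and> sat M P v)}"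

text \<open>Members of a formula of side \<open>s\<close> lie on the opposite side. If
  \<open>s\<close> is \<Sigma>, the member is \<Pi> and is merely renamed; if \<open>s\<close> is
  \<Pi>, it is \<Sigma> and is dualized. In both cases a \<Pi> formula is conjoined to the
  condition.\<close>

lemma cond_extend:
  assumes P: "P \<in> cond L M a" and \<chi>: "has_index L (opp s) b xs e \<chi>" "low a b"
    and v: "bij v" "sat M P v" "sat_side s M \<chi> (v \<circ> w)"
  shows "\<exists>Q\<in>cond L M a. (\<forall>v. sat M Q v \<longrightarrow> sat M P v) \<and> forces M Q (\<lambda>v. sat_side s M \<chi> (v \<circ> w))"
proof -
  obtain N where N: "\<And>x. x \<in> set xs \<Longrightarrow> w x < N"
    using finite_nat_bounded[of "w ` set xs"] by auto
  have "\<exists>e' \<chi>'. has_index L SidePi b (segl 0 N) e' \<chi>' \<and> (\<forall>M v. sat M \<chi>' v \<longleftrightarrow> sat_side s M \<chi> (v \<circ> w))"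
  proof (cases s)
    case SideSigma
    then show ?thesis using subst_index[where \<sigma>=w, OF \<chi>(1) N] by (auto simp: sat_side_simps)
  next
    case SidePi
    then show ?thesis using dual_index[where \<sigma>=w, OF \<chi>(1) N] by (auto simp: sat_side_simps)
  qed
  then obtain e' \<chi>' where \<chi>': "has_index L SidePi b (segl 0 N) e' \<chi>'"
    "\<And>M v. sat M \<chi>' v \<longleftrightarrow> sat_side s M \<chi> (v \<circ> w)" by blast
  obtain b' ys d where P': "low a b'" "has_index L SidePi b' ys d P" using P unfolding cond_def by blast
  obtain c where c: "low a c" "kleene_O c" "leO b' c" "leO b c" using low_directed[OF P'(1) \<chi>(2)] by blast
  from conj_index[OF P'(2) c(3) \<chi>'(1) c(4,2)] obtain d Q where
    Q: "has_index L SidePi c (ys @ segl 0 N) d Q" "\<And>M v. sat M Q v \<longleftrightarrow> sat M P v \<and> sat M \<chi>' v" by blast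
  have "Q \<in> cond L M a" unfolding cond_def using Q c(1) v \<chi>'(2) by blast
  then show ?thesis using Q(2) \<chi>'(2) unfolding forces_def by blast
qed

lemma cond_witness:
  assumes P: "P \<in> cond L M a" and \<phi>: "has_index L s b xs e \<phi>" "b \<noteq> 1" "b <\<^sub>O a" and w: "w \<in> finsupp"
  shows "\<exists>Q\<in>cond L M a. (\<forall>v. sat M Q v \<longrightarrow> sat M P v) \<and>
    (forces M Q (\<lambda>v. \<not> sat_side s M \<phi> (v \<circ> w)) \<or>
      (\<exists>k us w'. prod_encode (k, list_encode us) \<in> W e \<and> w' \<in> finsupp \<and> (\<forall>x. x \<notin> set us \<longrightarrow> w' x = w x) \<and>
        forces M Q (\<lambda>v. sat_side s M (fm_of L k) (v \<circ> w'))))"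
proof (cases "forces M P (\<lambda>v. \<not> sat_side s M \<phi> (v \<circ> w))")
  case True then show ?thesis using P by blast
next
  case False
  then obtain v where v: "bij v" "sat M P v" "sat_side s M \<phi> (v \<circ> w)" unfolding forces_def by blast
  then obtain k us u where k: "prod_encode (k, list_encode us) \<in> W e" and
    u: "\<forall>x. x \<notin> set us \<longrightarrow> u x = (v \<circ> w) x" "sat_side s M (fm_of L k) u"
    unfolding sat_side_iff[OF \<phi>(1,2)] by blast
  \<comment> \<open>Surjectivity of \<open>v\<close> provides a variable naming each witness in
    \<open>M\<close>.\<close>
  define w' where "w' x = (if x \<in> set us then inv v (u x) else w x)" for x
  have "v \<circ> w' = u" using u(1) v(1) by (auto simp: w'_def fun_eq_iff bij_is_surj surj_f_inv_f)
  moreover have "w' \<in> finsupp" by (rule finsupp_cong[OF w, of us]) (simp add: w'_def)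
  moreover have "\<forall>x. x \<notin> set us \<longrightarrow> w' x = w x" by (simp add: w'_def)
  moreover obtain b' ys d where k': "has_index L (opp s) b' ys d (fm_of L k)" "b' <\<^sub>O b"
    using has_index_memberD[OF \<phi>(1,2) k] by blast
  \<comment> \<open>The formula has level \<open>b\<close> below \<open>a\<close>, so
    \<open>b\<close> itself is the intermediate level for its members.\<close>
  moreover have "low a b'" using k'(2) \<phi>(3) unfolding low_def by blast
  ultimately show ?thesis using cond_extend[OF P k'(1) _ v(1,2), of w'] u(2) k by blast
qed

lemma cond_fun:
  assumes P: "P \<in> cond L M a" and "low a 1" "funs L f = Some (length xs)"
  shows "\<exists>Q\<in>cond L M a. (\<forall>v. sat M Q v \<longrightarrow> sat M P v) \<and> (\<exists>k. forces M Q (\<lambda>v. fun_int M f (map v xs) = v k))"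
proof -
  obtain v where v: "bij v" "sat M P v" using P unfolding cond_def by blast
  define k where "k = inv v (fun_int M f (map v xs))"
  let ?\<theta> = "Eq (Fn f (map Var xs)) (Var k)"
  have sat: "sat_side SideSigma M (Fin ?\<theta>) (u \<circ> (\<lambda>x. x)) \<longleftrightarrow> fun_int M f (map u xs) = u k" for u
    by (simp add: sat_side_simps comp_def)
  have "has_index L (opp SideSigma) 1 (k # xs) (qf_code ?\<theta>) (Fin ?\<theta>)"
    by (rule has_index.index_zero) (use assms(3) in auto)
  from cond_extend[OF P this assms(2) v, where w="\<lambda>x. x"] show ?thesis
    unfolding sat using v(1) by (auto simp: k_def bij_is_surj surj_f_inv_f)
qed

lemma cond_rel:
  assumes P: "P \<in> cond L M a" and "low a 1" "rels L r = Some (length xs)"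
  shows "\<exists>Q\<in>cond L M a. (\<forall>v. sat M Q v \<longrightarrow> sat M P v) \<and>
    (forces M Q (\<lambda>v. rel_int M r (map v xs)) \<or> forces M Q (\<lambda>v. \<not> rel_int M r (map v xs)))"
proof (cases "forces M P (\<lambda>v. \<not> rel_int M r (map v xs))")
  case True then show ?thesis using P by blast
next
  case False
  then obtain v where v: "bij v" "sat M P v" "rel_int M r (map v xs)" unfolding forces_def by blast
  let ?\<theta> = "Rel r (map Var xs)"
  have sat: "sat_side SideSigma M (Fin ?\<theta>) (u \<circ> (\<lambda>x. x)) \<longleftrightarrow> rel_int M r (map u xs)" for u
    by (simp add: sat_side_simps comp_def)
  have "has_index L (opp SideSigma) 1 xs (qf_code ?\<theta>) (Fin ?\<theta>)"
    by (rule has_index.index_zero) (use assms(3) in auto)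
  from cond_extend[OF P this assms(2) v(1,2), of "\<lambda>x. x"] show ?thesis
    unfolding sat using v(3) by blast
qed

text \<open>The Rasiowa-Sikorski construction for conditions \<open>C\<close> and countably many
  dense sets.\<close>

lemma generic_chain:
  assumes "countable \<D>" "P0 \<in> C" "\<And>P D. P \<in> C \<Longrightarrow> D \<in> \<D> \<Longrightarrow> \<exists>Q\<in>C. le Q P \<and> Q \<in> D" "\<And>P. le P P"
  shows "\<exists>p. (\<forall>n. p n \<in> C \<and> le (p (Suc n)) (p n)) \<and> (\<forall>D\<in>\<D>. \<exists>n. p n \<in> D)"
proof (cases "\<D> = {}")
  case True then show ?thesis using assms by (intro exI[of _ "\<lambda>_. P0"]) auto
next
  case False
  have "\<exists>p. \<forall>n. p n \<in> C \<and> (le (p (Suc n)) (p n) \<and> p (Suc n) \<in> from_nat_into \<D> n)"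
    by (rule dependent_nat_choice) (use assms from_nat_into[OF False] in blast)+
  then show ?thesis using from_nat_into_surj[OF assms(1)] by metis
qed

lemma generic_exists:
  assumes "low a 1" "P0 \<in> cond L M a"
  shows "\<exists>p. generic L M a p \<and> (\<forall>n. p n \<in> cond L M a)"
proof -
  define Df where "Df = (\<lambda>(f, xs). {P. funs L f = Some (length xs) \<longrightarrow> (\<exists>k. forces M P (\<lambda>v. fun_int M f (map v xs) = v k))})"
  define Dr where "Dr = (\<lambda>(r, xs). {P. rels L r = Some (length xs) \<longrightarrow>
    forces M P (\<lambda>v. rel_int M r (map v xs)) \<or> forces M P (\<lambda>v. \<not> rel_int M r (map v xs))})"
  \<comment> \<open>The side is represented by its code \<open>i\<close>, so that these sets are
    indexed by tuples of numbers and lists, a countable type.\<close>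
  define Ds where "Ds = (\<lambda>((i, b, xs, e), w). {P. \<forall>s \<phi>. side_code s = i \<longrightarrow> has_index L s b xs e \<phi> \<longrightarrow> b \<noteq> 1 \<longrightarrow> b <\<^sub>O a \<longrightarrow>
      forces M P (\<lambda>v. \<not> sat_side s M \<phi> (v \<circ> w)) \<or>
      (\<exists>k us w'. prod_encode (k, list_encode us) \<in> W e \<and> w' \<in> finsupp \<and> (\<forall>x. x \<notin> set us \<longrightarrow> w' x = w x) \<and>
        forces M P (\<lambda>v. sat_side s M (fm_of L k) (v \<circ> w')))})"
  let ?D = "range Df \<union> range Dr \<union> Ds ` (UNIV \<times> finsupp)"
  have "countable ?D" using countable_finsupp by simp
  then have "\<exists>p. (\<forall>n. p n \<in> cond L M a \<and> (\<forall>v. sat M (p (Suc n)) v \<longrightarrow> sat M (p n) v)) \<and> (\<forall>D\<in>?D. \<exists>n. p n \<in> D)"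
  proof (rule generic_chain[OF _ assms(2)])
    fix P D assume P: "P \<in> cond L M a" and "D \<in> ?D"
    then consider f xs where "D = Df (f, xs)" | r xs where "D = Dr (r, xs)"
      | i b xs e w where "D = Ds ((i, b, xs, e), w)" "w \<in> finsupp" by auto
    then show "\<exists>Q\<in>cond L M a. (\<forall>v. sat M Q v \<longrightarrow> sat M P v) \<and> Q \<in> D"
    proof cases
      case 1 then show ?thesis using cond_fun[OF P assms(1), of f xs] P unfolding Df_def by auto
    next
      case 2 then show ?thesis using cond_rel[OF P assms(1), of r xs] P unfolding Dr_def by auto
    next
      case 3
      show ?thesis
      proof (cases "\<exists>s \<phi>. side_code s = i \<and> has_index L s b xs e \<phi> \<and> b \<noteq> 1 \<and> b <\<^sub>O a")
        case True
        then obtain s \<phi> where s: "side_code s = i" "has_index L s b xs e \<phi>" "b \<noteq> 1" "b <\<^sub>O a" by blast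
        from cond_witness[OF P s(2-4) 3(2)] obtain Q where
          Q: "Q \<in> cond L M a" "\<forall>v. sat M Q v \<longrightarrow> sat M P v"
          "forces M Q (\<lambda>v. \<not> sat_side s M \<phi> (v \<circ> w)) \<or>
            (\<exists>k us w'. prod_encode (k, list_encode us) \<in> W e \<and> w' \<in> finsupp \<and> (\<forall>x. x \<notin> set us \<longrightarrow> w' x = w x) \<and>
            forces M Q (\<lambda>v. sat_side s M (fm_of L k) (v \<circ> w')))" by blast
        have "s' = s \<and> \<phi>' = \<phi>" if "side_code s' = i" "has_index L s' b xs e \<phi>'" for s' \<phi>'
          using that s(1,2) has_index_unique by (metis side_code_eq)
        then have "Q \<in> D" using Q(3) unfolding 3(1) Ds_def prod.case mem_Collect_eq by blast
        with Q show ?thesis by blast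
      next
        case False then show ?thesis using P unfolding 3(1) Ds_def by auto
      qed
    qed
  qed simp
  then obtain p where *: "\<forall>n. p n \<in> cond L M a \<and> (\<forall>v. sat M (p (Suc n)) v \<longrightarrow> sat M (p n) v)"
    "\<forall>D\<in>?D. \<exists>n. p n \<in> D" by (elim exE conjE)
  have p: "p n \<in> cond L M a" "sat M (p (Suc n)) v \<Longrightarrow> sat M (p n) v" for n v using *(1) by simp_all
  have D: "\<exists>n. p n \<in> D" if "D \<in> ?D" for D using *(2) that by (rule bspec)
  have "generic L M a p"
  proof
    show "\<exists>v. bij v \<and> sat M (p n) v" for n using p(1) unfolding cond_def by blast
    show "\<exists>n k. forces M (p n) (\<lambda>v. fun_int M f (map v xs) = v k)" if "funs L f = Some (length xs)" for f xs
    proof -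
      have "Df (f, xs) \<in> ?D" by blast
      from D[OF this] that show ?thesis unfolding Df_def by auto
    qed
    show "\<exists>n. forces M (p n) (\<lambda>v. rel_int M r (map v xs)) \<or> forces M (p n) (\<lambda>v. \<not> rel_int M r (map v xs))"
      if "rels L r = Some (length xs)" for r xs
    proof -
      have "Dr (r, xs) \<in> ?D" by blast
      from D[OF this] that show ?thesis unfolding Dr_def by auto
    qed
    show "\<exists>n. forces M (p n) (\<lambda>v. \<not> sat_side s M \<phi> (v \<circ> w)) \<or>
        (\<exists>k us w'. prod_encode (k, list_encode us) \<in> W e \<and> w' \<in> finsupp \<and> (\<forall>x. x \<notin> set us \<longrightarrow> w' x = w x) \<and>
          forces M (p n) (\<lambda>v. sat_side s M (fm_of L k) (v \<circ> w')))"
      if "has_index L s b xs e \<phi>" "b \<noteq> 1" "b <\<^sub>O a" "w \<in> finsupp" for s b xs e \<phi> w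
    proof -
      have "Ds ((side_code s, b, xs, e), w) \<in> ?D" using that(4) by blast
      from D[OF this] obtain n where "p n \<in> Ds ((side_code s, b, xs, e), w)" ..
      from this[unfolded Ds_def prod.case mem_Collect_eq, THEN spec, THEN spec, THEN mp, OF refl,
          THEN mp, OF that(1), THEN mp, OF that(2), THEN mp, OF that(3)]
      show ?thesis ..
    qed
  qed (fact p(2))
  with p(1) show ?thesis by blast
qed

section \<open>The separation theorem\<close>

text \<open>The complements of a finite domain and of its image are both infinite, hence in
  bijection.\<close>

lemma bij_extend:
  fixes u :: "nat \<Rightarrow> nat"
  assumes "inj_on u {..<m}" obtains v where "bij v" "\<And>i. i < m \<Longrightarrow> v i = u i"
proof -
  have inf: "infinite (UNIV - {..<m})" "infinite (UNIV - u ` {..<m})" by (simp_all add: Diff_infinite_finite)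
  have "bij_betw (from_nat_into (UNIV - u ` {..<m}) \<circ> to_nat_on (UNIV - {..<m})) (UNIV - {..<m}) (UNIV - u ` {..<m})"
    using inf by (intro bij_betw_trans[OF to_nat_on_infinite bij_betw_from_nat_into]) auto
  then obtain g where g: "bij_betw g (UNIV - {..<m}) (UNIV - u ` {..<m})" by blast
  define v where "v i = (if i \<in> {..<m} then u i else g i)" for i
  have "bij_betw v ({..<m} \<union> (UNIV - {..<m})) (u ` {..<m} \<union> (UNIV - u ` {..<m}))"
  proof (rule bij_betw_combine)
    show "bij_betw v {..<m} (u ` {..<m})"
      using assms by (subst bij_betw_cong[of _ _ u]) (auto simp: v_def bij_betw_def)
    show "bij_betw v (UNIV - {..<m}) (UNIV - u ` {..<m})"
      using g by (subst bij_betw_cong[of _ _ g]) (auto simp: v_def)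
  qed auto
  then have "bij v" by (simp add: Un_Diff_cancel)
  then show thesis by (rule that) (simp add: v_def)
qed

fun And_list :: "qf list \<Rightarrow> qf" where
  "And_list [] = Neg Bot"
| "And_list (\<theta> # \<theta>s) = And \<theta> (And_list \<theta>s)"

lemma And_list_simps:
  "qf_sat M v (And_list \<theta>s) \<longleftrightarrow> (\<forall>\<theta>\<in>set \<theta>s. qf_sat M v \<theta>)"
  "qf_in L (And_list \<theta>s) \<longleftrightarrow> (\<forall>\<theta>\<in>set \<theta>s. qf_in L \<theta>)"
  "qf_vars (And_list \<theta>s) = (\<Union>\<theta>\<in>set \<theta>s. qf_vars \<theta>)"
  by (induction \<theta>s) auto

definition distinct_vars :: "nat \<Rightarrow> qf" where
  "distinct_vars m = And_list [Neg (Eq (Var i) (Var j)). i \<leftarrow> [0..<m], j \<leftarrow> [0..<i]]"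

lemma qf_sat_distinct_vars: "qf_sat M v (distinct_vars m) \<longleftrightarrow> inj_on v {..<m}"
  unfolding distinct_vars_def And_list_simps inj_on_def
  by auto (metis atLeastLessThan_iff nat_neq_iff zero_le, metis lessThan_iff less_irrefl order.strict_trans)

lemma has_index_distinct_vars: "has_index L s 1 [0..<m] (qf_code (distinct_vars m)) (Fin (distinct_vars m))"
  by (rule has_index.index_zero) (auto simp: distinct_vars_def And_list_simps)

lemma sat_Conj_pair: "sat M (Conj (acset {\<phi>, \<psi>})) v \<longleftrightarrow> sat M \<phi> v \<and> sat M \<psi> v"
  unfolding sat_Conj_iff by (subst acset_inverse) auto

lemma member_sat:
  assumes "has_index L SidePi a xs e \<psi>" "a \<noteq> 1" "prod_encode (k, list_encode us) \<in> W e" "N \<in> Mod L \<psi>"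
  shows "sat N (fm_of L k) u"
  using assms(3,4) sat_side_iff[OF assms(1,2), of N u] unfolding sat_side_simps Mod_def by blast

text \<open>If a condition \<open>P\<close> were incompatible in \<open>M\<close> with an instance of the conjunct \<open>fm_of L k\<close> of \<open>\<psi>\<close>,
  then the realizability of \<open>P\<close> together with this incompatibility would be a d-\<open>\<Sigma>\<close> sentence true in \<open>M\<close>
  and refuting \<open>\<psi>\<close>.\<close>

lemma cond_compatible:
  assumes \<psi>: "has_index L SidePi a [] e \<psi>" "a \<noteq> 1" "prod_encode (k, list_encode us) \<in> W e"
    and P: "P \<in> cond L M a" and M: "M \<in> Str L"
    and no: "\<And>\<theta>. comp_d_Sigma_below L a [] \<theta> \<Longrightarrow> M \<in> Mod L \<theta> \<Longrightarrow> Mod L \<theta> \<inter> Mod L \<psi> \<noteq> {}"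
  shows "\<exists>v. bij v \<and> sat M P v \<and> sat M (fm_of L k) (v \<circ> w)"
proof -
  obtain b ys eP v0 where b: "low a b" and ys: "has_index L SidePi b ys eP P" and v0: "bij v0" "sat M P v0"
    using P unfolding cond_def by blast
  obtain bk xs d where bk: "bk <\<^sub>O a" and xs: "has_index L SideSigma bk xs d (fm_of L k)"
    using has_index_memberD[OF \<psi>] by auto
  obtain \<beta>' where \<beta>': "b <\<^sub>O \<beta>'" "\<beta>' <\<^sub>O a" using b unfolding low_def by blast
  \<comment> \<open>One level for both halves of the sentence: above \<open>b\<close>, and at least
    the level \<open>bk\<close> of the conjunct.\<close>
  obtain \<beta> where \<beta>: "\<beta> <\<^sub>O a" "leO \<beta>' \<beta>" "leO bk \<beta>" using directed_below[OF \<beta>'(2) bk] by blast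
  have O: "kleene_O \<beta>" "kleene_O b" using \<beta>(1) \<beta>'(1) less_O by blast+
  have b\<beta>: "b <\<^sub>O \<beta>" using less_le_O[OF \<beta>'(1) \<beta>(2) O(1)] .
  then have \<beta>1: "\<beta> \<noteq> 1" using not_less_one by blast
  obtain m where "set ys \<union> w ` set xs \<subseteq> {..<m}" using finite_nat_bounded[of "set ys \<union> w ` set xs"] by auto
  then have m: "set ys \<subseteq> {..<m}" "\<And>x. x \<in> set xs \<Longrightarrow> w x < m" by auto
  from subst_index[where \<sigma>=w, OF xs m(2)] obtain e1 \<Psi>1 where 1: "has_index L SideSigma bk (segl 0 m) e1 \<Psi>1"
    "\<And>M v. sat M \<Psi>1 v \<longleftrightarrow> sat M (fm_of L k) (v \<circ> w)" "bk \<noteq> 1 \<longrightarrow> fresh_members m e1" by auto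
  from lift_index[OF 1(1) \<beta>(3) O(1) \<beta>1 1(3)] obtain e2 \<Psi> where \<Psi>: "has_index L SideSigma \<beta> (segl 0 m) e2 \<Psi>"
    "fresh_members m e2" "\<And>M v. sat M \<Psi> v \<longleftrightarrow> sat M (fm_of L k) (v \<circ> w)" using 1(2) by blast
  \<comment> \<open>Bijectivity is replaced by distinctness of the variables below \<open>m\<close>,
    the only ones that occur. This is quantifier-free, so the level stays \<open>b\<close>.\<close>
  from conj_index[OF ys leO_refl has_index_distinct_vars[of L SidePi m] one_leO[OF O(2)] O(2)]
  obtain e3 Q where Q: "has_index L SidePi b (ys @ [0..<m]) e3 Q"
    "\<And>M v. sat M Q v \<longleftrightarrow> sat M P v \<and> inj_on v {..<m}" by (auto simp: qf_sat_distinct_vars)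
  from ex_index[OF Q(1) b\<beta>] obtain e4 \<Theta>1 where \<Theta>1: "has_index L SideSigma \<beta> [] e4 \<Theta>1"
    "\<And>M v. sat M \<Theta>1 v \<longleftrightarrow> (\<exists>u. sat M Q u)" by blast
  have "set (ys @ [0..<m]) \<subseteq> {..<m}" using m(1) by auto
  from ex_conj_index[OF Q(1) this b\<beta> \<Psi>(1,2)] obtain e5 \<Theta>2 where \<Theta>2: "has_index L SideSigma \<beta> [] e5 \<Theta>2"
    "\<And>M v. sat M \<Theta>2 v \<longleftrightarrow> (\<exists>u. sat M Q u \<and> sat M \<Psi> u)" by blast
  have "\<exists>e' \<phi>'. has_index L (opp SideSigma) \<beta> (segl 0 0) e' \<phi>' \<and> (\<forall>M v. sat M \<phi>' v \<longleftrightarrow> \<not> sat M \<Theta>2 (v \<circ> (\<lambda>x. x))) \<and>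
    (\<beta> \<noteq> 1 \<longrightarrow> fresh_members 0 e')" by (rule dual_index[OF \<Theta>2(1)]) simp
  then obtain e6 \<Theta>3 where \<Theta>3: "has_index L SidePi \<beta> [] e6 \<Theta>3"
    "\<And>M v. sat M \<Theta>3 v \<longleftrightarrow> \<not> (\<exists>u. sat M Q u \<and> sat M \<Psi> u)" by (auto simp: segl_def \<Theta>2(2))
  let ?\<theta> = "Conj (acset {\<Theta>1, \<Theta>3})"
  have \<theta>: "comp_d_Sigma_below L a [] ?\<theta>"
    unfolding comp_d_Sigma_below_def comp_d_Sigma_def comp_Sigma_def comp_Pi_def using \<beta>(1) \<Theta>1(1) \<Theta>3(1) by blast
  have sat\<theta>: "sat N ?\<theta> v \<longleftrightarrow> (\<exists>u. sat N Q u) \<and> \<not> (\<exists>u. sat N Q u \<and> sat N \<Psi> u)" for N v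
    by (simp only: sat_Conj_pair \<Theta>1(2) \<Theta>3(2))
  have "\<exists>u. sat M Q u" using v0 Q(2) bij_is_inj inj_on_subset by blast
  have "\<exists>u. sat M Q u \<and> sat M \<Psi> u"
  proof (rule ccontr)
    assume "\<not> ?thesis"
    with \<open>\<exists>u. sat M Q u\<close> M have "M \<in> Mod L ?\<theta>" unfolding Mod_def sat\<theta> by blast
    with no[OF \<theta>] obtain N where N: "N \<in> Mod L ?\<theta>" "N \<in> Mod L \<psi>" by blast
    from N(1) obtain u where "\<not> sat N \<Psi> u" unfolding Mod_def sat\<theta> by blast
    \<comment> \<open>Every model of \<psi> satisfies all instances of its conjuncts, so none of
      them can omit \<open>\<Psi>\<close>.\<close>
    with \<Psi>(3) member_sat[OF \<psi> N(2)] show False by blast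
  qed
  then obtain u where u: "sat M P u" "inj_on u {..<m}" "sat M (fm_of L k) (u \<circ> w)" unfolding Q(2) \<Psi>(3) by blast
  obtain v where v: "bij v" "\<And>i. i < m \<Longrightarrow> v i = u i" using bij_extend[OF u(2)] by blast
  have "sat M P v" using u(1) sat_cong[OF ys, of v u M] v(2) m(1) by auto
  moreover have "sat M (fm_of L k) (v \<circ> w)" using u(3) sat_cong[OF xs, of "v \<circ> w" "u \<circ> w" M] v(2) m(2) by auto
  ultimately show ?thesis using v(1) by blast
qed

lemma countable_comp_d_Sigma_below: "countable {\<theta>. comp_d_Sigma_below L a xs \<theta>}"
proof -
  have "{\<theta>. comp_d_Sigma_below L a xs \<theta>} \<subseteq> range (\<lambda>(i, j). Conj (acset {fm_of L i, fm_of L j}))"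
  proof
    fix \<theta> assume "\<theta> \<in> {\<theta>. comp_d_Sigma_below L a xs \<theta>}"
    then obtain b d e \<phi> \<psi> where "has_index L SideSigma b xs d \<phi>" "has_index L SidePi b xs e \<psi>" "\<theta> = Conj (acset {\<phi>, \<psi>})"
      unfolding comp_d_Sigma_below_def comp_d_Sigma_def comp_Sigma_def comp_Pi_def by blast
    then have "\<theta> = (\<lambda>(i, j). Conj (acset {fm_of L i, fm_of L j})) (index SideSigma b xs d, index SidePi b xs e)"
      using fm_of_index by simp
    then show "\<theta> \<in> range (\<lambda>(i, j). Conj (acset {fm_of L i, fm_of L j}))" by blast
  qed
  then show ?thesis by (rule countable_subset) simp
qed

lemma separating_sentence:
  assumes a: "low a 1" and \<phi>: "has_index L SidePi a [] d \<phi>" and \<psi>: "has_index L SidePi a [] e \<psi>"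
    and disj: "Mod L \<phi> \<inter> Mod L \<psi> = {}" and M: "M \<in> Mod L \<phi>"
  shows "\<exists>\<theta>. comp_d_Sigma_below L a [] \<theta> \<and> M \<in> Mod L \<theta> \<and> Mod L \<theta> \<inter> Mod L \<psi> = {}"
proof (rule ccontr)
  assume "\<not> ?thesis"
  then have no: "\<And>\<theta>. comp_d_Sigma_below L a [] \<theta> \<Longrightarrow> M \<in> Mod L \<theta> \<Longrightarrow> Mod L \<theta> \<inter> Mod L \<psi> \<noteq> {}" by blast
  have a1: "a \<noteq> 1" using a not_less_one unfolding low_def by blast
  have "has_index L SidePi 1 [] (qf_code (Neg Bot)) (Fin (Neg Bot))" by (rule has_index.index_zero) simp_all
  \<comment> \<open>The trivial condition, of level zero, starts the generic sequence.\<close>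
  then have "Fin (Neg Bot) \<in> cond L M a" using a bij_id unfolding cond_def by fastforce
  from generic_exists[OF a this] obtain p where p: "generic L M a p" "\<And>n. p n \<in> cond L M a" by blast
  interpret generic L M a p by (rule p(1))
  have "K \<in> Mod L \<phi>"
  proof (rule K_sentence[OF \<phi> a1])
    fix k us w assume "prod_encode (k, list_encode us) \<in> W d"
    from member_sat[OF \<phi> a1 this M] show "\<not> forced (\<lambda>v. \<not> sat M (fm_of L k) (v \<circ> w))"
      using forced_ex by blast
  qed
  moreover have "K \<in> Mod L \<psi>"
  proof (rule K_sentence[OF \<psi> a1])
    fix k us w assume k: "prod_encode (k, list_encode us) \<in> W e"
    have "M \<in> Str L" using M by (simp add: Mod_def)
    from cond_compatible[OF \<psi> a1 k p(2) this no]
    show "\<not> forced (\<lambda>v. \<not> sat M (fm_of L k) (v \<circ> w))" unfolding forced_def forces_def by blast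
  qed
  ultimately show False using disj by blast
qed

theorem theorem3p4:
  fixes L :: lang and a :: nat and A B :: "struct set"
  assumes "computable_lang L"
    and "kleene_O a" and "(natLeq_on 2, kleene_ord a) \<in> ordLeq"
    and "A \<subseteq> Str L" and "B \<subseteq> Str L" and "A \<inter> B = {}"
    and "\<exists>\<phi>. comp_Pi L a [] \<phi> \<and> A = Mod L \<phi>"
    and "\<exists>\<psi>. comp_Pi L a [] \<psi> \<and> B = Mod L \<psi>"
  shows "\<exists>S \<subseteq> Str L. A \<subseteq> S \<and> S \<inter> B = {} \<and>
    (\<exists>\<F>. countable \<F> \<and> (\<forall>X\<in>\<F>. \<exists>\<theta>. comp_d_Sigma_below L a [] \<theta> \<and> X = Mod L \<theta>) \<and> S = \<Union>\<F>)"
proof -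
  obtain b where b: "b <\<^sub>O a" "b \<noteq> 1" using exists_nonzero_below[OF assms(3)] by blast
  \<comment> \<open>Here \<alpha> \<ge> 2 is used: \<open>b\<close> lies strictly between the
    notation of zero and \<open>a\<close>.\<close>
  then have low: "low a 1" unfolding low_def using one_less less_O by blast
  obtain d \<phi> where \<phi>: "has_index L SidePi a [] d \<phi>" "A = Mod L \<phi>" using assms(7) unfolding comp_Pi_def by blast
  obtain e \<psi> where \<psi>: "has_index L SidePi a [] e \<psi>" "B = Mod L \<psi>" using assms(8) unfolding comp_Pi_def by blast
  \<comment> \<open>All admissible sentences without a model in \<open>B\<close> are taken at once;
    which of them covers a given member of \<open>A\<close> need not be selected.\<close>
  define \<F> where "\<F> = Mod L ` {\<theta>. comp_d_Sigma_below L a [] \<theta> \<and> Mod L \<theta> \<inter> B = {}}"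
  have "countable {\<theta>. comp_d_Sigma_below L a [] \<theta> \<and> Mod L \<theta> \<inter> B = {}}"
    by (rule countable_subset[OF _ countable_comp_d_Sigma_below[of L a "[]"]]) blast
  then have "countable \<F>" unfolding \<F>_def by (rule countable_image)
  moreover have "\<forall>X\<in>\<F>. \<exists>\<theta>. comp_d_Sigma_below L a [] \<theta> \<and> X = Mod L \<theta>" unfolding \<F>_def by blast
  moreover have "A \<subseteq> \<Union>\<F>"
    using separating_sentence[OF low \<phi>(1) \<psi>(1)] assms(6) unfolding \<phi>(2) \<psi>(2) \<F>_def by blast
  moreover have "\<Union>\<F> \<inter> B = {}" "\<Union>\<F> \<subseteq> Str L" unfolding \<F>_def by (auto simp: Mod_def)
  ultimately show ?thesis by blast
qed

end
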